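(* There exists an algorithm which, given a graph $G$ with a vertex cover of size $k$ and a constant $c$, solves $c$-balanced partitioning on $G$ in time $2^{2^{O(k+c)}}+2^k|V(G)|$.
   Context: Graphs are finite, simple, loopless. The $c$-balanced partitioning problem: given a graph $G$ and an integer $c$, find a partition of $V(G)$ into $c$ sets whose cardinalities pairwise differ by at most $1$, such that the number of edges whose endpoints lie in different sets is minimized (i.e. compute such an optimal partition / the minimum number of such edges). *)

theory Defs
  imports Main "HOL-Library.Disjoint_Sets"
begin

section \<open>Graphs, vertex covers, balanced partitions\<close>

definition simple_graph :: "'a set \<Rightarrow> 'a set set \<Rightarrow> bool" where
  "simple_graph V E \<longleftrightarrow> finite V \<and> (\<forall>e\<in>E. e \<subseteq> V \<and> card e = 2)"

definition vertex_cover :: "'a set \<Rightarrow> 'a set set \<Rightarrow> 'a set \<Rightarrow> bool" where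
  "vertex_cover V E S \<longleftrightarrow> S \<subseteq> V \<and> (\<forall>e\<in>E. e \<inter> S \<noteq> {})"

text \<open>
  The parts are indexed by the numbers below \<open>c\<close> and may be empty. Since the sizes differ by at
  most one, an empty part can only occur if \<open>c\<close> exceeds the number of vertices.
\<close>

definition balanced_partition :: "'a set \<Rightarrow> nat \<Rightarrow> (nat \<Rightarrow> 'a set) \<Rightarrow> bool" where
  "balanced_partition V c P \<longleftrightarrow>
     (\<Union>i<c. P i) = V \<and> disjoint_family_on P {..<c} \<and>
     (\<forall>i<c. \<forall>j<c. card (P i) \<le> card (P j) + 1)"

definition cut_edges :: "'a set set \<Rightarrow> nat \<Rightarrow> (nat \<Rightarrow> 'a set) \<Rightarrow> 'a set set" where
  "cut_edges E c P = {e\<in>E. \<exists>i<c. \<exists>j<c. i \<noteq> j \<and> e \<inter> P i \<noteq> {} \<and> e \<inter> P j \<noteq> {}}"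

definition optimal_balanced_partition ::
    "'a set \<Rightarrow> 'a set set \<Rightarrow> nat \<Rightarrow> (nat \<Rightarrow> 'a set) \<Rightarrow> bool" where
  "optimal_balanced_partition V E c P \<longleftrightarrow>
     balanced_partition V c P \<and>
     (\<forall>Q. balanced_partition V c Q \<longrightarrow> card (cut_edges E c P) \<le> card (cut_edges E c Q))"

section \<open>Algorithms: while programs on a random access memory\<close>

text \<open>
  The machine model is the uniform-cost random access machine with addition and truncated
  subtraction as its only arithmetic. The memory consists of named arrays of natural
  numbers; a program can only mention finitely many of them, and a scalar variable is cell 0 of an
  array. There is no unit-cost multiplication, so the numbers reached in \<open>t\<close> steps
  have only \<open>O(t)\<close> bits more than the input numbers.
\<close>

type_synonym state = "string \<Rightarrow> nat \<Rightarrow> nat"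

datatype aexp = Const nat | Cell string aexp | Plus aexp aexp | Minus aexp aexp

datatype bexp = Less aexp aexp | Not bexp | And bexp bexp

datatype com =
    Skip
  | Assign string aexp aexp  \<comment> \<open>array name, index, new value\<close>
  | Seq com com
  | If bexp com com
  | While bexp com

fun aval :: "aexp \<Rightarrow> state \<Rightarrow> nat" where
  "aval (Const n) s = n"
| "aval (Cell x i) s = s x (aval i s)"
| "aval (Plus a b) s = aval a s + aval b s"
| "aval (Minus a b) s = aval a s - aval b s"

fun bval :: "bexp \<Rightarrow> state \<Rightarrow> bool" where
  "bval (Less a b) s \<longleftrightarrow> aval a s < aval b s"
| "bval (Not b) s \<longleftrightarrow> \<not> bval b s"
| "bval (And a b) s \<longleftrightarrow> bval a s \<and> bval b s"

text \<open>One time unit is charged for every operation in an expression.\<close>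

fun acost :: "aexp \<Rightarrow> nat" where
  "acost (Const n) = 1"
| "acost (Cell x i) = acost i + 1"
| "acost (Plus a b) = acost a + acost b + 1"
| "acost (Minus a b) = acost a + acost b + 1"

fun bcost :: "bexp \<Rightarrow> nat" where
  "bcost (Less a b) = acost a + acost b + 1"
| "bcost (Not b) = bcost b + 1"
| "bcost (And a b) = bcost a + bcost b + 1"

text \<open>
  \<open>exec p s t s'\<close>: started in \<open>s\<close>, program \<open>p\<close> halts after exactly \<open>t\<close> time units in \<open>s'\<close>.
\<close>

inductive exec :: "com \<Rightarrow> state \<Rightarrow> nat \<Rightarrow> state \<Rightarrow> bool" where
  Skip: "exec Skip s 1 s"
| Assign: "exec (Assign x i a) s (acost i + acost a + 1)
             (s(x := (s x)(aval i s := aval a s)))"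
| Seq: "exec p s t s' \<Longrightarrow> exec q s' t' s'' \<Longrightarrow> exec (Seq p q) s (t + t') s''"
| IfTrue: "bval b s \<Longrightarrow> exec p s t s' \<Longrightarrow> exec (If b p q) s (bcost b + 1 + t) s'"
| IfFalse: "\<not> bval b s \<Longrightarrow> exec q s t s' \<Longrightarrow> exec (If b p q) s (bcost b + 1 + t) s'"
| WhileFalse: "\<not> bval b s \<Longrightarrow> exec (While b p) s (bcost b + 1) s"
| WhileTrue: "bval b s \<Longrightarrow> exec p s t s' \<Longrightarrow> exec (While b p) s' t' s'' \<Longrightarrow>
     exec (While b p) s (bcost b + 1 + t + t') s''"

inductive_cases exec_SkipE: "exec Skip s t s'"
inductive_cases exec_AssignE: "exec (Assign x i a) s t s'"
inductive_cases exec_SeqE: "exec (Seq p q) s t s'"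
inductive_cases exec_IfE: "exec (If b p q) s t s'"
inductive_cases exec_WhileE: "exec (While b p) s t s'"

lemma exec_deterministic:
  "exec p s t s' \<Longrightarrow> exec p s u s'' \<Longrightarrow> t = u \<and> s' = s''"
proof (induction arbitrary: u s'' rule: exec.induct)
  case (Skip s)
  then show ?case by (auto elim: exec_SkipE)
next
  case (Assign x i a s)
  then show ?case by (auto elim: exec_AssignE)
next
  case (Seq p s t s' q t' s1)
  from Seq.prems obtain v v' r where "exec p s v r" "exec q r v' s''" "u = v + v'"
    by (rule exec_SeqE)
  with Seq.IH show ?case by metis
next
  case (IfTrue b s p t s' q)
  from IfTrue.prems IfTrue.hyps obtain v where "exec p s v s''" "u = bcost b + 1 + v"
    by (auto elim: exec_IfE)
  with IfTrue.IH show ?case by metis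
next
  case (IfFalse b s q t s' p)
  from IfFalse.prems IfFalse.hyps obtain v where "exec q s v s''" "u = bcost b + 1 + v"
    by (auto elim: exec_IfE)
  with IfFalse.IH show ?case by metis
next
  case (WhileFalse b s p)
  from WhileFalse.prems WhileFalse.hyps show ?case by (auto elim: exec_WhileE)
next
  case (WhileTrue b s p t s' t' s1)
  from WhileTrue.prems WhileTrue.hyps obtain v v' r
    where "exec p s v r" "exec (While b p) r v' s''" "u = bcost b + 1 + v + v'"
    by (auto elim: exec_WhileE)
  with WhileTrue.IH show ?case by metis
qed

section \<open>Input and output\<close>

text \<open>
  The vertices are numbered by their positions in a list \<open>vs\<close>, and the adjacency
  lists \<open>adj\<close> contain vertex numbers, in any order.
\<close>

definition adjacency_lists ::
    "'a set \<Rightarrow> 'a set set \<Rightarrow> 'a list \<Rightarrow> nat list list \<Rightarrow> bool" where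
  "adjacency_lists V E vs adj \<longleftrightarrow>
     distinct vs \<and> set vs = V \<and> length adj = length vs \<and>
     (\<forall>i<length vs. distinct (adj ! i) \<and>
        set (adj ! i) = {j. j < length vs \<and> {vs ! i, vs ! j} \<in> E})"

definition array_of :: "nat list \<Rightarrow> nat \<Rightarrow> nat" where
  "array_of xs i = (if i < length xs then xs ! i else 0)"

text \<open>
  The adjacency lists are stored one after the other in the array \<open>adj\<close>; the list of vertex \<open>i\<close>
  occupies the cells from \<open>off[i]\<close> up to, but excluding, \<open>off[i+1]\<close>.
\<close>

definition input_state :: "nat list list \<Rightarrow> nat \<Rightarrow> state" where
  "input_state adj c = (\<lambda>_ _. 0)
     (''n'' := array_of [length adj],
      ''c'' := array_of [c],
      ''off'' := array_of (map (\<lambda>i. length (concat (take i adj))) [0..<Suc (length adj)]),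
      ''adj'' := array_of (concat adj))"

definition output_partition :: "'a list \<Rightarrow> state \<Rightarrow> nat \<Rightarrow> 'a set" where
  "output_partition vs s j = {vs ! i | i. i < length vs \<and> s ''part'' i = j}"

definition output_cut_size :: "state \<Rightarrow> nat" where
  "output_cut_size s = s ''cut'' 0"

end

theory Submission
  imports Defs "HOL-Library.Nat_Bijection"
begin

text \<open>
  A maximal matching gives a vertex cover of at most \<open>2k\<close> vertices. The remaining vertices fall into
  at most \<open>2\<^sup>2\<^sup>k\<close> classes of equal neighbourhoods, and each cover vertex is a class of its own. A balanced
  partition matters only through the numbers \<open>x A i\<close> of vertices of class \<open>A\<close> in part \<open>i\<close>, and for fixed
  parts of the cover vertices the cut size is linear in \<open>x\<close>. The matrices \<open>x\<close> are the integer solutions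
  of a transportation problem. Some optimal solution saturates a cell, that is,
  \<open>x A i = min (row sum) (column sum) > 0\<close>: otherwise its support contains a cycle, along which \<open>x\<close> can be
  changed by \<open>1\<close> in both directions without changing the cost, and one direction increases the sum of
  squares. By induction an optimum is found by a greedy procedure that saturates the cells in a suitable
  order, and with \<open>m\<close> classes \<open>m + c\<close> cells suffice. Trying all words of \<open>m + c\<close> cells takes doubly
  exponential time independent of the number of vertices, while the passes over the whole graph take
  time proportional to the number of vertices and edges, which is at most \<open>(k + 1) |V|\<close>.
\<close>

section \<open>Running time of while programs\<close>

text \<open>The cut size is not linear in \<open>x\<close> alone: an edge from a class to a cover
  vertex is cut unless both get the same column, and the column of the cover vertex is itself part
  of \<open>x\<close>. Since the cover vertices are rows of the same transportation problem, one
  word yields their columns together with the counts of all classes, so their parts are never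
  guessed separately. The good word exists for a profit that depends on an optimal partition; the
  program therefore tries every word and evaluates the true cut size of each complete run. The
  matching cover may have 2k vertices and give about 4^k classes, too many for a factor on |V|. So
  the class of a vertex is found by using the binary code of its neighbourhood, summed along its
  arcs, as an array address; the number of classes then enters only the doubly exponential term. The
  cover \<open>S\<close> and the number \<open>k\<close> are known to the analysis only. The machine
  cannot multiply: products become tables of repeated sums, powers become doublings, and division
  becomes repeated subtraction.\<close>

definition ht :: "com \<Rightarrow> state \<Rightarrow> (nat \<Rightarrow> state \<Rightarrow> bool) \<Rightarrow> bool" where
  "ht p s Q \<longleftrightarrow> (\<exists>t s'. exec p s t s' \<and> Q t s')"

lemma ht_mono: "ht p s Q \<Longrightarrow> (\<And>t s'. Q t s' \<Longrightarrow> R t s') \<Longrightarrow> ht p s R"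
  unfolding ht_def by blast

lemma exec_Skip_iff: "exec Skip s t s' \<longleftrightarrow> t = 1 \<and> s' = s"
  by (subst exec.simps) simp

lemma exec_Assign_iff:
  "exec (Assign x i a) s t s' \<longleftrightarrow>
     t = acost i + acost a + 1 \<and> s' = s(x := (s x)(aval i s := aval a s))"
  by (subst exec.simps) simp

lemma exec_Seq_iff:
  "exec (Seq p q) s t s'' \<longleftrightarrow>
     (\<exists>u u' s'. exec p s u s' \<and> exec q s' u' s'' \<and> t = u + u')"
  by (blast intro: exec.Seq elim: exec_SeqE)

lemma exec_If_iff:
  "exec (If b p q) s t s' \<longleftrightarrow>
     (\<exists>u. exec (if bval b s then p else q) s u s' \<and> t = bcost b + 1 + u)"
  by (cases "bval b s") (auto elim: exec_IfE dest: exec.IfTrue exec.IfFalse)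

lemma ht_Skip: "ht Skip s Q \<longleftrightarrow> Q 1 s"
  unfolding ht_def exec_Skip_iff by simp

lemma ht_Assign:
  "ht (Assign x i a) s Q \<longleftrightarrow>
     Q (acost i + acost a + 1) (s(x := (s x)(aval i s := aval a s)))"
  unfolding ht_def exec_Assign_iff by simp

text \<open>The postcondition also sees the time, so sequencing merely shifts it. Rewriting with
  \<open>ht_simps\<close> thus executes loop-free code symbolically and leaves one inequality
  between numerals.\<close>

lemma ht_Seq: "ht (Seq p q) s Q \<longleftrightarrow> ht p s (\<lambda>t s'. ht q s' (\<lambda>u. Q (t + u)))"
  unfolding ht_def exec_Seq_iff by metis

lemma ht_If:
  "ht (If b p q) s Q \<longleftrightarrow>
     (if bval b s then ht p s (\<lambda>t. Q (bcost b + 1 + t)) else ht q s (\<lambda>t. Q (bcost b + 1 + t)))"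
  unfolding ht_def exec_If_iff by auto

lemmas ht_simps = ht_Skip ht_Assign ht_Seq ht_If

lemma ht_SeqI:
  assumes "ht p s P" "\<And>t s'. P t s' \<Longrightarrow> ht q s' (\<lambda>u. Q (t + u))"
  shows "ht (Seq p q) s Q"
  unfolding ht_Seq using assms by (rule ht_mono)

lemma ht_Assign_SeqI:
  assumes "ht p (s(x := (s x)(aval i s := aval a s))) P"
    and "\<And>t s'. P t s' \<Longrightarrow> Q (acost i + acost a + 1 + t) s'"
  shows "ht (Seq (Assign x i a) p) s Q"
  unfolding ht_Seq ht_Assign using assms by (rule ht_mono)

section \<open>Arrays left unchanged by a program\<close>

fun writes :: "com \<Rightarrow> string set" where
  "writes Skip = {}"
| "writes (Assign x i a) = {x}"
| "writes (Seq p q) = writes p \<union> writes q"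
| "writes (If b p q) = writes p \<union> writes q"
| "writes (While b p) = writes p"

lemma exec_frame: "exec p s t s' \<Longrightarrow> x \<notin> writes p \<Longrightarrow> s' x = s x"
  by (induction rule: exec.induct) auto

text \<open>\<open>W\<close> lists the arrays that may have changed. With literal sets of names the
  simplifier decides which arrays persist.\<close>

definition agree :: "string set \<Rightarrow> state \<Rightarrow> state \<Rightarrow> bool" where
  "agree W s s' \<longleftrightarrow> (\<forall>x. x \<notin> W \<longrightarrow> s' x = s x)"

lemma agreeD: "agree W s s' \<Longrightarrow> x \<notin> W \<Longrightarrow> s' x = s x"
  by (simp add: agree_def)

lemma agree_refl: "agree W s s"
  by (simp add: agree_def)

lemma agree_trans: "agree W s s' \<Longrightarrow> agree W s' s'' \<Longrightarrow> agree W s s''"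
  by (simp add: agree_def)

text \<open>The variant \<open>f\<close> strictly decreases, so its initial value bounds the number
  of iterations, each costing at most \<open>d\<close> plus the test. The step may also assume that
  arrays not written by the body are those of loop entry, which keeps them out of the
  invariant.\<close>

lemma ht_While:
  assumes "I s"
    and step: "\<And>s'. I s' \<Longrightarrow> agree (writes p) s s' \<Longrightarrow> bval b s' \<Longrightarrow>
      ht p s' (\<lambda>t s''. t \<le> d \<and> I s'' \<and> f s'' < f s')"
  shows "ht (While b p) s (\<lambda>t s'. t \<le> f s * (d + bcost b + 1) + bcost b + 1 \<and> I s' \<and>
           agree (writes p) s s' \<and> \<not> bval b s')"
proof -
  let ?D = "d + bcost b + 1"
  have "I u \<Longrightarrow> agree (writes p) s u \<Longrightarrow> \<exists>t s'. exec (While b p) u t s' \<and>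
      t \<le> f u * ?D + bcost b + 1 \<and> I s' \<and> agree (writes p) s s' \<and> \<not> bval b s'" for u
  proof (induction "f u" arbitrary: u rule: less_induct)
    case less
    show ?case
    proof (cases "bval b u")
      case False
      have "exec (While b p) u (bcost b + 1) u"
        using False by (rule WhileFalse)
      then show ?thesis
        using less.prems False by (intro exI[of _ "bcost b + 1"] exI[of _ u]) auto
    next
      case True
      obtain t u' where u': "exec p u t u'" "t \<le> d" "I u'" "f u' < f u"
        using step[OF less.prems True] unfolding ht_def by blast
      have "agree (writes p) s u'"
        using less.prems(2) exec_frame[OF u'(1)] by (simp add: agree_def)
      then obtain t' s' where s': "exec (While b p) u' t' s'" "t' \<le> f u' * ?D + bcost b + 1"
          "I s'" "agree (writes p) s s'" "\<not> bval b s'"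
        using less.hyps[OF u'(4) u'(3)] by blast
      have "Suc (f u') * ?D \<le> f u * ?D"
        using u'(4) by (intro mult_le_mono1) simp
      then have "bcost b + 1 + t + t' \<le> f u * ?D + bcost b + 1"
        using u'(2) s'(2) by simp
      then show ?thesis
        using WhileTrue[OF True u'(1) s'(1)] s'(3-5) by blast
    qed
  qed
  from this[OF assms(1) agree_refl] show ?thesis
    unfolding ht_def by blast
qed

abbreviation Var :: "string \<Rightarrow> aexp" where
  "Var x \<equiv> Cell x (Const 0)"

abbreviation Set :: "string \<Rightarrow> aexp \<Rightarrow> com" where
  "Set x a \<equiv> Assign x (Const 0) a"

abbreviation Incr :: "string \<Rightarrow> com" where
  "Incr x \<equiv> Set x (Plus (Var x) (Const 1))"

fun Block :: "com list \<Rightarrow> com" where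
  "Block [] = Skip"
| "Block [p] = p"
| "Block (p # q # ps) = Seq p (Block (q # ps))"

section \<open>Transportation problems and greedy solutions\<close>

definition transport ::
    "nat \<Rightarrow> nat \<Rightarrow> (nat \<Rightarrow> nat) \<Rightarrow> (nat \<Rightarrow> nat) \<Rightarrow> (nat \<Rightarrow> nat \<Rightarrow> nat) \<Rightarrow> bool" where
  "transport m c r d x \<longleftrightarrow>
     (\<forall>A<m. (\<Sum>i<c. x A i) = r A) \<and> (\<forall>i<c. (\<Sum>A<m. x A i) = d i)"

definition profit ::
    "nat \<Rightarrow> nat \<Rightarrow> (nat \<Rightarrow> nat \<Rightarrow> nat) \<Rightarrow> (nat \<Rightarrow> nat \<Rightarrow> nat) \<Rightarrow> nat" where
  "profit m c g x = (\<Sum>A<m. \<Sum>i<c. g A i * x A i)"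

section \<open>Circulations in the support and saturated cells\<close>

lemma sum_of_bool_unique:
  fixes P :: "'a \<Rightarrow> bool"
  assumes "finite J" "\<And>j k. \<lbrakk>j \<in> J; k \<in> J; P j; P k\<rbrakk> \<Longrightarrow> j = k"
  shows "(\<Sum>j\<in>J. of_bool (P j) :: int) = of_bool (\<exists>j\<in>J. P j)"
proof (cases "\<exists>j\<in>J. P j")
  case True
  then obtain j where j: "j \<in> J" "P j" by blast
  have "(\<Sum>j\<in>J. of_bool (P j) :: int) = (\<Sum>k\<in>J. if k = j then 1 else 0)"
    using assms(2) j by (intro sum.cong) auto
  also have "\<dots> = 1"
    using assms(1) j by simp
  finally show ?thesis using True by simp
next
  case False
  then show ?thesis by simp
qed

text \<open>No positive cell is alone in its row or column, so one can walk through the support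
  forever, changing row and column in turn. Rows are finite in number, so a row recurs; the walk
  between two occurrences at minimal distance is a closed cycle, and alternating signs along it give
  zero row and column sums.\<close>

lemma alternating_cycle:
  fixes x :: "nat \<Rightarrow> nat \<Rightarrow> nat"
  assumes start: "A0 < m" "i0 < c" "x A0 i0 > 0"
    and row: "\<And>A i. \<lbrakk>A < m; i < c; x A i > 0\<rbrakk> \<Longrightarrow> \<exists>i'<c. i' \<noteq> i \<and> x A i' > 0"
    and col: "\<And>A i. \<lbrakk>A < m; i < c; x A i > 0\<rbrakk> \<Longrightarrow> \<exists>A'<m. A' \<noteq> A \<and> x A' i > 0"
  obtains y :: "nat \<Rightarrow> nat \<Rightarrow> int" where
    "\<And>A. A < m \<Longrightarrow> (\<Sum>i<c. y A i) = 0" "\<And>i. i < c \<Longrightarrow> (\<Sum>A<m. y A i) = 0"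
    "\<And>A i. \<bar>y A i\<bar> \<le> 1" "\<And>A i. x A i = 0 \<Longrightarrow> y A i = 0"
    "\<exists>A<m. \<exists>i<c. y A i \<noteq> 0"
proof -
  define P where "P = (\<lambda>(A, i). A < m \<and> i < c \<and> x A i > 0)"
  \<comment> \<open>Two moves at once: inside column \<open>i\<close> to another row, then inside
    that row to another column.\<close>
  define R where "R = (\<lambda>(A, i) (A', i'). A' \<noteq> A \<and> x A' i > 0 \<and> i' \<noteq> i)"
  have "\<exists>f. \<forall>n::nat. P (f n) \<and> R (f n) (f (Suc n))"
  proof (rule dependent_nat_choice)
    show "\<exists>z. P z" using start unfolding P_def by auto
    fix z :: "nat \<times> nat" and n :: nat
    assume "P z"
    then obtain A i where z: "z = (A, i)" "A < m" "i < c" "x A i > 0"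
      unfolding P_def by auto
    obtain A' where A': "A' < m" "A' \<noteq> A" "x A' i > 0" using col z by blast
    obtain i' where "i' < c" "i' \<noteq> i" "x A' i' > 0" using row A' z by blast
    with A' z show "\<exists>z'. P z' \<and> R z z'"
      unfolding P_def R_def by (intro exI[of _ "(A', i')"]) auto
  qed
  then obtain f :: "nat \<Rightarrow> nat \<times> nat" where f: "\<And>n. P (f n)" "\<And>n. R (f n) (f (Suc n))"
    by blast
  define T where "T n = fst (f n)" for n
  define I where "I n = snd (f n)" for n
  have TI: "T n < m" "I n < c" "x (T n) (I n) > 0"
      "T (Suc n) \<noteq> T n" "x (T (Suc n)) (I n) > 0" "I (Suc n) \<noteq> I n" for n
    using f(1)[of n] f(2)[of n] unfolding P_def R_def T_def I_def case_prod_beta by simp_all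
  have "\<not> inj T"
  proof
    assume "inj T"
    moreover have "finite (range T)"
      by (rule finite_subset[of _ "{..<m}"]) (use TI in auto)
    ultimately show False using finite_imageD by blast
  qed
  then obtain a b where "T a = T b" "a < b"
    unfolding inj_def by (metis linorder_neqE_nat)
  then have ex: "\<exists>d>0. \<exists>a. T a = T (a + d)"
    by (intro exI[of _ "b - a"] conjI exI[of _ a]) auto
  \<comment> \<open>The minimal distance makes the rows of one period pairwise distinct, so no cell
    is counted twice and the entries of \<open>y\<close> stay within -1, 0, 1.\<close>
  define D where "D = (LEAST d. d > 0 \<and> (\<exists>a. T a = T (a + d)))"
  have D: "D > 0" "\<exists>a. T a = T (a + D)"
    using LeastI_ex[OF ex] unfolding D_def by auto
  have D_le: "D \<le> d" if "d > 0" "T a = T (a + d)" for d a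
    unfolding D_def using that by (intro Least_le) auto
  obtain a where a: "T a = T (a + D)" using D(2) by blast
  have "D \<noteq> 1" using a TI(4)[of a] by auto
  with D(1) have D2: "D \<ge> 2" by simp
  define T' where "T' j = T (a + j)" for j
  define I' where "I' j = I (a + j)" for j
  have inj1: "j = k" if "j < D" "k < D" "T' j = T' k" for j k
  proof (rule ccontr)
    assume "j \<noteq> k"
    then consider "j < k" | "k < j" by linarith
    then show False
    proof cases
      case 1
      then show False using D_le[of "k - j" "a + j"] that unfolding T'_def by simp
    next
      case 2
      then show False using D_le[of "j - k" "a + k"] that unfolding T'_def by simp
    qed
  qed
  have per: "T' D = T' 0" using a unfolding T'_def by simp
  have inj2: "j = k" if "j < D" "k < D" "T' (Suc j) = T' (Suc k)" for j k
  proof -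
    have eq: "T' (if Suc j = D then 0 else Suc j) = T' (if Suc k = D then 0 else Suc k)"
      using that per by auto
    have "(if Suc j = D then 0 else Suc j) = (if Suc k = D then 0 else Suc k)"
      by (rule inj1[OF _ _ eq]) (use that in auto)
    then show ?thesis by (auto split: if_splits)
  qed
  \<comment> \<open>\<open>y1\<close> counts the cells from which a column is entered,
    \<open>y2\<close> the cells in the next row of the same column; the circulation is
    \<open>y1 - y2\<close>.\<close>
  define y1 where "y1 A i = (\<Sum>j<D. of_bool (A = T' j \<and> i = I' j) :: int)" for A i
  define y2 where "y2 A i = (\<Sum>j<D. of_bool (A = T' (Suc j) \<and> i = I' j) :: int)" for A i
  have y1: "y1 A i = of_bool (\<exists>j\<in>{..<D}. A = T' j \<and> i = I' j)" for A i
    unfolding y1_def by (rule sum_of_bool_unique) (use inj1 in auto)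
  have y2: "y2 A i = of_bool (\<exists>j\<in>{..<D}. A = T' (Suc j) \<and> i = I' j)" for A i
    unfolding y2_def by (rule sum_of_bool_unique) (use inj2 in auto)
  have TI': "T' n < m" "I' n < c" "x (T' n) (I' n) > 0" "x (T' (Suc n)) (I' n) > 0"
      "I' (Suc n) \<noteq> I' n" for n
    unfolding T'_def I'_def add_Suc_right by (fact TI)+
  show ?thesis
  proof
    fix A assume "A < m"
    have r1: "(\<Sum>i<c. of_bool (B \<and> i = I' j)) = (of_bool B :: int)" for B j
      using TI'(2)[of j] by (simp add: of_bool_def if_distrib sum.If_cases)
    \<comment> \<open>In a row the contributions telescope over the period, and the walk ends in the
      row in which it began.\<close>
    have "(\<Sum>i<c. y1 A i - y2 A i) =
        (\<Sum>j<D. of_bool (A = T' j) - of_bool (A = T' (Suc j)))"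
      unfolding sum_subtractf y1_def y2_def
      by (subst (1 2) sum.swap) (simp add: r1)
    also have "\<dots> = of_bool (A = T' 0) - of_bool (A = T' D)"
      by (rule sum_lessThan_telescope')
    finally show "(\<Sum>i<c. y1 A i - y2 A i) = 0" using per by simp
  next
    fix i assume "i < c"
    have r1: "(\<Sum>A<m. of_bool (A = T' j \<and> B)) = (of_bool B :: int)" for B j
      using TI'(1)[of j] by (simp add: of_bool_def if_distrib sum.If_cases)
    \<comment> \<open>In a column each index \<open>j\<close> with \<open>I' j = i\<close>
      contributes one cell to \<open>y1\<close> and one to \<open>y2\<close>.\<close>
    show "(\<Sum>A<m. y1 A i - y2 A i) = 0"
      unfolding sum_subtractf y1_def y2_def
      by (subst (1 2) sum.swap) (simp add: r1)
  next
    show "\<bar>y1 A i - y2 A i\<bar> \<le> 1" for A i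
      unfolding y1 y2 by (simp add: of_bool_def)
  next
    show "y1 A i - y2 A i = 0" if "x A i = 0" for A i
    proof -
      have "\<not> (\<exists>j\<in>{..<D}. A = T' j \<and> i = I' j)" "\<not> (\<exists>j\<in>{..<D}. A = T' (Suc j) \<and> i = I' j)"
        using that TI'(3,4) by (metis less_irrefl)+
      then show ?thesis unfolding y1 y2 by (simp only: of_bool_eq(1) diff_self)
    qed
  next
    \<comment> \<open>Index 1 avoids the wrap-around: only the move from index 0 leads into row
      \<open>T' 1\<close>, and it does so in column \<open>I' 0\<close>, which differs from
      \<open>I' 1\<close>.\<close>
    have "y1 (T' 1) (I' 1) = 1" unfolding y1 using D2 by auto
    moreover have "y2 (T' 1) (I' 1) = 0"
    proof -
      have "\<not> (T' 1 = T' (Suc j) \<and> I' 1 = I' j)" if "j < D" for j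
        using inj2[of 0 j] that D2 TI'(5)[of 0] by auto
      then show ?thesis unfolding y2 by auto
    qed
    ultimately show "\<exists>A<m. \<exists>i<c. y1 A i - y2 A i \<noteq> 0"
      using TI' by (intro exI[of _ "T' 1"] conjI exI[of _ "I' 1"]) auto
  qed
qed

lemma transport_le:
  assumes "transport m c r d x" "A < m" "i < c"
  shows "x A i \<le> r A" "x A i \<le> d i"
proof -
  have "x A i \<le> (\<Sum>i<c. x A i)" using assms by (intro member_le_sum) auto
  then show "x A i \<le> r A" using assms unfolding transport_def by auto
  have "x A i \<le> (\<Sum>A<m. x A i)" using assms by (intro member_le_sum) auto
  then show "x A i \<le> d i" using assms unfolding transport_def by auto
qed

lemma profit_bounded:
  assumes "transport m c r d x"
  shows "profit m c g x \<le> (\<Sum>A<m. \<Sum>i<c. g A i * r A)"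
  unfolding profit_def using transport_le[OF assms] by (intro sum_mono mult_le_mono2) auto

lemma saturated_cell:
  assumes x0: "transport m c r d x0" and pos: "A0 < m" "r A0 > 0"
  obtains x A i where "transport m c r d x" "profit m c g x0 \<le> profit m c g x"
    "A < m" "i < c" "x A i > 0" "x A i = min (r A) (d i)"
proof -
  obtain x1 where x1: "transport m c r d x1"
      "\<And>x. transport m c r d x \<Longrightarrow> profit m c g x \<le> profit m c g x1"
    using ex_has_greatest_nat[of "transport m c r d" x0 "profit m c g", OF x0,
        of "Suc (\<Sum>A<m. \<Sum>i<c. g A i * r A)"] profit_bounded[of m c r d _ g]
    by (auto simp: less_Suc_eq_le)
  let ?P = "\<lambda>x. transport m c r d x \<and> profit m c g x = profit m c g x1"
  \<comment> \<open>The sum of squares is the profit of \<open>x\<close> with \<open>x\<close>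
    itself as weight matrix. Maximising it among the solutions of maximal profit excludes
    cycles.\<close>
  let ?sq = "\<lambda>x. profit m c x x"
  have "\<exists>x. ?P x \<and> (\<forall>y. ?P y \<longrightarrow> ?sq y \<le> ?sq x)"
  proof (rule ex_has_greatest_nat)
    show "?P x1" using x1 by simp
    show "\<forall>y. ?P y \<longrightarrow> ?sq y < Suc (\<Sum>A<m. \<Sum>i<c. r A * r A)"
      unfolding profit_def less_Suc_eq_le
      by (intro allI impI sum_mono mult_le_mono) (auto dest: transport_le(1))
  qed
  then obtain x where x: "transport m c r d x" "profit m c g x = profit m c g x1"
      "\<And>y. ?P y \<Longrightarrow> ?sq y \<le> ?sq x"
    by blast
  have "\<exists>A<m. \<exists>i<c. x A i > 0 \<and> x A i = min (r A) (d i)"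
  proof (rule ccontr)
    assume non: "\<not> ?thesis"
    have lt: "x A i < r A" "x A i < d i" if "A < m" "i < c" "x A i > 0" for A i
    proof -
      have "x A i \<noteq> min (r A) (d i)" using non that by blast
      then show "x A i < r A" "x A i < d i" using transport_le[OF x(1) that(1,2)] by linarith+
    qed
    have sums: "(\<Sum>i<c. x A i) = r A" "(\<Sum>A<m. x A i) = d i" if "A < m" "i < c" for A i
      using x(1) that unfolding transport_def by auto
    have "\<exists>i0<c. x A0 i0 > 0"
    proof (rule ccontr)
      assume "\<not> ?thesis"
      then have "(\<Sum>i<c. x A0 i) = 0" by simp
      then show False using x(1) pos unfolding transport_def by auto
    qed
    then obtain i0 where i0: "i0 < c" "x A0 i0 > 0" by blast
    \<comment> \<open>A positive cell that stays below the row sum leaves a remainder, which must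
      sit in another cell of the row; columns are treated in the same way.\<close>
    have others_row: "\<exists>i'<c. i' \<noteq> i \<and> x A i' > 0" if *: "A < m" "i < c" "x A i > 0" for A i
    proof (rule ccontr)
      assume "\<not> ?thesis"
      then have "(\<Sum>i'<c. x A i') = (\<Sum>i'<c. if i' = i then x A i else 0)"
        by (intro sum.cong) auto
      then show False using sums(1)[OF *(1,2)] lt[OF *] * by simp
    qed
    have others_col: "\<exists>A'<m. A' \<noteq> A \<and> x A' i > 0" if *: "A < m" "i < c" "x A i > 0" for A i
    proof (rule ccontr)
      assume "\<not> ?thesis"
      then have "(\<Sum>A'<m. x A' i) = (\<Sum>A'<m. if A' = A then x A i else 0)"
        by (intro sum.cong) auto
      then show False using sums(2)[OF *(1,2)] lt[OF *] * by simp
    qed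
    obtain y :: "nat \<Rightarrow> nat \<Rightarrow> int" where y: "\<And>A. A < m \<Longrightarrow> (\<Sum>i<c. y A i) = 0"
        "\<And>i. i < c \<Longrightarrow> (\<Sum>A<m. y A i) = 0"
        "\<And>A i. \<bar>y A i\<bar> \<le> 1" "\<And>A i. x A i = 0 \<Longrightarrow> y A i = 0"
        "\<exists>A<m. \<exists>i<c. y A i \<noteq> 0"
      by (rule alternating_cycle[of A0 m i0 c x, OF pos(1) i0 others_row others_col]; blast intro: that)
    define shift where "shift e A i = nat (int (x A i) + e * y A i)" for e A i
    have sh: "int (shift e A i) = int (x A i) + e * y A i" if "e = 1 \<or> e = -1" for e A i
    proof -
      \<comment> \<open>\<open>y\<close> vanishes where \<open>x\<close> does and is at least -1
        elsewhere, so the truncation by \<open>nat\<close> is harmless.\<close>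
      have "0 \<le> int (x A i) + e * y A i"
        using y(3)[of A i] y(4)[of A i] that by (cases "x A i = 0") auto
      then show ?thesis unfolding shift_def by simp
    qed
    have tr: "transport m c r d (shift e)" if e: "e = 1 \<or> e = -1" for e
      unfolding transport_def
    proof (intro conjI allI impI)
      fix A assume "A < m"
      then have "int (\<Sum>i<c. shift e A i) = int (r A)"
        using x(1) y(1) by (simp add: sh[OF e] sum.distrib flip: sum_distrib_left)
          (simp add: transport_def flip: of_nat_sum)
      then show "(\<Sum>i<c. shift e A i) = r A" by (simp only: of_nat_eq_iff)
    next
      fix i assume "i < c"
      then have "int (\<Sum>A<m. shift e A i) = int (d i)"
        using x(1) y(2) by (simp add: sh[OF e] sum.distrib flip: sum_distrib_left)
          (simp add: transport_def flip: of_nat_sum)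
      then show "(\<Sum>A<m. shift e A i) = d i" by (simp only: of_nat_eq_iff)
    qed
    define \<Delta> where "\<Delta> = (\<Sum>A<m. \<Sum>i<c. int (g A i) * y A i)"
    have pr: "int (profit m c g (shift e)) = int (profit m c g x) + e * \<Delta>"
      if e: "e = 1 \<or> e = -1" for e
      unfolding profit_def \<Delta>_def
      by (simp add: sh[OF e] distrib_left sum.distrib sum_distrib_left mult.left_commute)
    have le: "int (profit m c g x) + e * \<Delta> \<le> int (profit m c g x)"
      if e: "e = 1 \<or> e = -1" for e
      using x1(2)[OF tr[OF e]] x(2) pr[OF e] by simp
    have "\<Delta> = 0" using le[of 1] le[of "-1"] by simp
    then have P: "?P (shift e)" if e: "e = 1 \<or> e = -1" for e
      using tr[OF e] pr[OF e] x(2) by simp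
    have sq: "?sq (shift 1) + ?sq (shift (-1)) \<le> 2 * ?sq x"
      using x(3)[OF P[of 1]] x(3)[OF P[of "-1"]] by simp
    \<comment> \<open>Parallelogram identity: (x + y)^2 + (x - y)^2 = 2 x^2 + 2 y^2, so a nonzero
      \<open>y\<close> makes one of the two shifts have a larger sum of squares.\<close>
    have "int (?sq (shift 1) + ?sq (shift (-1))) =
        (\<Sum>A<m. \<Sum>i<c. 2 * (int (x A i) * int (x A i)) + 2 * (y A i * y A i))"
      unfolding profit_def by (simp add: sh flip: sum.distrib) (simp add: algebra_simps)
    also have "\<dots> = 2 * int (?sq x) + 2 * (\<Sum>A<m. \<Sum>i<c. y A i * y A i)"
      unfolding profit_def by (simp add: sum.distrib sum_distrib_left)
    finally have "(\<Sum>A<m. \<Sum>i<c. y A i * y A i) \<le> 0" using sq by linarith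
    moreover have "(\<Sum>A<m. \<Sum>i<c. y A i * y A i) > 0"
    proof -
      obtain A i where Ai: "A < m" "i < c" "y A i \<noteq> 0" using y(5) by blast
      have "0 < y A i * y A i" using Ai(3) by (simp add: zero_less_mult_iff) linarith
      also have "\<dots> \<le> (\<Sum>i<c. y A i * y A i)"
        using Ai by (intro member_le_sum) auto
      also have "\<dots> \<le> (\<Sum>A<m. \<Sum>i<c. y A i * y A i)"
        using Ai by (intro member_le_sum[of A _ "\<lambda>A. \<Sum>i<c. y A i * y A i"]) (auto intro: sum_nonneg)
      finally show ?thesis .
    qed
    ultimately show False by simp
  qed
  then show ?thesis using that x x1 x0 by metis
qed

section \<open>The greedy procedure\<close>

type_synonym gstate =
  "(nat \<Rightarrow> nat \<Rightarrow> nat) \<times> (nat \<Rightarrow> nat) \<times> (nat \<Rightarrow> nat) \<times> (nat \<Rightarrow> nat)"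

text \<open>
  The last component records for every row the column that was used last; it is read only for
  the rows of supply 1, which the greedy procedure never splits.
\<close>

definition gstep :: "nat \<times> nat \<Rightarrow> gstate \<Rightarrow> gstate" where
  "gstep = (\<lambda>(A, i) (x, r, d, p). let t = min (r A) (d i) in
     if 0 < t
     then (x(A := (x A)(i := x A i + t)), r(A := r A - t), d(i := d i - t), p(A := i))
     else (x, r, d, p))"

fun greedy :: "(nat \<times> nat) list \<Rightarrow> gstate \<Rightarrow> gstate" where
  "greedy [] st = st"
| "greedy (l # w) st = greedy w (gstep l st)"

lemma greedy_append: "greedy (v @ w) st = greedy w (greedy v st)"
  by (induction v arbitrary: st) auto

text \<open>Additions on both sides avoid truncated subtraction, as the new value may be larger or
  smaller than the old one.\<close>

lemma sum_fun_upd: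
  fixes f :: "'a \<Rightarrow> nat"
  assumes "finite S" "a \<in> S"
  shows "sum (f(a := v)) S + f a = sum f S + v"
proof -
  have "sum (f(a := v)) S = v + sum f (S - {a})"
    using assms by (subst sum.remove[of _ a]) auto
  moreover have "sum f S = f a + sum f (S - {a})"
    using assms by (rule sum.remove)
  ultimately show ?thesis by simp
qed

lemma sum_fun_upd_column:
  fixes x :: "'a \<Rightarrow> 'b \<Rightarrow> nat"
  assumes "finite S" "A \<in> S"
  shows "(\<Sum>B\<in>S. (x(A := f)) B i) + x A i = (\<Sum>B\<in>S. x B i) + f i"
proof -
  have "(\<Sum>B\<in>S. (x(A := f)) B i) = sum ((\<lambda>B. x B i)(A := f i)) S"
    by (intro sum.cong) auto
  then show ?thesis using sum_fun_upd[OF assms, of "\<lambda>B. x B i" "f i"] by simp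
qed

lemma profit_fun_upd:
  assumes "A < m" "i < c"
  shows "profit m c g (x(A := (x A)(i := v))) + g A i * x A i = profit m c g x + g A i * v"
proof -
  let ?f = "\<lambda>x B. \<Sum>i<c. g B i * x B i"
  let ?v = "\<Sum>j<c. ((\<lambda>j. g A j * x A j)(i := g A i * v)) j"
  have eq: "?f (x(A := (x A)(i := v))) = (?f x)(A := ?v)"
    by (rule ext) (auto intro!: sum.cong)
  have "sum (?f (x(A := (x A)(i := v)))) {..<m} + ?f x A = sum (?f x) {..<m} + ?v"
    unfolding eq by (rule sum_fun_upd) (use assms in auto)
  then have "profit m c g (x(A := (x A)(i := v))) + ?f x A = profit m c g x + ?v"
    unfolding profit_def .
  moreover have "(\<Sum>j<c. ((\<lambda>j. g A j * x A j)(i := g A i * v)) j) + g A i * x A i =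
      ?f x A + g A i * v"
    using sum_fun_upd[of "{..<c}" i "\<lambda>j. g A j * x A j"] assms by simp
  ultimately show ?thesis by linarith
qed

text \<open>Moving the content of a saturated cell exhausts its row or its column, and the rest of
  the solution solves the remaining problem, so induction on the number of nonzero supplies and
  demands applies. The start matrix \<open>y\<close> is arbitrary because the later letters of the
  word add to what has been placed already.\<close>

lemma greedy_optimal:
  assumes "transport m c r d x0"
  shows "\<exists>w. length w \<le> card {A. A < m \<and> r A > 0} + card {i. i < c \<and> d i > 0} \<and>
      set w \<subseteq> {..<m} \<times> {..<c} \<and>
      (\<forall>y p. \<exists>y' r' d' p'. greedy w (y, r, d, p) = (y', r', d', p') \<and> (\<forall>A<m. r' A = 0) \<and>
         profit m c g y + profit m c g x0 \<le> profit m c g y')"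
  using assms
proof (induction "card {A. A < m \<and> r A > 0} + card {i. i < c \<and> d i > 0}"
    arbitrary: r d x0 rule: less_induct)
  case less
  show ?case
  proof (cases "\<forall>A<m. r A = 0")
    case True
    then have "x0 A i = 0" if "A < m" "i < c" for A i
      using transport_le(1)[OF less.prems that] that by simp
    then have "profit m c g x0 = 0" unfolding profit_def by simp
    then show ?thesis using True by (intro exI[of _ "[]"]) auto
  next
    case False
    then obtain A0 where "A0 < m" "r A0 > 0" by blast
    from saturated_cell[OF less.prems this] obtain x A i
      where x: "transport m c r d x" "profit m c g x0 \<le> profit m c g x"
        "A < m" "i < c" "x A i > 0" "x A i = min (r A) (d i)" .
    define t where "t = x A i"
    define r1 where "r1 = r(A := r A - t)"
    define d1 where "d1 = d(i := d i - t)"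
    define x1 where "x1 = x(A := (x A)(i := 0))"
    have t: "t > 0" "t \<le> r A" "t \<le> d i" "t = min (r A) (d i)" using x unfolding t_def by auto
    have tr: "transport m c r1 d1 x1"
      unfolding transport_def
    proof (intro conjI allI impI)
      fix B assume B: "B < m"
      have "(\<Sum>j<c. x B j) = r B" using x(1) B unfolding transport_def by blast
      moreover have "(\<Sum>j<c. ((x A)(i := 0)) j) + t = (\<Sum>j<c. x A j)"
        using sum_fun_upd[of "{..<c}" i "x A" 0] x(4) unfolding t_def by simp
      ultimately show "(\<Sum>j<c. x1 B j) = r1 B" unfolding x1_def r1_def by auto
    next
      fix j assume j: "j < c"
      have "(\<Sum>B<m. x B j) = d j" using x(1) j unfolding transport_def by blast
      moreover have "(\<Sum>B<m. x1 B j) + x A j = (\<Sum>B<m. x B j) + ((x A)(i := 0)) j"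
        unfolding x1_def by (rule sum_fun_upd_column) (use x in auto)
      ultimately show "(\<Sum>B<m. x1 B j) = d1 j"
        unfolding d1_def t_def by auto
    qed
    let ?R = "\<lambda>r. {A. A < m \<and> r A > (0::nat)}"
    let ?C = "\<lambda>d. {i. i < c \<and> d i > (0::nat)}"
    have sub: "?R r1 \<subseteq> ?R r" "?C d1 \<subseteq> ?C d"
      unfolding r1_def d1_def by (auto split: if_splits)
    have strict: "?R r1 \<subset> ?R r \<or> ?C d1 \<subset> ?C d"
    proof (cases "t = r A")
      case True
      then have "A \<in> ?R r - ?R r1" using t x(3) unfolding r1_def by auto
      then show ?thesis using sub by blast
    next
      case False
      then have "t = d i" using t by linarith
      then have "i \<in> ?C d - ?C d1" using t x(4) unfolding d1_def by auto
      then show ?thesis using sub by blast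
    qed
    have fin: "finite (?R r)" "finite (?C d)" by auto
    have lt: "card (?R r1) + card (?C d1) < card (?R r) + card (?C d)"
      using strict
    proof
      assume "?R r1 \<subset> ?R r"
      then show ?thesis
        using psubset_card_mono[OF fin(1), of "?R r1"] card_mono[OF fin(2) sub(2)] by linarith
    next
      assume "?C d1 \<subset> ?C d"
      then show ?thesis
        using psubset_card_mono[OF fin(2), of "?C d1"] card_mono[OF fin(1) sub(1)] by linarith
    qed
    obtain w where w: "length w \<le> card (?R r1) + card (?C d1)" "set w \<subseteq> {..<m} \<times> {..<c}"
        "\<And>y p. \<exists>y' r' d' p'. greedy w (y, r1, d1, p) = (y', r', d', p') \<and> (\<forall>A<m. r' A = 0) \<and>
           profit m c g y + profit m c g x1 \<le> profit m c g y'"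
      using less.hyps[OF lt tr] by blast
    have px: "profit m c g x1 + g A i * t = profit m c g x"
      using profit_fun_upd[OF x(3,4), of g x 0] unfolding x1_def t_def by simp
    show ?thesis
    proof (intro exI[of _ "(A, i) # w"] conjI allI)
      show "length ((A, i) # w) \<le> card (?R r) + card (?C d)" using w(1) lt by simp
      show "set ((A, i) # w) \<subseteq> {..<m} \<times> {..<c}" using w(2) x by simp
    next
      fix y :: "nat \<Rightarrow> nat \<Rightarrow> nat" and p :: "nat \<Rightarrow> nat"
      define y1 where "y1 = y(A := (y A)(i := y A i + t))"
      have py: "profit m c g y1 = profit m c g y + g A i * t"
        using profit_fun_upd[OF x(3,4), of g y "y A i + t"] unfolding y1_def
        by (simp add: distrib_left)
      have "gstep (A, i) (y, r, d, p) = (y1, r1, d1, p(A := i))"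
        unfolding gstep_def y1_def r1_def d1_def using t by (simp add: Let_def)
      then show "\<exists>y' r' d' p'. greedy ((A, i) # w) (y, r, d, p) = (y', r', d', p') \<and>
          (\<forall>A<m. r' A = 0) \<and> profit m c g y + profit m c g x0 \<le> profit m c g y'"
        using w(3)[of y1 "p(A := i)"] px py x(2) by fastforce
    qed
  qed
qed

text \<open>Every word over the legal cells preserves this, whether it is a good word or not. Hence
  each run that empties all rows is feasible, and the program has only the costs left to
  compare.\<close>

definition ginv ::
    "nat \<Rightarrow> nat \<Rightarrow> (nat \<Rightarrow> nat) \<Rightarrow> (nat \<Rightarrow> nat) \<Rightarrow> gstate \<Rightarrow> bool" where
  "ginv m c sz tgt = (\<lambda>(x, r, d, p).
     (\<forall>A<m. (\<Sum>i<c. x A i) + r A = sz A) \<and> (\<forall>i<c. (\<Sum>A<m. x A i) + d i = tgt i) \<and>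
     (\<forall>A<m. r A \<noteq> sz A \<longrightarrow> p A < c \<and> x A (p A) > 0))"

lemma ginv_gstep:
  assumes "ginv m c sz tgt st" "A < m" "i < c"
  shows "ginv m c sz tgt (gstep (A, i) st)"
proof -
  obtain x r d p where st: "st = (x, r, d, p)" by (metis prod_cases4)
  define t where "t = min (r A) (d i)"
  show ?thesis
  proof (cases "t > 0")
    case False
    then show ?thesis using assms(1) unfolding st gstep_def t_def by (auto simp: Let_def)
  next
    case True
    define x1 where "x1 = x(A := (x A)(i := x A i + t))"
    have eq: "gstep (A, i) st = (x1, r(A := r A - t), d(i := d i - t), p(A := i))"
      using True unfolding st gstep_def t_def x1_def by (simp add: Let_def)
    have t: "t \<le> r A" "t \<le> d i" unfolding t_def by auto
    show ?thesis
      unfolding eq ginv_def prod.case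
    proof (intro conjI allI impI)
      fix B assume B: "B < m"
      have "(\<Sum>j<c. x B j) + r B = sz B" using assms(1) B unfolding st ginv_def by simp
      moreover have "(\<Sum>j<c. ((x A)(i := x A i + t)) j) = (\<Sum>j<c. x A j) + t"
        using sum_fun_upd[of "{..<c}" i "x A" "x A i + t"] assms(3) by simp
      ultimately show "(\<Sum>j<c. x1 B j) + (r(A := r A - t)) B = sz B"
        using t unfolding x1_def by auto
    next
      fix j assume j: "j < c"
      have "(\<Sum>B<m. x B j) + d j = tgt j" using assms(1) j unfolding st ginv_def by simp
      moreover have "(\<Sum>B<m. x1 B j) + x A j = (\<Sum>B<m. x B j) + ((x A)(i := x A i + t)) j"
        unfolding x1_def by (rule sum_fun_upd_column) (use assms in auto)
      ultimately show "(\<Sum>B<m. x1 B j) + (d(i := d i - t)) j = tgt j"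
        using t by auto
    next
      fix B assume B: "B < m" "(r(A := r A - t)) B \<noteq> sz B"
      then show "(p(A := i)) B < c"
        using assms unfolding st ginv_def by auto
      show "0 < x1 B ((p(A := i)) B)"
        using assms B True unfolding st ginv_def x1_def by auto
    qed
  qed
qed

lemma ginv_greedy:
  "ginv m c sz tgt st \<Longrightarrow> set w \<subseteq> {..<m} \<times> {..<c} \<Longrightarrow> ginv m c sz tgt (greedy w st)"
proof (induction w arbitrary: st)
  case (Cons a w)
  obtain A i where a: "a = (A, i)" "A < m" "i < c" using Cons.prems by (cases a) auto
  have "ginv m c sz tgt (gstep (A, i) st)" by (rule ginv_gstep[OF Cons.prems(1) a(2,3)])
  then show ?case using Cons.IH Cons.prems a by simp
qed simp

definition ginit :: "(nat \<Rightarrow> nat) \<Rightarrow> (nat \<Rightarrow> nat) \<Rightarrow> gstate" where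
  "ginit sz tgt = (\<lambda>_ _. 0, sz, tgt, \<lambda>_. 0)"

lemma ginv_ginit: "ginv m c sz tgt (ginit sz tgt)"
  unfolding ginv_def ginit_def by simp

text \<open>Equal totals of supply and demand force the columns to be full as soon as the rows are
  empty, so it suffices to watch the rows. A row of supply 1 has been touched, and its single unit
  sits in the recorded column.\<close>

lemma ginv_final:
  assumes "ginv m c sz tgt (x, r, d, p)" "\<forall>A<m. r A = 0" "(\<Sum>A<m. sz A) = (\<Sum>i<c. tgt i)"
  shows "transport m c sz tgt x" and "A < m \<Longrightarrow> sz A = 1 \<Longrightarrow> p A < c \<and> x A (p A) = 1"
proof -
  have rows: "(\<Sum>i<c. x A i) = sz A" if "A < m" for A
    using assms(1,2) that unfolding ginv_def by auto
  have cols: "(\<Sum>A<m. x A i) + d i = tgt i" if "i < c" for i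
    using assms(1) that unfolding ginv_def by auto
  have "(\<Sum>i<c. tgt i) = (\<Sum>i<c. (\<Sum>A<m. x A i) + d i)"
    using cols by (intro sum.cong) auto
  also have "\<dots> = (\<Sum>A<m. \<Sum>i<c. x A i) + (\<Sum>i<c. d i)"
    unfolding sum.distrib by (subst sum.swap) (rule refl)
  also have "(\<Sum>A<m. \<Sum>i<c. x A i) = (\<Sum>A<m. sz A)"
    using rows by (intro sum.cong) auto
  finally have "d i = 0" if "i < c" for i
    using assms(3) that by simp
  then show tr: "transport m c sz tgt x"
    unfolding transport_def using rows cols by fastforce
  assume A: "A < m" "sz A = 1"
  then have "p A < c" "x A (p A) > 0" using assms(1,2) unfolding ginv_def by auto
  moreover have "x A (p A) \<le> 1" using transport_le(1)[OF tr A(1)] calculation(1) A(2) by simp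
  ultimately show "p A < c \<and> x A (p A) = 1" by simp
qed

section \<open>The cut size as a linear function\<close>

text \<open>Rows \<open>j < K\<close> have supply 1; they stand for the vertices of the cover.\<close>

definition cut_cost ::
    "nat \<Rightarrow> nat \<Rightarrow> (nat \<Rightarrow> nat \<Rightarrow> bool) \<Rightarrow> (nat \<Rightarrow> nat) \<Rightarrow> (nat \<Rightarrow> nat \<Rightarrow> nat) \<Rightarrow> (nat \<Rightarrow> nat) \<Rightarrow> nat" where
  "cut_cost m K nb sz x p = (\<Sum>A<m. \<Sum>j<K. if nb A j then sz A - x A (p j) else 0)"

text \<open>The weight of cell \<open>(A, i)\<close> is the number of cover vertices in part
  \<open>i\<close> that are related to class \<open>A\<close>. Entries never exceed row sums, so the
  subtraction in \<open>cut_cost\<close> is exact; with a constant total, minimising the cut means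
  maximising the profit.\<close>

lemma cut_cost_plus_profit:
  assumes "transport m c sz tgt x" "\<forall>j<K. p j < c"
  shows "cut_cost m K nb sz x p +
      profit m c (\<lambda>A i. \<Sum>j<K. if nb A j \<and> p j = i then 1 else 0) x =
      (\<Sum>A<m. \<Sum>j<K. if nb A j then sz A else 0)"
proof -
  have "(\<Sum>i<c. (\<Sum>j<K. if nb A j \<and> p j = i then 1 else 0) * x A i) =
      (\<Sum>j<K. if nb A j then x A (p j) else 0)" for A
  proof -
    have "(\<Sum>i<c. (\<Sum>j<K. if nb A j \<and> p j = i then 1 else 0) * x A i) =
        (\<Sum>j<K. \<Sum>i<c. if p j = i then (if nb A j then x A i else 0) else 0)"
      unfolding sum_distrib_right by (subst sum.swap) (intro sum.cong, auto)
    also have "\<dots> = (\<Sum>j<K. if nb A j then x A (p j) else 0)"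
      using assms(2) by (intro sum.cong) (auto simp: sum.delta)
    finally show ?thesis .
  qed
  then have "cut_cost m K nb sz x p +
      profit m c (\<lambda>A i. \<Sum>j<K. if nb A j \<and> p j = i then 1 else 0) x =
      (\<Sum>A<m. \<Sum>j<K. (if nb A j then sz A - x A (p j) else 0) + (if nb A j then x A (p j) else 0))"
    unfolding cut_cost_def profit_def by (simp add: sum.distrib)
  also have "\<dots> = (\<Sum>A<m. \<Sum>j<K. if nb A j then sz A else 0)"
    using transport_le(1)[OF assms(1)] assms(2) by (intro sum.cong) auto
  finally show ?thesis .
qed

text \<open>
  For fixed columns of the first \<open>K\<close> rows the cost is linear. A large bonus \<open>W\<close> on the
  cells \<open>(j, ps j)\<close> makes every optimal solution respect these columns.
\<close>

lemma greedy_cut_cost: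
  assumes xs: "transport m c sz tgt xs" and K: "K \<le> m"
    and ps: "\<And>j. j < K \<Longrightarrow> sz j = 1 \<and> ps j < c \<and> xs j (ps j) = 1"
  shows "\<exists>w x r d p. length w \<le> m + c \<and> set w \<subseteq> {..<m} \<times> {..<c} \<and>
      greedy w (ginit sz tgt) = (x, r, d, p) \<and> (\<forall>A<m. r A = 0) \<and>
      cut_cost m K nb sz x p \<le> cut_cost m K nb sz xs ps"
proof -
  define g where "g A i = (\<Sum>j<K. if nb A j \<and> ps j = i then 1 else 0 :: nat)" for A i
  \<comment> \<open>Larger than any profit under \<open>g\<close>, so the loss of a single bonus
    cannot be compensated.\<close>
  define W where "W = Suc (\<Sum>A<m. \<Sum>i<c. g A i * sz A)"
  define h where "h A i = g A i + (if A < K \<and> ps A = i then W else 0)" for A i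
  have sum_eq: "(\<Sum>A<m. sz A) = (\<Sum>i<c. tgt i)"
  proof -
    have "(\<Sum>A<m. sz A) = (\<Sum>A<m. \<Sum>i<c. xs A i)"
      using xs unfolding transport_def by (intro sum.cong) auto
    also have "\<dots> = (\<Sum>i<c. \<Sum>A<m. xs A i)" by (rule sum.swap)
    also have "\<dots> = (\<Sum>i<c. tgt i)"
      using xs unfolding transport_def by (intro sum.cong) auto
    finally show ?thesis .
  qed
  have prh: "profit m c h x = profit m c g x + W * (\<Sum>j<K. x j (ps j))" for x
  proof -
    have "(\<Sum>i<c. (if A < K \<and> ps A = i then W else 0) * x A i) =
        (if A < K then W * x A (ps A) else 0)" for A
    proof (cases "A < K")
      case True
      then have "(\<Sum>i<c. (if A < K \<and> ps A = i then W else 0) * x A i) =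
          (\<Sum>i<c. if ps A = i then W * x A i else 0)" by (intro sum.cong) auto
      then show ?thesis using True ps by simp
    qed simp
    then have "profit m c h x = profit m c g x + (\<Sum>A<m. if A < K then W * x A (ps A) else 0)"
      unfolding profit_def h_def by (simp add: distrib_right sum.distrib)
    also have "(\<Sum>A<m. if A < K then W * x A (ps A) else 0) = (\<Sum>A<K. W * x A (ps A))"
      using K by (intro sum.mono_neutral_cong_right) auto
    finally show ?thesis by (simp add: sum_distrib_left)
  qed
  obtain w where w: "length w \<le> card {A. A < m \<and> sz A > 0} + card {i. i < c \<and> tgt i > 0}"
      "set w \<subseteq> {..<m} \<times> {..<c}"
      "\<And>y p. \<exists>y' r' d' p'. greedy w (y, sz, tgt, p) = (y', r', d', p') \<and> (\<forall>A<m. r' A = 0) \<and>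
         profit m c h y + profit m c h xs \<le> profit m c h y'"
    using greedy_optimal[OF xs, of h] by blast
  obtain x r d p where x: "greedy w (ginit sz tgt) = (x, r, d, p)" "\<forall>A<m. r A = 0"
      "profit m c h xs \<le> profit m c h x"
    using w(3)[of "\<lambda>_ _. 0" "\<lambda>_. 0"] unfolding ginit_def by fastforce
  have "ginv m c sz tgt (x, r, d, p)"
    using ginv_greedy[OF ginv_ginit w(2)] x(1) by metis
  note fin = ginv_final[OF this x(2) sum_eq]
  have le1: "x j (ps j) \<le> 1" if "j < K" for j
    using transport_le(1)[OF fin(1), of j "ps j"] ps[OF that] that K by simp
  have "profit m c g x < W"
    using profit_bounded[OF fin(1), of g] unfolding W_def by simp
  moreover have "(\<Sum>j<K. xs j (ps j)) = K" using ps by simp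
  \<comment> \<open>\<open>xs\<close> collects all \<open>K\<close> bonuses and \<open>x\<close>
    earns at least as much, of which less than \<open>W\<close> comes from \<open>g\<close>.\<close>
  ultimately have "W * K < W * (\<Sum>j<K. x j (ps j)) + W"
    using x(3) unfolding prh by simp
  then have "W * K < W * Suc (\<Sum>j<K. x j (ps j))" by simp
  then have ge: "K \<le> (\<Sum>j<K. x j (ps j))" using mult_less_cancel1 less_Suc_eq_le by blast
  have one: "x j (ps j) = 1" if "j < K" for j
  proof (rule ccontr)
    assume "x j (ps j) \<noteq> 1"
    then have "x j (ps j) < 1" using le1[OF that] by simp
    then have "(\<Sum>j<K. x j (ps j)) < (\<Sum>j<K. 1)"
      using le1 that by (intro sum_strict_mono_ex1) (auto intro!: bexI[of _ j])
    then show False using ge by simp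
  qed
  have pj: "p j = ps j" if "j < K" for j
  proof (rule ccontr)
    assume neq: "p j \<noteq> ps j"
    have j: "j < m" "sz j = 1" "ps j < c" using that K ps by auto
    have pj: "p j < c" "x j (p j) = 1" using fin(2)[OF j(1,2)] by auto
    \<comment> \<open>Two different columns holding a unit each would exceed the supply 1 of row
      \<open>j\<close>.\<close>
    have "(\<Sum>i\<in>{p j, ps j}. x j i) \<le> (\<Sum>i<c. x j i)"
      using pj j by (intro sum_mono2) auto
    then show False
      using fin(1) j pj one[OF that] neq unfolding transport_def by simp
  qed
  have "profit m c g xs \<le> profit m c g x"
    using x(3) one ps unfolding prh by simp
  moreover have "cut_cost m K nb sz x p = cut_cost m K nb sz x ps"
    unfolding cut_cost_def using pj by (intro sum.cong) auto
  moreover have "cut_cost m K nb sz x ps + profit m c g x =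
      cut_cost m K nb sz xs ps + profit m c g xs"
    using cut_cost_plus_profit[OF fin(1), of K ps nb] cut_cost_plus_profit[OF xs, of K ps nb] ps
    unfolding g_def by simp
  ultimately have "cut_cost m K nb sz x p \<le> cut_cost m K nb sz xs ps" by linarith
  moreover have "length w \<le> m + c"
  proof -
    have "card {A. A < m \<and> sz A > 0} \<le> card {..<m}" "card {i. i < c \<and> tgt i > 0} \<le> card {..<c}"
      by (intro card_mono; auto)+
    then show ?thesis using w(1) by simp
  qed
  ultimately show ?thesis using w(2) x(1,2) by blast
qed

section \<open>Words of cells as mixed-radix numerals\<close>

fun decode :: "nat \<Rightarrow> nat \<Rightarrow> nat \<Rightarrow> nat \<Rightarrow> (nat \<times> nat) list" where
  "decode m c 0 k = []"
| "decode m c (Suc l) k = (k mod m, k div m mod c) # decode m c l (k div m div c)"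

lemma set_decode: "m > 0 \<Longrightarrow> c > 0 \<Longrightarrow> set (decode m c l k) \<subseteq> {..<m} \<times> {..<c}"
  by (induction l arbitrary: k) auto

text \<open>Digits alternate between base \<open>m\<close> and base \<open>c\<close>. Words shorter
  than \<open>l\<close> are padded with the cell \<open>(0, 0)\<close>, which does nothing once row
  0 is empty (\<open>greedy_idle\<close>), so words of one fixed length suffice.\<close>

lemma decode_surj:
  assumes "set w \<subseteq> {..<m} \<times> {..<c}" "length w \<le> l" "m > 0" "c > 0"
  shows "\<exists>k < (m * c) ^ l. decode m c l k = w @ replicate (l - length w) (0, 0)"
  using assms(1,2)
proof (induction w arbitrary: l)
  case Nil
  have "decode m c l 0 = replicate l (0, 0)" by (induction l) auto
  then show ?case using assms by (intro exI[of _ 0]) auto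
next
  case (Cons a w)
  obtain A i where a: "a = (A, i)" "A < m" "i < c" using Cons.prems by (cases a) auto
  obtain l' where l: "l = Suc l'" "length w \<le> l'" using Cons.prems by (cases l) auto
  obtain k where k: "k < (m * c) ^ l'" "decode m c l' k = w @ replicate (l' - length w) (0, 0)"
    using Cons.IH[OF _ l(2)] Cons.prems by auto
  \<comment> \<open>Horner's rule: the first letter occupies the two least significant
    digits.\<close>
  define k' where "k' = A + m * (i + c * k)"
  have eq: "k' mod m = A" "k' div m = i + c * k" "(i + c * k) mod c = i" "(i + c * k) div c = k"
    unfolding k'_def using a by (auto simp: mod_less div_less)
  have "i + c * k < c * Suc k" using a by simp
  also have "\<dots> \<le> c * (m * c) ^ l'" using k(1) by (intro mult_le_mono2) simp
  finally have "Suc (i + c * k) \<le> c * (m * c) ^ l'" by simp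
  then have "m * Suc (i + c * k) \<le> m * (c * (m * c) ^ l')" by (rule mult_le_mono2)
  then have "k' < (m * c) ^ l" unfolding k'_def l(1) using a(2) by (simp add: mult.assoc)
  moreover have "decode m c l k' = (a # w) @ replicate (l - length (a # w)) (0, 0)"
    using k(2) eq unfolding l(1) a by simp
  ultimately show ?case by blast
qed

lemma greedy_idle:
  assumes "r 0 = 0"
  shows "greedy (replicate l (0, i)) (x, r, d, p) = (x, r, d, p)"
  by (induction l) (use assms in \<open>auto simp: gstep_def\<close>)

section \<open>Balanced partitions and twin classes\<close>

definition parts :: "'a list \<Rightarrow> (nat \<Rightarrow> nat) \<Rightarrow> nat \<Rightarrow> 'a set" where
  "parts vs f j = {vs ! i | i. i < length vs \<and> f i = j}"

lemma output_partition_eq: "output_partition vs s = parts vs (s ''part'')"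
  unfolding output_partition_def parts_def by (rule ext) simp

text \<open>Normal form of balance: the larger parts come first. This turns the pairwise condition
  on sizes into prescribed column sums.\<close>

definition part_size :: "nat \<Rightarrow> nat \<Rightarrow> nat \<Rightarrow> nat" where
  "part_size n c i = n div c + (if i < n mod c then 1 else 0)"

lemma sum_part_size:
  assumes "c > 0"
  shows "(\<Sum>i<c. part_size n c i) = n"
proof -
  have "(\<Sum>i<c. if i < n mod c then 1 else 0 :: nat) = (\<Sum>i<n mod c. 1)"
    by (rule sum.mono_neutral_cong_right)
      (use assms in \<open>auto intro: less_trans[OF _ mod_less_divisor]\<close>)
  then show ?thesis
    unfolding part_size_def sum.distrib using div_mult_mod_eq[of n c] by (simp add: mult.commute)
qed

text \<open>All sizes are \<open>a\<close> or \<open>a + 1\<close> for the minimum \<open>a\<close>.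
  The minimum is attained, so fewer than \<open>c\<close> parts are larger, and uniqueness of
  quotient and remainder identifies \<open>a\<close> and the number of larger parts. It remains to
  permute the larger parts to the front.\<close>

lemma balanced_sizes_permutation:
  fixes f :: "nat \<Rightarrow> nat"
  assumes "c > 0" and close: "\<forall>i<c. \<forall>j<c. f i \<le> f j + 1" and sum: "(\<Sum>i<c. f i) = n"
  obtains \<sigma> where "bij_betw \<sigma> {..<c} {..<c}" "\<And>i. i < c \<Longrightarrow> f (\<sigma> i) = part_size n c i"
proof -
  define a where "a = Min (f ` {..<c})"
  define H where "H = {i. i < c \<and> f i = a + 1}"
  have "a \<in> f ` {..<c}" unfolding a_def using assms(1) by (intro Min_in) auto
  then obtain i0 where i0: "i0 < c" "f i0 = a" by auto
  have f: "f i = a + (if i \<in> H then 1 else 0)" if "i < c" for i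
  proof -
    have "a \<le> f i" unfolding a_def using that by (intro Min_le) auto
    moreover have "f i \<le> a + 1" using close that i0 by metis
    ultimately show ?thesis unfolding H_def using that by auto
  qed
  have H: "H \<subseteq> {..<c}" "finite H" unfolding H_def by auto
  have "i0 \<notin> H" using i0 unfolding H_def by simp
  then have cardH: "card H < c"
    using psubset_card_mono[of "{..<c}" H] H i0 by auto
  have "n = c * a + (\<Sum>i<c. if i \<in> H then 1 else 0)"
    using sum f by (simp add: sum.distrib)
  also have "(\<Sum>i<c. if i \<in> H then 1 else 0) = card H"
    using H by (simp add: sum.If_cases Int_absorb1)
  finally have n: "n = c * a + card H" .
  have dm: "n div c = a" "n mod c = card H"
    using cardH unfolding n by auto
  obtain g where g: "bij_betw g {..<card H} H"
    using H(2) finite_same_card_bij[of "{..<card H}" H] by auto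
  have "card ({..<c} - {..<card H}) = card ({..<c} - H)"
    using cardH H by (simp add: card_Diff_subset)
  then obtain h where h: "bij_betw h ({..<c} - {..<card H}) ({..<c} - H)"
    using finite_same_card_bij[of "{..<c} - {..<card H}" "{..<c} - H"] by auto
  define \<sigma> where "\<sigma> i = (if i < card H then g i else h i)" for i
  have s1: "bij_betw \<sigma> {..<card H} H"
    using g by (rule bij_betw_cong[THEN iffD1, rotated]) (simp add: \<sigma>_def)
  have s2: "bij_betw \<sigma> ({..<c} - {..<card H}) ({..<c} - H)"
    using h by (rule bij_betw_cong[THEN iffD1, rotated]) (simp add: \<sigma>_def)
  have "bij_betw \<sigma> ({..<card H} \<union> ({..<c} - {..<card H})) (H \<union> ({..<c} - H))"
    using s1 s2 by (rule bij_betw_combine) auto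
  moreover have "{..<card H} \<union> ({..<c} - {..<card H}) = {..<c}" "H \<union> ({..<c} - H) = {..<c}"
    using cardH H by auto
  ultimately have bij: "bij_betw \<sigma> {..<c} {..<c}" by simp
  show ?thesis
  proof (rule that[OF bij])
    fix i assume i: "i < c"
    have "\<sigma> i < c" using bij_betwE[OF bij] i by auto
    moreover have "\<sigma> i \<in> H \<longleftrightarrow> i < card H"
      using bij_betwE[OF s1] bij_betwE[OF s2] i by auto
    ultimately show "f (\<sigma> i) = part_size n c i"
      unfolding part_size_def dm by (simp add: f)
  qed
qed

section \<open>Balanced partitions of graphs given by adjacency lists\<close>

locale balanced_input =
  fixes V :: "'a set" and E :: "'a set set" and c :: nat and vs :: "'a list"
    and adj :: "nat list list"
  assumes graph: "simple_graph V E" and c_pos: "c > 0" and lists: "adjacency_lists V E vs adj"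
begin

abbreviation n :: nat where "n \<equiv> length vs"

abbreviation nbr :: "nat \<Rightarrow> nat set" where "nbr v \<equiv> set (adj ! v)"

lemma vs: "distinct vs" "set vs = V" "length adj = n"
  using lists unfolding adjacency_lists_def by auto

lemma vs_inj: "\<lbrakk>i < n; j < n; vs ! i = vs ! j\<rbrakk> \<Longrightarrow> i = j"
  using vs(1) by (simp add: nth_eq_iff_index_eq)

lemma distinct_adj: "v < n \<Longrightarrow> distinct (adj ! v)"
  using lists unfolding adjacency_lists_def by auto

lemma nbr_iff: "v < n \<Longrightarrow> u \<in> nbr v \<longleftrightarrow> u < n \<and> {vs ! v, vs ! u} \<in> E"
  using lists unfolding adjacency_lists_def by auto

lemma nbr_sym: "\<lbrakk>v < n; u \<in> nbr v\<rbrakk> \<Longrightarrow> v \<in> nbr u"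
  by (simp add: nbr_iff insert_commute)

lemma nbr_irrefl: "\<lbrakk>v < n; u \<in> nbr v\<rbrakk> \<Longrightarrow> u \<noteq> v"
  using graph by (auto simp: nbr_iff simple_graph_def)

lemma edgeE:
  assumes "e \<in> E"
  obtains v u where "v < n" "u < n" "u \<in> nbr v" "e = {vs ! v, vs ! u}"
proof -
  have "e \<subseteq> V" "card e = 2" using assms graph unfolding simple_graph_def by auto
  then obtain a b where ab: "e = {a, b}" "a \<in> set vs" "b \<in> set vs"
    using vs(2) by (auto simp: card_2_iff)
  then obtain v u where "v < n" "vs ! v = a" "u < n" "vs ! u = b"
    unfolding in_set_conv_nth by blast
  then show ?thesis using that[of v u] ab assms by (auto simp: nbr_iff)
qed

lemma card_parts: "card (parts vs f i) = card {v. v < n \<and> f v = i}"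
proof -
  have "parts vs f i = (!) vs ` {v. v < n \<and> f v = i}" unfolding parts_def by auto
  moreover have "inj_on ((!) vs) {v. v < n \<and> f v = i}"
    by (intro inj_onI) (auto dest: vs_inj)
  ultimately show ?thesis by (simp add: card_image)
qed

lemma card_V: "card V = n"
  using vs distinct_card by blast

lemma nth_mem_parts: "v < n \<Longrightarrow> vs ! v \<in> parts vs f i \<longleftrightarrow> f v = i"
  unfolding parts_def by (auto dest: vs_inj)

lemma balanced_parts:
  assumes "\<forall>v<n. f v < c" "\<forall>i<c. card {v. v < n \<and> f v = i} = part_size n c i"
  shows "balanced_partition V c (parts vs f)"
  unfolding balanced_partition_def
proof (intro conjI)
  show "(\<Union>i<c. parts vs f i) = V"
    using assms(1) vs(2) unfolding parts_def by (fastforce simp: in_set_conv_nth)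
  show "disjoint_family_on (parts vs f) {..<c}"
    unfolding disjoint_family_on_def parts_def by (auto dest: vs_inj)
  show "\<forall>i<c. \<forall>j<c. card (parts vs f i) \<le> card (parts vs f j) + 1"
    using assms(2) by (simp add: card_parts part_size_def)
qed

lemma cut_edge_parts_iff:
  assumes "v < n" "u < n" "u \<in> nbr v" "\<forall>v<n. f v < c"
  shows "{vs ! v, vs ! u} \<in> cut_edges E c (parts vs f) \<longleftrightarrow> f v \<noteq> f u"
proof -
  have "{vs ! v, vs ! u} \<in> E" using assms by (simp add: nbr_iff)
  then show ?thesis
    unfolding cut_edges_def using assms by (auto simp: nth_mem_parts Int_insert_left)
qed

text \<open>Renaming the parts leaves the cut edges unchanged, so only partitions with sizes in
  normal form have to compete.\<close>

lemma balanced_partition_parts: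
  assumes Q: "balanced_partition V c Q"
  obtains f where "\<forall>v<n. f v < c" "\<forall>i<c. card {v. v < n \<and> f v = i} = part_size n c i"
    "cut_edges E c (parts vs f) = cut_edges E c Q"
proof -
  have un: "(\<Union>i<c. Q i) = V" and dis: "disjoint_family_on Q {..<c}"
    and close: "\<forall>i<c. \<forall>j<c. card (Q i) \<le> card (Q j) + 1"
    using Q unfolding balanced_partition_def by auto
  have fin: "finite (Q i)" if "i < c" for i
    using un graph that unfolding simple_graph_def by (auto intro: finite_subset)
  have "(\<Sum>i<c. card (Q i)) = card (\<Union>i<c. Q i)"
    using dis fin by (intro card_UN_disjoint[symmetric]) (auto simp: disjoint_family_on_def)
  then have "(\<Sum>i<c. card (Q i)) = n" using un card_V by simp
  from balanced_sizes_permutation[OF c_pos close this] obtain \<sigma> :: "nat \<Rightarrow> nat"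
    where bij: "bij_betw \<sigma> {..<c} {..<c}"
      and size: "\<And>i. i < c \<Longrightarrow> card (Q (\<sigma> i)) = part_size n c i" by blast
  have ex: "\<exists>i<c. vs ! v \<in> Q (\<sigma> i)" if "v < n" for v
  proof -
    have "vs ! v \<in> (\<Union>i<c. Q i)" using un vs(2) that nth_mem by blast
    then obtain j where "j < c" "vs ! v \<in> Q j" by blast
    then show ?thesis using bij unfolding bij_betw_def by (metis imageE lessThan_iff)
  qed
  have uniq: "i = j" if "i < c" "j < c" "a \<in> Q (\<sigma> i)" "a \<in> Q (\<sigma> j)" for a i j
  proof -
    have "\<sigma> i < c" "\<sigma> j < c" using bij_betwE[OF bij] that by auto
    then have "\<sigma> i = \<sigma> j" using dis that unfolding disjoint_family_on_def by blast
    then show ?thesis using bij that unfolding bij_betw_def by (auto dest: inj_onD)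
  qed
  define f where "f v = (SOME i. i < c \<and> vs ! v \<in> Q (\<sigma> i))" for v
  have f: "f v < c" "vs ! v \<in> Q (\<sigma> (f v))" if "v < n" for v
    using someI_ex[OF ex[OF that]] unfolding f_def by auto
  have eq: "parts vs f i = Q (\<sigma> i)" if "i < c" for i
  proof
    show "parts vs f i \<subseteq> Q (\<sigma> i)" unfolding parts_def using f(2) by auto
    show "Q (\<sigma> i) \<subseteq> parts vs f i"
    proof
      fix a assume a: "a \<in> Q (\<sigma> i)"
      have "\<sigma> i < c" using bij_betwE[OF bij] that by auto
      then have "a \<in> set vs" using a un vs(2) by blast
      then obtain v where v: "v < n" "a = vs ! v" by (auto simp: in_set_conv_nth)
      then have "f v = i" using uniq f a that by metis
      then show "a \<in> parts vs f i" using v unfolding parts_def by auto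
    qed
  qed
  show ?thesis
  proof
    show "\<forall>v<n. f v < c" using f by blast
    show "\<forall>i<c. card {v. v < n \<and> f v = i} = part_size n c i"
      using eq size by (simp flip: card_parts)
    \<comment> \<open>The index sets are written as bounded quantifiers so that they can be replaced
      by their image under the permutation.\<close>
    have "cut_edges E c (parts vs f) = {e \<in> E. \<exists>i\<in>{..<c}. \<exists>j\<in>{..<c}.
        \<sigma> i \<noteq> \<sigma> j \<and> e \<inter> Q (\<sigma> i) \<noteq> {} \<and> e \<inter> Q (\<sigma> j) \<noteq> {}}"
    proof -
      have "\<sigma> i \<noteq> \<sigma> j \<longleftrightarrow> i \<noteq> j" if "i < c" "j < c" for i j
        using bij that unfolding bij_betw_def by (auto dest: inj_onD)
      then have "(\<exists>i<c. \<exists>j<c. i \<noteq> j \<and> e \<inter> parts vs f i \<noteq> {} \<and> e \<inter> parts vs f j \<noteq> {}) \<longleftrightarrow>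
          (\<exists>i\<in>{..<c}. \<exists>j\<in>{..<c}. \<sigma> i \<noteq> \<sigma> j \<and> e \<inter> Q (\<sigma> i) \<noteq> {} \<and> e \<inter> Q (\<sigma> j) \<noteq> {})" for e
        using eq by (simp add: Bex_def cong: conj_cong)
      then show ?thesis unfolding cut_edges_def by presburger
    qed
    also have "\<dots> = {e \<in> E. \<exists>i\<in>\<sigma> ` {..<c}. \<exists>j\<in>\<sigma> ` {..<c}.
        i \<noteq> j \<and> e \<inter> Q i \<noteq> {} \<and> e \<inter> Q j \<noteq> {}}"
      by simp
    also have "\<sigma> ` {..<c} = {..<c}" using bij unfolding bij_betw_def by simp
    finally show "cut_edges E c (parts vs f) = cut_edges E c Q"
      unfolding cut_edges_def by auto
  qed
qed

end

section \<open>Cover indices, twin classes and the cut size\<close>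

text \<open>
  \<open>ix v\<close> is 0 for vertices outside the cover and one plus the number of the cover vertex otherwise.
  The relation \<open>nb\<close> between classes and cover vertices contains every edge once: an edge inside the
  cover is attributed to its endpoint of larger number.
\<close>

locale cover_index = balanced_input +
  fixes ix :: "nat \<Rightarrow> nat" and K :: nat
  assumes ix_bij: "bij_betw ix {v. v < n \<and> ix v > 0} {1..K}"
    and covered: "\<And>v u. \<lbrakk>v < n; u \<in> nbr v\<rbrakk> \<Longrightarrow> ix v > 0 \<or> ix u > 0"
begin

lemma ix_le: "v < n \<Longrightarrow> ix v \<le> K"
  using bij_betwE[OF ix_bij] by (cases "ix v = 0") auto

end

locale twin_classes = cover_index +
  fixes m :: nat and cls sz :: "nat \<Rightarrow> nat" and nb :: "nat \<Rightarrow> nat \<Rightarrow> bool"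
  assumes K_le: "K \<le> m"
    and cls_less: "\<And>v. v < n \<Longrightarrow> cls v < m"
    and cls_cover: "\<And>v. \<lbrakk>v < n; ix v > 0\<rbrakk> \<Longrightarrow> cls v = ix v - 1"
    and cls_other: "\<And>v. \<lbrakk>v < n; ix v = 0\<rbrakk> \<Longrightarrow> K \<le> cls v"
    and cls_twins: "\<And>v u. \<lbrakk>v < n; u < n; ix v = 0; ix u = 0; cls v = cls u\<rbrakk> \<Longrightarrow> nbr v = nbr u"
    and sz: "\<And>A. A < m \<Longrightarrow> sz A = card {v. v < n \<and> cls v = A}"
    and nb: "\<And>A j. \<lbrakk>A < m; j < K\<rbrakk> \<Longrightarrow> nb A j \<longleftrightarrow>
      (\<exists>v u. v < n \<and> u \<in> nbr v \<and> cls v = A \<and> ix u = Suc j \<and> (ix v = 0 \<or> ix u < ix v))"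
begin

definition cov :: "nat \<Rightarrow> nat" where
  "cov j = the_inv_into {v. v < n \<and> ix v > 0} ix (Suc j)"

lemma cov: "j < K \<Longrightarrow> cov j < n \<and> ix (cov j) = Suc j"
  using the_inv_into_into[of ix "{v. v < n \<and> ix v > 0}" "Suc j"] ix_bij
    f_the_inv_into_f_bij_betw[OF ix_bij, of "Suc j"]
  unfolding cov_def bij_betw_def by auto

lemma cov_unique: "\<lbrakk>v < n; ix v = Suc j\<rbrakk> \<Longrightarrow> v = cov j"
  using the_inv_into_f_f[of ix "{v. v < n \<and> ix v > 0}" v] ix_bij
  unfolding cov_def bij_betw_def by auto

text \<open>\<open>nb\<close> asks for some member of the class with a suitable arc, and this holds
  for one member iff for all: outside the cover the members are twins, inside the cover the class is
  a singleton.\<close>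

lemma nb_cls:
  assumes "v < n" "j < K"
  shows "nb (cls v) j \<longleftrightarrow> cov j \<in> nbr v \<and> (ix v = 0 \<or> Suc j < ix v)"
proof
  assume "nb (cls v) j"
  then obtain w u where w: "w < n" "u \<in> nbr w" "cls w = cls v" "ix u = Suc j"
      "ix w = 0 \<or> ix u < ix w"
    using nb assms cls_less by blast
  have u: "u = cov j" using w by (intro cov_unique) (auto simp: nbr_iff)
  show "cov j \<in> nbr v \<and> (ix v = 0 \<or> Suc j < ix v)"
  proof (cases "ix w = 0")
    case True
    then have "K \<le> cls v" using cls_other w by metis
    then have "ix v = 0" using cls_cover[OF assms(1)] ix_le[OF assms(1)] by fastforce
    then have "nbr v = nbr w" using cls_twins True w assms by metis
    then show ?thesis using u w \<open>ix v = 0\<close> by simp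
  next
    case False
    then have w': "cls v = ix w - 1" "ix w \<le> K" "ix w > 0" using cls_cover ix_le w by auto
    then have "ix v \<noteq> 0" using cls_other[OF assms(1)] by fastforce
    then have "ix v = ix w" using cls_cover[OF assms(1)] w' by simp
    then have "v = w" using cov_unique[of v "ix w - 1"] cov_unique[of w "ix w - 1"] assms w(1) w'(3)
      by simp
    then show ?thesis using u w by simp
  qed
next
  assume "cov j \<in> nbr v \<and> (ix v = 0 \<or> Suc j < ix v)"
  then have "v < n \<and> cov j \<in> nbr v \<and> cls v = cls v \<and> ix (cov j) = Suc j \<and>
      (ix v = 0 \<or> ix (cov j) < ix v)"
    using cov[OF assms(2)] assms by simp
  then show "nb (cls v) j" using nb[OF cls_less[OF assms(1)] assms(2)] by blast
qed

lemma class_cover: "j < K \<Longrightarrow> {v. v < n \<and> cls v = j} = {cov j}"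
proof (intro equalityI subsetI)
  fix v assume "j < K" "v \<in> {v. v < n \<and> cls v = j}"
  then have v: "v < n" "cls v = j" "ix v \<noteq> 0" using cls_other[of v] by auto
  then have "ix v = Suc j" using cls_cover[of v] by simp
  then show "v \<in> {cov j}" using cov_unique v by simp
next
  fix v assume "j < K" "v \<in> {cov j}"
  then show "v \<in> {v. v < n \<and> cls v = j}" using cov[of j] cls_cover[of "cov j"] by simp
qed

lemma sz_cover: "j < K \<Longrightarrow> sz j = 1"
  using sz[of j] class_cover K_le by simp

definition counts :: "(nat \<Rightarrow> nat) \<Rightarrow> nat \<Rightarrow> nat \<Rightarrow> nat" where
  "counts f A i = card {v. v < n \<and> cls v = A \<and> f v = i}"

lemma counts_cover:
  assumes "j < K"
  shows "counts f j i = (if f (cov j) = i then 1 else 0)"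
proof -
  have "{v. v < n \<and> cls v = j \<and> f v = i} = {v \<in> {v. v < n \<and> cls v = j}. f v = i}" by auto
  also have "\<dots> = (if f (cov j) = i then {cov j} else {})" unfolding class_cover[OF assms] by auto
  finally show ?thesis unfolding counts_def by simp
qed

lemma sum_counts_row:
  assumes "A < m" "\<forall>v<n. f v < c"
  shows "(\<Sum>i<c. counts f A i) = sz A"
proof -
  have "sz A = card (\<Union>i<c. {v. v < n \<and> cls v = A \<and> f v = i})"
    unfolding sz[OF assms(1)] using assms(2) by (intro arg_cong[of _ _ card]) auto
  also have "\<dots> = (\<Sum>i<c. counts f A i)"
    unfolding counts_def by (intro card_UN_disjoint) auto
  finally show ?thesis by simp
qed

lemma sum_counts_column: "(\<Sum>A<m. counts f A i) = card {v. v < n \<and> f v = i}"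
proof -
  have "card {v. v < n \<and> f v = i} = card (\<Union>A<m. {v. v < n \<and> cls v = A \<and> f v = i})"
    using cls_less by (intro arg_cong[of _ _ card]) auto
  also have "\<dots> = (\<Sum>A<m. counts f A i)"
    unfolding counts_def by (intro card_UN_disjoint) auto
  finally show ?thesis by simp
qed

text \<open>Class size minus the members in the part of \<open>cov j\<close> counts the members
  separated from \<open>cov j\<close>. Summation gives the number of pairs \<open>(v, j)\<close> in
  \<open>X\<close>, and these correspond to the cut edges through their endpoints.\<close>

lemma cut_cost_counts:
  assumes f: "\<forall>v<n. f v < c"
  shows "cut_cost m K nb sz (counts f) (\<lambda>j. f (cov j)) = card (cut_edges E c (parts vs f))"
proof -
  define X where "X = {(v, j). v < n \<and> j < K \<and> nb (cls v) j \<and> f v \<noteq> f (cov j)}"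
  define \<phi> where "\<phi> = (\<lambda>(v, j). {vs ! v, vs ! cov j})"
  have diff: "sz A - counts f A i = card {v. v < n \<and> cls v = A \<and> f v \<noteq> i}" if "A < m" for A i
  proof -
    have "sz A = card ({v. v < n \<and> cls v = A \<and> f v = i} \<union> {v. v < n \<and> cls v = A \<and> f v \<noteq> i})"
      unfolding sz[OF that] by (intro arg_cong[of _ _ card]) auto
    also have "\<dots> = counts f A i + card {v. v < n \<and> cls v = A \<and> f v \<noteq> i}"
      unfolding counts_def by (intro card_Un_disjoint) auto
    finally show ?thesis by simp
  qed
  have "cut_cost m K nb sz (counts f) (\<lambda>j. f (cov j)) =
      (\<Sum>A<m. \<Sum>j<K. \<Sum>v\<in>{v \<in> {..<n}. cls v = A}. of_bool (nb (cls v) j \<and> f v \<noteq> f (cov j)))"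
    unfolding cut_cost_def
  proof (intro sum.cong refl)
    fix A j assume A: "A \<in> {..<m}"
    show "(if nb A j then sz A - counts f A (f (cov j)) else 0) =
        (\<Sum>v\<in>{v \<in> {..<n}. cls v = A}. of_bool (nb (cls v) j \<and> f v \<noteq> f (cov j)))"
      using A by (auto simp: diff Collect_conj_eq[symmetric] sum.If_cases of_bool_def
          intro!: arg_cong[of _ _ card])
  qed
  also have "\<dots> = (\<Sum>A<m. \<Sum>v\<in>{v \<in> {..<n}. cls v = A}. \<Sum>j<K. of_bool (nb (cls v) j \<and> f v \<noteq> f (cov j)))"
    by (rule sum.cong[OF refl]) (rule sum.swap)
  also have "\<dots> = (\<Sum>v<n. \<Sum>j<K. of_bool (nb (cls v) j \<and> f v \<noteq> f (cov j)))"
    by (rule sum.group) (use cls_less in auto)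
  also have "\<dots> = (\<Sum>(v, j)\<in>{..<n} \<times> {..<K}. of_bool (nb (cls v) j \<and> f v \<noteq> f (cov j)))"
    by (rule sum.cartesian_product)
  also have "\<dots> = card X"
    unfolding X_def by (auto simp: of_bool_def case_prod_beta sum.If_cases intro!: arg_cong[of _ _ card])
  also have "\<dots> = card (cut_edges E c (parts vs f))"
  proof (rule bij_betw_same_card)
    have X: "v < n \<and> j < K \<and> cov j < n \<and> cov j \<in> nbr v \<and> (ix v = 0 \<or> ix (cov j) < ix v) \<and>
        ix (cov j) = Suc j \<and> f v \<noteq> f (cov j)" if "(v, j) \<in> X" for v j
      using that nb_cls[of v j] cov[of j] unfolding X_def by auto
    show "bij_betw \<phi> X (cut_edges E c (parts vs f))"
      unfolding bij_betw_def
    proof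
      show "inj_on \<phi> X"
      proof (rule inj_onI, clarify)
        fix v j w k assume *: "(v, j) \<in> X" "(w, k) \<in> X" "\<phi> (v, j) = \<phi> (w, k)"
        from *(3) have "v = w \<and> cov j = cov k \<or> v = cov k \<and> cov j = w"
          using X[OF *(1)] X[OF *(2)] unfolding \<phi>_def by (auto simp: doubleton_eq_iff dest: vs_inj)
        then show "v = w \<and> j = k"
        proof
          assume "v = w \<and> cov j = cov k"
          then show ?thesis using X[OF *(1)] X[OF *(2)] by (metis Suc_inject)
        next
          \<comment> \<open>The same edge in opposite orientation would need each endpoint to have
            the larger index.\<close>
          assume vw: "v = cov k \<and> cov j = w"
          have "ix v = 0 \<or> Suc j < ix v" "ix w = 0 \<or> Suc k < ix w" "ix v = Suc k" "ix w = Suc j"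
            using X[OF *(1)] X[OF *(2)] vw by metis+
          then show ?thesis by simp
        qed
      qed
      show "\<phi> ` X = cut_edges E c (parts vs f)"
      proof (intro equalityI subsetI)
        fix e assume "e \<in> \<phi> ` X"
        then obtain v j where "(v, j) \<in> X" "e = {vs ! v, vs ! cov j}" unfolding \<phi>_def by auto
        then show "e \<in> cut_edges E c (parts vs f)"
          using X cut_edge_parts_iff[of v "cov j" f] f by blast
      next
        fix e assume e: "e \<in> cut_edges E c (parts vs f)"
        then have "e \<in> E" unfolding cut_edges_def by simp
        then obtain v u where vu: "v < n" "u < n" "u \<in> nbr v" "e = {vs ! v, vs ! u}"
          by (rule edgeE)
        have fvu: "f v \<noteq> f u" using cut_edge_parts_iff[OF vu(1-3) f] e vu(4) by simp
        have *: "e \<in> \<phi> ` X" if vu: "v < n" "u < n" "u \<in> nbr v" "e = {vs ! v, vs ! u}"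
            "f v \<noteq> f u" "ix u > 0" "ix v = 0 \<or> ix u < ix v" for v u
        proof -
          define j where "j = ix u - 1"
          have j: "ix u = Suc j" "j < K" using vu ix_le[of u] unfolding j_def by auto
          then have "u = cov j" using cov_unique vu by blast
          then have "(v, j) \<in> X" using vu j nb_cls[of v j] unfolding X_def by auto
          then show ?thesis using \<open>u = cov j\<close> vu unfolding \<phi>_def by force
        qed
        \<comment> \<open>Distinct cover vertices have distinct indices, so exactly one orientation
          qualifies.\<close>
        have "ix u \<noteq> ix v" if "ix u > 0"
          using cov_unique[of u "ix u - 1"] cov_unique[of v "ix u - 1"] vu that nbr_irrefl
          by (metis Suc_diff_1)
        then consider "ix u > 0" "ix v = 0 \<or> ix u < ix v" | "ix v > 0" "ix u = 0 \<or> ix v < ix u"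
          using covered[OF vu(1,3)] by linarith
        then show "e \<in> \<phi> ` X"
        proof cases
          case 1
          then show ?thesis using * vu fvu by blast
        next
          case 2
          moreover have "v \<in> nbr u" "e = {vs ! u, vs ! v}" using vu nbr_sym by auto
          ultimately show ?thesis using *[of u v] vu fvu by metis
        qed
      qed
    qed
  qed
  finally show ?thesis .
qed

lemma transport_counts:
  assumes "\<forall>v<n. f v < c" "\<forall>i<c. card {v. v < n \<and> f v = i} = part_size n c i"
  shows "transport m c sz (part_size n c) (counts f)"
  unfolding transport_def using assms by (simp add: sum_counts_row sum_counts_column)

lemma sum_sz: "(\<Sum>A<m. sz A) = (\<Sum>i<c. part_size n c i)"
proof -
  \<comment> \<open>With all vertices assigned to part 0, the class sizes form column 0, whose sum
    is \<open>n\<close>.\<close>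
  have "(\<Sum>A<m. sz A) = (\<Sum>A<m. counts (\<lambda>_. 0) A 0)"
    unfolding counts_def by (intro sum.cong) (auto simp: sz)
  then show ?thesis using sum_counts_column[of "\<lambda>_. 0" 0] by (simp add: sum_part_size c_pos)
qed

section \<open>Solutions, partitions and coded greedy runs\<close>

definition solution :: "(nat \<Rightarrow> nat \<Rightarrow> nat) \<Rightarrow> (nat \<Rightarrow> nat) \<Rightarrow> bool" where
  "solution x p \<longleftrightarrow> transport m c sz (part_size n c) x \<and> (\<forall>j<K. p j < c \<and> x j (p j) = 1)"

lemma solution_of_partition:
  assumes "balanced_partition V c Q"
  obtains x p where "solution x p" "cut_cost m K nb sz x p = card (cut_edges E c Q)"
proof -
  obtain f where f: "\<forall>v<n. f v < c" "\<forall>i<c. card {v. v < n \<and> f v = i} = part_size n c i"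
      "cut_edges E c (parts vs f) = cut_edges E c Q"
    using balanced_partition_parts[OF assms] by blast
  have "solution (counts f) (\<lambda>j. f (cov j))"
    unfolding solution_def using transport_counts[OF f(1,2)] f(1) cov by (simp add: counts_cover)
  then show ?thesis using that cut_cost_counts[OF f(1)] f(3) by metis
qed

lemma partition_of_solution:
  assumes "solution x p" "\<forall>v<n. f v < c" "\<And>A i. \<lbrakk>A < m; i < c\<rbrakk> \<Longrightarrow> x A i = counts f A i"
  shows "balanced_partition V c (parts vs f)"
    and "cut_cost m K nb sz x p = card (cut_edges E c (parts vs f))"
proof -
  have "card {v. v < n \<and> f v = i} = part_size n c i" if "i < c" for i
  proof -
    have "card {v. v < n \<and> f v = i} = (\<Sum>A<m. x A i)"
      using that assms(3) by (simp flip: sum_counts_column)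
    then show ?thesis using assms(1) that unfolding solution_def transport_def by simp
  qed
  then show "balanced_partition V c (parts vs f)" using balanced_parts assms(2) by blast
  have p: "p j < c" "f (cov j) = p j" if "j < K" for j
  proof -
    show "p j < c" using assms(1) that unfolding solution_def by blast
    \<comment> \<open>Row \<open>j\<close> stands for one vertex, so its only nonzero count lies in
      the part of that vertex.\<close>
    then have "counts f j (p j) = 1"
      using assms(1,3) that K_le unfolding solution_def by fastforce
    then show "f (cov j) = p j" using counts_cover[OF that, of f "p j"] by presburger
  qed
  have "cut_cost m K nb sz x p = cut_cost m K nb sz (counts f) (\<lambda>j. f (cov j))"
    unfolding cut_cost_def using p assms(3) by (intro sum.cong) auto
  then show "cut_cost m K nb sz x p = card (cut_edges E c (parts vs f))"
    using cut_cost_counts[OF assms(2)] by simp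
qed

definition run :: "nat \<Rightarrow> gstate" where
  "run k = greedy (decode m c (m + c) k) (ginit sz (part_size n c))"

definition run_x :: "nat \<Rightarrow> nat \<Rightarrow> nat \<Rightarrow> nat" where
  "run_x k = fst (run k)"

definition run_r :: "nat \<Rightarrow> nat \<Rightarrow> nat" where
  "run_r k = fst (snd (run k))"

definition run_p :: "nat \<Rightarrow> nat \<Rightarrow> nat" where
  "run_p k = snd (snd (snd (run k)))"

definition run_cost :: "nat \<Rightarrow> nat" where
  "run_cost k = cut_cost m K nb sz (run_x k) (run_p k)"

definition complete :: "nat \<Rightarrow> bool" where
  "complete k \<longleftrightarrow> (\<forall>A<m. run_r k A = 0)"

lemma solution_run:
  assumes "complete k" "m > 0"
  shows "solution (run_x k) (run_p k)"
proof -
  obtain x r d p where run: "run k = (x, r, d, p)" by (metis prod_cases4)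
  have "ginv m c sz (part_size n c) (x, r, d, p)"
    using ginv_greedy[OF ginv_ginit set_decode[OF assms(2) c_pos]] run unfolding run_def by metis
  moreover have "\<forall>A<m. r A = 0" using assms(1) run unfolding complete_def run_r_def by simp
  ultimately have fin: "transport m c sz (part_size n c) x"
      "\<And>A. \<lbrakk>A < m; sz A = 1\<rbrakk> \<Longrightarrow> p A < c \<and> x A (p A) = 1"
    using ginv_final[OF _ _ sum_sz] by blast+
  have "p j < c \<and> x j (p j) = 1" if "j < K" for j
    using fin(2) sz_cover[OF that] that K_le by simp
  then show ?thesis
    using fin(1) run unfolding solution_def run_x_def run_p_def by simp
qed

text \<open>The word comes from \<open>greedy_cut_cost\<close>. As \<open>m > 0\<close>, row 0
  exists and is empty at the end of it, so the padding to length \<open>m + c\<close> changes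
  nothing.\<close>

lemma run_optimal:
  assumes "solution xs ps" "m > 0"
  obtains k where "k < (m * c) ^ (m + c)" "complete k" "run_cost k \<le> cut_cost m K nb sz xs ps"
proof -
  obtain w x r d p where w: "length w \<le> m + c" "set w \<subseteq> {..<m} \<times> {..<c}"
      "greedy w (ginit sz (part_size n c)) = (x, r, d, p)" "\<forall>A<m. r A = 0"
      "cut_cost m K nb sz x p \<le> cut_cost m K nb sz xs ps"
    using greedy_cut_cost[of m c sz "part_size n c" xs K ps nb] assms(1) K_le sz_cover
    unfolding solution_def by blast
  obtain k where k: "k < (m * c) ^ (m + c)"
      "decode m c (m + c) k = w @ replicate (m + c - length w) (0, 0)"
    using decode_surj[OF w(2,1) assms(2) c_pos] by blast
  have "run k = (x, r, d, p)"
    unfolding run_def k(2) greedy_append w(3) using w(4) assms(2) by (simp add: greedy_idle)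
  then show ?thesis
    using that[of k] k(1) w(4,5)
    unfolding complete_def run_cost_def run_x_def run_r_def run_p_def by simp
qed

end

section \<open>Loops over arrays and arcs\<close>

definition for_loop :: "string \<Rightarrow> aexp \<Rightarrow> com \<Rightarrow> com" where
  "for_loop i b p = Seq (Set i (Const 0)) (While (Less (Var i) b) (Seq p (Incr i)))"

lemma writes_for_loop: "writes (for_loop i b p) = insert i (writes p)"
  unfolding for_loop_def by auto

text \<open>The loop bound is evaluated anew in every round and has to keep its value under changes
  within \<open>W\<close>. The body is verified together with the increment, which also shows that
  it restores the counter. The slack 10 and 20 covers test and initialisation.\<close>

lemma ht_for_loop:
  assumes W: "W = insert i (writes p)"
    and b: "\<And>s'. agree W s s' \<Longrightarrow> aval b s' = N"
    and init: "I 0 (s(i := (s i)(0 := 0)))"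
    and step: "\<And>k s'. \<lbrakk>k < N; s' i 0 = k; agree W s s'; I k s'\<rbrakk> \<Longrightarrow>
      ht (Seq p (Incr i)) s' (\<lambda>t s''. t \<le> d \<and> I (Suc k) s'' \<and> s'' i 0 = Suc k)"
    and T: "N * (d + acost b + 10) + acost b + 20 \<le> T"
  shows "ht (for_loop i b p) s (\<lambda>t s'. t \<le> T \<and> I N s' \<and> agree W s s')"
proof -
  let ?s = "s(i := (s i)(0 := 0))"
  let ?b = "Less (Var i) b" and ?p = "Seq p (Incr i)"
  have wp: "writes ?p = W" unfolding W by auto
  have ag: "agree W s ?s" unfolding agree_def W by simp
  define J where "J s' \<longleftrightarrow> s' i 0 \<le> N \<and> I (s' i 0) s'" for s' :: state
  have "ht (While ?b ?p) ?s (\<lambda>t s'. t \<le> (N - ?s i 0) * (d + bcost ?b + 1) + bcost ?b + 1 \<and> J s' \<and>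
      agree (writes ?p) ?s s' \<and> \<not> bval ?b s')"
  proof (rule ht_While[where I = J and f = "\<lambda>s'. N - s' i 0"])
    show "J ?s" unfolding J_def using init by simp
  next
    fix s' assume *: "J s'" "agree (writes ?p) ?s s'" "bval ?b s'"
    have ag': "agree W s s'" using *(2) agree_trans[OF ag] wp by metis
    have lt: "s' i 0 < N" using *(3) b[OF ag'] by simp
    have "ht ?p s' (\<lambda>t s''. t \<le> d \<and> I (Suc (s' i 0)) s'' \<and> s'' i 0 = Suc (s' i 0))"
      using step[OF lt refl ag'] *(1) unfolding J_def by simp
    then show "ht ?p s' (\<lambda>t s''. t \<le> d \<and> J s'' \<and> N - s'' i 0 < N - s' i 0)"
      by (rule ht_mono) (use lt in \<open>auto simp: J_def\<close>)
  qed
  then show ?thesis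
    unfolding for_loop_def ht_Seq ht_Assign aval.simps
  proof (rule ht_mono)
    fix t s' assume *: "t \<le> (N - ?s i 0) * (d + bcost ?b + 1) + bcost ?b + 1 \<and> J s' \<and>
      agree (writes ?p) ?s s' \<and> \<not> bval ?b s'"
    have ag': "agree W s s'" using * agree_trans[OF ag] wp by metis
    have "s' i 0 = N" using * b[OF ag'] unfolding J_def by simp
    moreover have "acost (Const 0) + acost (Const 0) + 1 + t \<le> T"
    proof -
      have "t \<le> N * (d + bcost ?b + 1) + (bcost ?b + 1)" using * by simp
      also have "\<dots> \<le> N * (d + acost b + 10) + (acost b + 10)"
        by (rule add_mono[OF mult_le_mono2]) auto
      finally show ?thesis using T by simp
    qed
    ultimately show "acost (Const 0) + acost (Const 0) + 1 + t \<le> T \<and> I N s' \<and> agree W s s'"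
      using * ag' unfolding J_def by (intro conjI) simp_all
  qed
qed

text \<open>
  One loop instead of two nested ones: every iteration advances one of the counters \<open>v\<close> and \<open>e\<close>, which
  bounds the number of iterations by the number of vertices plus the number of arcs.
\<close>

definition scan :: "com \<Rightarrow> com \<Rightarrow> com" where
  "scan edge fin =
     Seq (Set ''v'' (Const 0)) (Seq (Set ''e'' (Const 0))
       (While (Less (Var ''v'') (Var ''n''))
         (If (Less (Var ''e'') (Cell ''off'' (Plus (Var ''v'') (Const 1))))
           (Seq edge (Incr ''e''))
           (Seq fin (Incr ''v'')))))"

text \<open>The remainder stays in \<open>x\<close>. The time is linear in the dividend, which is
  affordable for its dividends: \<open>n\<close>, and codes that never exceed the number of
  enumerated codes.\<close>

definition divmod_by :: "string \<Rightarrow> string \<Rightarrow> string \<Rightarrow> com" where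
  "divmod_by x y q =
     Seq (Set q (Const 0))
       (While (Not (Less (Var x) (Var y)))
         (Seq (Set x (Minus (Var x) (Var y))) (Incr q)))"

lemma ht_divmod_by:
  assumes dist: "distinct [x, y, q]" and pos: "s y 0 > 0"
  shows "ht (divmod_by x y q) s (\<lambda>t s'. t \<le> 30 * s x 0 + 30 \<and>
    s' = s(x := (s x)(0 := s x 0 mod s y 0), q := (s q)(0 := s x 0 div s y 0)))"
    (is "ht _ s ?Q")
  unfolding divmod_by_def
proof (rule ht_Assign_SeqI)
  \<comment> \<open>The state after \<open>k\<close> subtractions.\<close>
  let ?st = "\<lambda>k. s(x := (s x)(0 := s x 0 - k * s y 0), q := (s q)(0 := k))"
  let ?b = "Not (Less (Var x) (Var y))" and ?p = "Seq (Set x (Minus (Var x) (Var y))) (Incr q)"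
  define I where "I s' \<longleftrightarrow> (\<exists>k. k * s y 0 \<le> s x 0 \<and> s' = ?st k)" for s'
  define s1 where "s1 = s(q := (s q)(aval (Const 0) s := aval (Const 0) s))"
  have "ht (While ?b ?p) s1 (\<lambda>t s'. t \<le> s1 x 0 * (13 + bcost ?b + 1) + bcost ?b + 1 \<and> I s' \<and>
      agree (writes ?p) s1 s' \<and> \<not> bval ?b s')"
  proof (rule ht_While[where I = I and f = "\<lambda>s'. s' x 0"])
    show "I s1"
      unfolding I_def s1_def using dist by (intro exI[of _ 0]) (auto simp: fun_eq_iff)
  next
    fix s' assume "I s'" "bval ?b s'"
    then obtain k where k: "k * s y 0 \<le> s x 0" "s' = ?st k" "s y 0 \<le> s x 0 - k * s y 0"
      unfolding I_def using dist by auto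
    have k': "Suc k * s y 0 \<le> s x 0" using k by simp
    have eq: "s'(x := (s' x)(0 := s' x 0 - s' y 0), q := (s' q)(0 := Suc (s' q 0))) = ?st (Suc k)"
      unfolding k(2) using dist by (auto simp: fun_eq_iff)
    have "I (s'(x := (s' x)(0 := s' x 0 - s' y 0), q := (s' q)(0 := Suc (s' q 0))))"
      unfolding I_def eq using k' by blast
    moreover have "s' x 0 - s' y 0 < s' x 0"
      unfolding k(2) using k(3) dist pos by auto
    ultimately show "ht ?p s' (\<lambda>t s''. t \<le> 13 \<and> I s'' \<and> s'' x 0 < s' x 0)"
      using dist by (auto simp: ht_simps)
  qed
  moreover have "s1 x 0 = s x 0" unfolding s1_def using dist by auto
  ultimately show "ht (While ?b ?p) (s(q := (s q)(aval (Const 0) s := aval (Const 0) s)))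
      (\<lambda>t s'. t \<le> s x 0 * 20 + 7 \<and> I s' \<and> s' x 0 < s' y 0)"
    unfolding s1_def[symmetric] by (auto elim!: ht_mono)
  fix t s' assume *: "t \<le> s x 0 * 20 + 7 \<and> I s' \<and> s' x 0 < s' y 0"
  then obtain k where k: "k * s y 0 \<le> s x 0" "s' = ?st k" unfolding I_def by blast
  have "s x 0 - k * s y 0 < s y 0" using * dist unfolding k(2) by auto
  then have dv: "s x 0 div s y 0 = k"
    using k(1) by (auto intro!: div_nat_eqI simp: algebra_simps)
  then have "s x 0 mod s y 0 = s x 0 - k * s y 0"
    by (metis minus_div_mult_eq_mod)
  with dv k(2) * show "?Q (acost (Const 0) + acost (Const 0) + 1 + t) s'"
    by (intro conjI) simp_all
qed

section \<open>Arcs as positions in the adjacency array\<close>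

context balanced_input
begin

definition off :: "nat \<Rightarrow> nat" where "off i = length (concat (take i adj))"

definition src :: "nat \<Rightarrow> nat set" where "src v = {off v..<off (Suc v)}"

abbreviation nbr_at :: "nat \<Rightarrow> nat" where "nbr_at x \<equiv> concat adj ! x"

abbreviation arcs :: nat where "arcs \<equiv> length (concat adj)"

lemma off_0: "off 0 = 0"
  unfolding off_def by simp

lemma off_n: "off n = arcs"
  unfolding off_def using vs(3) by simp

lemma off_Suc: "v < n \<Longrightarrow> off (Suc v) = off v + length (adj ! v)"
  unfolding off_def using vs(3) by (simp add: take_Suc_conv_app_nth)

lemma off_mono: "i \<le> j \<Longrightarrow> off i \<le> off j"
proof -
  assume "i \<le> j"
  then have "take j adj = take i adj @ take (j - i) (drop i adj)"
    by (metis le_add_diff_inverse take_add)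
  then show ?thesis unfolding off_def by simp
qed

lemma off_le: "v < n \<Longrightarrow> off (Suc v) \<le> arcs"
  using off_mono[of "Suc v" n] off_n by simp

lemma nbr_at_off:
  assumes "v < n" "k < length (adj ! v)"
  shows "nbr_at (off v + k) = adj ! v ! k"
proof -
  have "concat adj = concat (take v adj) @ adj ! v @ concat (drop (Suc v) adj)"
    using assms(1) vs(3) by (metis concat.simps(2) concat_append id_take_nth_drop)
  then show ?thesis using assms(2) unfolding off_def by (simp add: nth_append)
qed

text \<open>Adjacency lists are distinct, so array positions can replace neighbours in sums,
  quantifiers and invariants.\<close>

lemma bij_src:
  assumes "v < n"
  shows "bij_betw nbr_at (src v) (nbr v)"
proof -
  have "bij_betw (\<lambda>k. adj ! v ! k) {..<length (adj ! v)} (nbr v)"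
    using distinct_adj[OF assms] by (simp add: bij_betw_nth)
  moreover have "bij_betw (\<lambda>x. x - off v) (src v) {..<length (adj ! v)}"
    unfolding src_def off_Suc[OF assms]
    by (rule bij_betwI[of _ _ _ "\<lambda>k. off v + k"]) auto
  ultimately have "bij_betw ((\<lambda>k. adj ! v ! k) \<circ> (\<lambda>x. x - off v)) (src v) (nbr v)"
    using bij_betw_trans by blast
  moreover have "((\<lambda>k. adj ! v ! k) \<circ> (\<lambda>x. x - off v)) x = nbr_at x" if "x \<in> src v" for x
    using nbr_at_off[OF assms, of "x - off v"] that off_Suc[OF assms] unfolding src_def by auto
  ultimately show ?thesis using bij_betw_cong[of "src v"] by blast
qed

lemma src_nbr: "\<lbrakk>v < n; x \<in> src v\<rbrakk> \<Longrightarrow> nbr_at x \<in> nbr v"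
  using bij_betwE[OF bij_src] by blast

lemma src_less: "\<lbrakk>v < n; x \<in> src v\<rbrakk> \<Longrightarrow> x < arcs"
  using off_le[of v] unfolding src_def by auto

definition inp :: "state \<Rightarrow> bool" where
  "inp s \<longleftrightarrow> s ''n'' 0 = n \<and> s ''c'' 0 = c \<and> (\<forall>i\<le>n. s ''off'' i = off i) \<and>
     (\<forall>x<arcs. s ''adj'' x = nbr_at x)"

lemma inp_input_state: "inp (input_state adj c)"
  unfolding inp_def input_state_def array_of_def off_def using vs(3)
  by (auto simp del: upt_Suc)

lemma inp_agree:
  "agree W s s' \<Longrightarrow> W \<inter> {''n'', ''c'', ''off'', ''adj''} = {} \<Longrightarrow> inp s \<Longrightarrow> inp s'"
  unfolding inp_def agree_def by (metis (no_types, lifting) disjoint_iff insertCI)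

text \<open>In \<open>J v e\<close>, vertices below \<open>v\<close> are finished and arc positions
  below \<open>e\<close> are processed. \<open>fin\<close> runs exactly when the arcs of
  \<open>v\<close> are used up, and the next list starts at that very position.\<close>

lemma ht_scan:
  assumes inp: "inp s"
    and W: "W = writes edge \<union> writes fin \<union> {''v'', ''e''}"
      "W \<inter> {''n'', ''c'', ''off'', ''adj''} = {}"
    and init: "J 0 0 (s(''v'' := (s ''v'')(0 := 0), ''e'' := (s ''e'')(0 := 0)))"
    and edge: "\<And>v x s'. \<lbrakk>v < n; x \<in> src v; s' ''v'' 0 = v; s' ''e'' 0 = x; inp s'; agree W s s';
        J v x s'\<rbrakk> \<Longrightarrow> ht (Seq edge (Incr ''e'')) s' (\<lambda>t s''. t \<le> d \<and> J v (Suc x) s'' \<and>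
          s'' ''v'' 0 = v \<and> s'' ''e'' 0 = Suc x)"
    and fin: "\<And>v s'. \<lbrakk>v < n; s' ''v'' 0 = v; s' ''e'' 0 = off (Suc v); inp s'; agree W s s';
        J v (off (Suc v)) s'\<rbrakk> \<Longrightarrow> ht (Seq fin (Incr ''v'')) s' (\<lambda>t s''. t \<le> d \<and>
          J (Suc v) (off (Suc v)) s'' \<and> s'' ''v'' 0 = Suc v \<and> s'' ''e'' 0 = off (Suc v))"
  shows "ht (scan edge fin) s (\<lambda>t s'. t \<le> (n + arcs) * (d + 20) + 20 \<and> J n arcs s' \<and> inp s' \<and>
    agree W s s')"
    (is "ht _ s ?Q")
proof -
  let ?s = "s(''v'' := (s ''v'')(0 := 0), ''e'' := (s ''e'')(0 := 0))"
  let ?b = "Less (Var ''v'') (Var ''n'')"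
  let ?eb = "Less (Var ''e'') (Cell ''off'' (Plus (Var ''v'') (Const 1)))"
  let ?p = "If ?eb (Seq edge (Incr ''e'')) (Seq fin (Incr ''v''))"
  have wp: "writes ?p = W" unfolding W(1) by auto
  have ag: "agree W s ?s" unfolding agree_def W(1) by auto
  have inp': "inp s'" if "agree W s s'" for s' using inp_agree[OF that W(2) inp] .
  \<comment> \<open>When \<open>v\<close> reaches \<open>n\<close>, the bounds
    \<open>off n <= e\<close> and \<open>e <= arcs\<close> pin \<open>e\<close> to
    \<open>arcs\<close>.\<close>
  define I where "I s' \<longleftrightarrow> s' ''v'' 0 \<le> n \<and> off (s' ''v'' 0) \<le> s' ''e'' 0 \<and>
      (s' ''v'' 0 < n \<longrightarrow> s' ''e'' 0 \<le> off (Suc (s' ''v'' 0))) \<and> s' ''e'' 0 \<le> arcs \<and>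
      J (s' ''v'' 0) (s' ''e'' 0) s'" for s'
  have I0: "I ?s" unfolding I_def using init off_0 by auto
  define f where "f s' = (n - s' ''v'' 0) + (arcs - s' ''e'' 0)" for s' :: state
  have "ht (While ?b ?p) ?s (\<lambda>t s'. t \<le> f ?s * ((d + 9) + bcost ?b + 1) + bcost ?b + 1 \<and> I s' \<and>
          agree (writes ?p) ?s s' \<and> \<not> bval ?b s')"
  proof (rule ht_While[where I = I and f = f])
    show "I ?s" by (rule I0)
  next
    fix s' assume s': "I s'" "agree (writes ?p) ?s s'" "bval ?b s'"
    have ag': "agree W s s'" using s'(2) agree_trans[OF ag] wp by metis
    define v where "v = s' ''v'' 0"
    define x where "x = s' ''e'' 0"
    have v: "v < n" using s'(3) inp'[OF ag'] unfolding v_def inp_def by simp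
    have o: "s' ''off'' (Suc v) = off (Suc v)" using v inp'[OF ag'] unfolding inp_def by simp
    have Jx: "J v x s'" "off v \<le> x" "x \<le> off (Suc v)" "x \<le> arcs"
      using s'(1) v unfolding I_def v_def x_def by auto
    show "ht ?p s' (\<lambda>t s''. t \<le> d + 9 \<and> I s'' \<and> f s'' < f s')"
    proof (cases "x < off (Suc v)")
      case True
      then have xs: "x \<in> src v" using Jx unfolding src_def by auto
      have xa: "x < arcs" using src_less[OF v xs] .
      have "ht (Seq edge (Incr ''e'')) s' (\<lambda>t s''. t \<le> d \<and> J v (Suc x) s'' \<and>
          s'' ''v'' 0 = v \<and> s'' ''e'' 0 = Suc x)"
        using edge[OF v xs _ _ inp'[OF ag'] ag' Jx(1)] unfolding v_def x_def by simp
      then have "ht (Seq edge (Incr ''e'')) s' (\<lambda>t s''. bcost ?eb + 1 + t \<le> d + 9 \<and> I s'' \<and> f s'' < f s')"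
        by (rule ht_mono) (use v True xa Jx(2) in \<open>auto simp: I_def f_def simp flip: v_def x_def\<close>)
      then show ?thesis using True o unfolding ht_If by (simp add: v_def x_def)
    next
      case False
      then have xe: "x = off (Suc v)" using Jx by simp
      have le: "off (Suc v) \<le> arcs" using off_le[OF v] .
      have "ht (Seq fin (Incr ''v'')) s' (\<lambda>t s''. t \<le> d \<and>
          J (Suc v) (off (Suc v)) s'' \<and> s'' ''v'' 0 = Suc v \<and> s'' ''e'' 0 = off (Suc v))"
        using fin[OF v _ _ inp'[OF ag'] ag'] Jx(1) xe unfolding v_def x_def by simp
      then have "ht (Seq fin (Incr ''v'')) s' (\<lambda>t s''. bcost ?eb + 1 + t \<le> d + 9 \<and> I s'' \<and> f s'' < f s')"
        by (rule ht_mono)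
          (use v xe le off_mono[of "Suc v" "Suc (Suc v)"] in \<open>auto simp: I_def f_def simp flip: v_def x_def\<close>)
      then show ?thesis using False o unfolding ht_If by (simp add: v_def x_def)
    qed
  qed
  then have "ht (While ?b ?p) ?s (\<lambda>t. ?Q (6 + t))"
  proof (rule ht_mono)
    fix t s' assume *: "t \<le> f ?s * ((d + 9) + bcost ?b + 1) + bcost ?b + 1 \<and> I s' \<and>
          agree (writes ?p) ?s s' \<and> \<not> bval ?b s'"
    have ag': "agree W s s'" using * agree_trans[OF ag] wp by metis
    have vn: "s' ''v'' 0 = n" using * inp'[OF ag'] unfolding I_def inp_def by auto
    then have "s' ''e'' 0 = arcs" using * off_n unfolding I_def by auto
    then have "J n arcs s'" using * vn unfolding I_def by metis
    moreover have "f ?s = n + arcs" unfolding f_def by simp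
    then have "6 + t \<le> (n + arcs) * (d + 20) + 20" using * by (simp add: distrib_left)
    ultimately show "?Q (6 + t) s'"
      using ag' inp' by blast
  qed
  then show ?thesis unfolding scan_def ht_Seq ht_Assign by simp
qed

end

section \<open>A vertex cover and the twin classes in linear time\<close>

text \<open>\<open>P\<close> is kept equal to 2^K by doubling, and \<open>pw\<close> stores for a
  cover vertex of index i the weight 2^(i - 1), that is, its bit in neighbourhood codes.\<close>

definition cover_edge :: com where
  "cover_edge =
     If (And (Less (Cell ''ix'' (Var ''v'')) (Const 1))
             (Less (Cell ''ix'' (Cell ''adj'' (Var ''e''))) (Const 1)))
       (Block
         [Assign ''ix'' (Var ''v'') (Plus (Var ''K'') (Const 1)),
          Assign ''ix'' (Cell ''adj'' (Var ''e'')) (Plus (Var ''K'') (Const 2)),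
          Assign ''pw'' (Var ''v'') (Var ''P''),
          Assign ''pw'' (Cell ''adj'' (Var ''e'')) (Plus (Var ''P'') (Var ''P'')),
          Set ''P'' (Plus (Plus (Var ''P'') (Var ''P'')) (Plus (Var ''P'') (Var ''P''))),
          Set ''K'' (Plus (Var ''K'') (Const 2))])
       Skip"

definition cover_prog :: com where
  "cover_prog = Seq (Set ''P'' (Const 1)) (scan cover_edge Skip)"

text \<open>Weights of vertices outside the cover are 0. For a cover vertex the sum is discarded by
  \<open>type_vertex\<close>.\<close>

definition type_edge :: com where
  "type_edge = Set ''ty'' (Plus (Var ''ty'') (Cell ''pw'' (Cell ''adj'' (Var ''e''))))"

text \<open>
  \<open>cl[t]\<close> is one plus the number of the class with neighbourhood code \<open>t\<close>, so that 0 means that no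
  vertex of this type has been met.
\<close>

definition type_vertex :: com where
  "type_vertex =
     Block
       [If (Less (Cell ''ix'' (Var ''v'')) (Const 1))
         (Block
           [If (Less (Cell ''cl'' (Var ''ty'')) (Const 1))
             (Block [Incr ''m'', Assign ''cl'' (Var ''ty'') (Var ''m'')]) Skip,
            Set ''A'' (Minus (Cell ''cl'' (Var ''ty'')) (Const 1))])
         (Set ''A'' (Minus (Cell ''ix'' (Var ''v'')) (Const 1))),
        Assign ''cls'' (Var ''v'') (Var ''A''),
        Assign ''sz'' (Var ''A'') (Plus (Cell ''sz'' (Var ''A'')) (Const 1)),
        Set ''ty'' (Const 0)]"

definition types_prog :: com where
  "types_prog = Seq (Set ''m'' (Var ''K'')) (scan type_edge type_vertex)"

text \<open>The row offsets \<open>A * c\<close> and \<open>A * K\<close> are tabulated by repeated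
  addition, so that later accesses to matrices in row-major order take constant time.\<close>

definition rows_body :: com where
  "rows_body =
     Block
       [Assign ''cb'' (Var ''A'') (Var ''a''), Assign ''kb'' (Var ''A'') (Var ''b''),
        Set ''a'' (Plus (Var ''a'') (Var ''c'')), Set ''b'' (Plus (Var ''b'') (Var ''K''))]"

definition rows_prog :: com where
  "rows_prog =
     Block
       [Set ''a'' (Const 0), Set ''b'' (Const 0), for_loop ''A'' (Var ''m'') rows_body,
        Set ''M'' (Var ''a'')]"

text \<open>\<open>bexp\<close> has no disjunction; the nested negations express that
  \<open>v\<close> lies outside the cover or has the larger index.\<close>

definition nb_edge :: com where
  "nb_edge =
     If (And (Less (Const 0) (Cell ''ix'' (Cell ''adj'' (Var ''e''))))
             (Not (And (Less (Const 0) (Cell ''ix'' (Var ''v'')))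
                       (Not (Less (Cell ''ix'' (Cell ''adj'' (Var ''e'')))
                                  (Cell ''ix'' (Var ''v'')))))))
       (Assign ''nb''
         (Plus (Cell ''kb'' (Cell ''cls'' (Var ''v'')))
               (Minus (Cell ''ix'' (Cell ''adj'' (Var ''e''))) (Const 1)))
         (Const 1))
       Skip"

definition nb_prog :: com where
  "nb_prog = scan nb_edge Skip"

lemma row_major_inj:
  fixes i j :: nat
  assumes "i < c" "j < c"
  shows "A * c + i = B * c + j \<longleftrightarrow> A = B \<and> i = j"
proof
  assume eq: "A * c + i = B * c + j"
  have "(A * c + i) div c = A" "(B * c + j) div c = B" using assms by auto
  then show "A = B \<and> i = j" using eq by auto
qed simp

lemma card_class_Suc:
  assumes "\<forall>A. sz A = card {u. u < v \<and> cls u = A}"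
  shows "\<forall>A. (sz(a := Suc (sz a))) A = card {u. u < Suc v \<and> (cls(v := a)) u = A}"
proof
  fix A
  have "{u. u < Suc v \<and> (cls(v := a)) u = A} =
      (if a = A then insert v {u. u < v \<and> cls u = A} else {u. u < v \<and> cls u = A})"
    by (auto simp: less_Suc_eq)
  then show "(sz(a := Suc (sz a))) A = card {u. u < Suc v \<and> (cls(v := a)) u = A}"
    using assms by auto
qed

section \<open>The matching cover\<close>

context balanced_input
begin

lemma src_unique: "\<lbrakk>x \<in> src v; x \<in> src u\<rbrakk> \<Longrightarrow> v = u"
proof (rule ccontr)
  assume *: "x \<in> src v" "x \<in> src u" "v \<noteq> u"
  then consider "Suc v \<le> u" | "Suc u \<le> v" by linarith
  then show False
  proof cases
    case 1
    then show False using off_mono[OF 1] * unfolding src_def by simp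
  next
    case 2
    then show False using off_mono[OF 2] * unfolding src_def by simp
  qed
qed

text \<open>\<open>S\<close> is an arbitrary vertex cover that the program never reads. The last
  conjunct carries the factor 2 of maximal matchings: each matched edge raises \<open>K\<close> by
  two and marks a new vertex of \<open>S\<close>.\<close>

definition cover_ok ::
    "'a set \<Rightarrow> nat \<Rightarrow> (nat \<Rightarrow> nat) \<Rightarrow> (nat \<Rightarrow> nat) \<Rightarrow> nat \<Rightarrow> nat \<Rightarrow> bool" where
  "cover_ok S e ix pw K P \<longleftrightarrow>
     bij_betw ix {v. v < n \<and> ix v > 0} {1..K} \<and> P = 2 ^ K \<and>
     (\<forall>u<n. pw u = (if ix u = 0 then 0 else 2 ^ (ix u - 1))) \<and>
     (\<forall>v<n. \<forall>x\<in>src v. x < e \<longrightarrow> ix v > 0 \<or> ix (nbr_at x) > 0) \<and>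
     K \<le> 2 * card {v. v < n \<and> ix v > 0 \<and> vs ! v \<in> S}"

lemma cover_ok_skip:
  assumes "cover_ok S x ix pw K P" "v < n" "x \<in> src v" "ix v > 0 \<or> ix (nbr_at x) > 0"
  shows "cover_ok S (Suc x) ix pw K P"
proof -
  have "ix w > 0 \<or> ix (nbr_at y) > 0" if "w < n" "y \<in> src w" "y < Suc x" for w y
  proof (cases "y = x")
    case True
    then show ?thesis using src_unique[OF assms(3), of w] that assms(4) by simp
  next
    case False
    then show ?thesis using assms(1) that unfolding cover_ok_def by auto
  qed
  then have "\<forall>w<n. \<forall>y\<in>src w. y < Suc x \<longrightarrow> ix w > 0 \<or> ix (nbr_at y) > 0"
    by (intro allI ballI impI)
  with assms(1) show ?thesis
    unfolding cover_ok_def by - (elim conjE, intro conjI, assumption+)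
qed

text \<open>Both endpoints of an uncovered edge are taken, and at least one of them lies in \<open>S\<close>.\<close>

lemma cover_ok_take:
  assumes ok: "cover_ok S x ix pw K P" and S: "vertex_cover V E S"
    and v: "v < n" "x \<in> src v" "u = nbr_at x" "ix v = 0" "ix u = 0"
  shows "cover_ok S (Suc x) (ix(v := Suc K, u := Suc (Suc K))) (pw(v := P, u := P + P))
    (Suc (Suc K)) (P + P + (P + P))"
proof -
  let ?ix = "ix(v := Suc K, u := Suc (Suc K))"
  let ?M = "\<lambda>ix. {v. v < n \<and> ix v > (0::nat)}"
  have u: "u \<in> nbr v" "u < n" "u \<noteq> v" "{vs ! v, vs ! u} \<in> E"
    using src_nbr[OF v(1,2)] v nbr_irrefl nbr_iff by auto
  have bij: "bij_betw ix (?M ix) {1..K}" using ok unfolding cover_ok_def by blast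
  have M: "?M ?ix = (?M ix \<union> {v}) \<union> {u}" using v(1) u(2) by auto
  have "bij_betw ?ix (?M ix) {1..K}"
    using bij v(4,5) by (subst bij_betw_cong[where g = ix]) auto
  then have "bij_betw ?ix (?M ix \<union> {v}) ({1..K} \<union> {?ix v})"
    by (rule notIn_Un_bij_betw[rotated 2]) (use v u in auto)
  then have b: "bij_betw ?ix ((?M ix \<union> {v}) \<union> {u}) (({1..K} \<union> {?ix v}) \<union> {?ix u})"
    by (rule notIn_Un_bij_betw[rotated 2]) (use v u in auto)
  have eq: "({1..K} \<union> {?ix v}) \<union> {?ix u} = {1..Suc (Suc K)}" using u by auto
  have bij': "bij_betw ?ix (?M ?ix) {1..Suc (Suc K)}" using b unfolding M eq .
  have "{vs ! v, vs ! u} \<inter> S \<noteq> {}"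
    by (rule S[unfolded vertex_cover_def, THEN conjunct2, rule_format, OF u(4)])
  then have "vs ! v \<in> S \<or> vs ! u \<in> S" by auto
  then obtain z where z: "z \<in> {v, u}" "vs ! z \<in> S" by blast
  have "Suc (card {v. v < n \<and> ix v > 0 \<and> vs ! v \<in> S}) =
      card (insert z {v. v < n \<and> ix v > 0 \<and> vs ! v \<in> S})"
    using z v by (subst card_insert_disjoint) auto
  also have "\<dots> \<le> card {v. v < n \<and> ?ix v > 0 \<and> vs ! v \<in> S}"
    using z v u by (intro card_mono) auto
  finally have card: "Suc (Suc K) \<le> 2 * card {v. v < n \<and> ?ix v > 0 \<and> vs ! v \<in> S}"
    using ok unfolding cover_ok_def by linarith
  have cov: "?ix w > 0 \<or> ?ix (nbr_at y) > 0" if "w < n" "y \<in> src w" "y < Suc x" for w y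
  proof (cases "y = x")
    case True
    then show ?thesis using src_unique[OF v(2)] that by simp
  next
    case False
    then show ?thesis using ok that unfolding cover_ok_def by auto
  qed
  have pw: "(pw(v := P, u := P + P)) w = (if ?ix w = 0 then 0 else 2 ^ (?ix w - 1))" if "w < n" for w
    using ok that unfolding cover_ok_def by auto
  have P: "P + P + (P + P) = 2 ^ Suc (Suc K)" using ok unfolding cover_ok_def by simp
  show ?thesis
    unfolding cover_ok_def
  proof (intro conjI)
    show "bij_betw ?ix (?M ?ix) {1..Suc (Suc K)}" by (rule bij')
    show "P + P + (P + P) = 2 ^ Suc (Suc K)" by (rule P)
    show "\<forall>w<n. (pw(v := P, u := P + P)) w = (if ?ix w = 0 then 0 else 2 ^ (?ix w - 1))"
      using pw by simp
    show "\<forall>w<n. \<forall>y\<in>src w. y < Suc x \<longrightarrow> ?ix w > 0 \<or> ?ix (nbr_at y) > 0"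
      using cov by (intro allI ballI impI)
    show "Suc (Suc K) \<le> 2 * card {v. v < n \<and> ?ix v > 0 \<and> vs ! v \<in> S}" by (rule card)
  qed
qed

lemma ht_cover_prog:
  assumes inp: "inp s" and S: "vertex_cover V E S"
    and zero: "s ''ix'' = (\<lambda>_. 0)" "s ''pw'' = (\<lambda>_. 0)" "s ''K'' 0 = 0"
  shows "ht cover_prog s (\<lambda>t s'. t \<le> (n + arcs) * 200 + 200 \<and> inp s' \<and>
    cover_ok S arcs (s' ''ix'') (s' ''pw'') (s' ''K'' 0) (s' ''P'' 0) \<and>
    agree {''ix'', ''pw'', ''K'', ''P'', ''v'', ''e''} s s')"
proof -
  define J where "J v e s' \<longleftrightarrow> cover_ok S e (s' ''ix'') (s' ''pw'') (s' ''K'' 0) (s' ''P'' 0)"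
    for v e :: nat and s' :: state
  let ?s = "s(''P'' := (s ''P'')(0 := 1))"
  let ?W = "writes cover_edge \<union> writes Skip \<union> {''v'', ''e''}"
  have W: "?W = {''ix'', ''pw'', ''K'', ''P'', ''v'', ''e''}"
    unfolding cover_edge_def by auto
  have "ht (scan cover_edge Skip) ?s (\<lambda>t s'. t \<le> (n + arcs) * (150 + 20) + 20 \<and> J n arcs s' \<and>
      inp s' \<and> agree ?W ?s s')"
  proof (rule ht_scan)
    show "inp ?s" using inp unfolding inp_def by simp
    show "?W \<inter> {''n'', ''c'', ''off'', ''adj''} = {}" unfolding W by simp
    show "J 0 0 (?s(''v'' := (?s ''v'')(0 := 0), ''e'' := (?s ''e'')(0 := 0)))"
      unfolding J_def cover_ok_def using zero by (simp add: bij_betw_def)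
  next
    fix v x s'
    assume *: "v < n" "x \<in> src v" "s' ''v'' 0 = v" "s' ''e'' 0 = x" "inp s'" "J v x s'"
    have ad: "s' ''adj'' x = nbr_at x" using src_less[OF *(1,2)] *(5) unfolding inp_def by simp
    have ne: "nbr_at x \<noteq> v" using src_nbr nbr_irrefl * by metis
    show "ht (Seq cover_edge (Incr ''e'')) s' (\<lambda>t s''. t \<le> 150 \<and> J v (Suc x) s'' \<and>
        s'' ''v'' 0 = v \<and> s'' ''e'' 0 = Suc x)"
    proof (cases "s' ''ix'' v = 0 \<and> s' ''ix'' (nbr_at x) = 0")
      case True
      note take = cover_ok_take[OF *(6)[unfolded J_def] S *(1,2) refl]
      show ?thesis
        using True take *(3,4) ad ne unfolding cover_edge_def J_def by (simp add: ht_simps)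
    next
      case False
      then have "s' ''ix'' v > 0 \<or> s' ''ix'' (nbr_at x) > 0" by auto
      note skip = cover_ok_skip[OF *(6)[unfolded J_def] *(1,2) this]
      show ?thesis
        using False skip *(3,4) ad unfolding cover_edge_def J_def by (auto simp: ht_simps)
    qed
  next
    fix v s'
    assume "s' ''v'' 0 = v" "s' ''e'' 0 = off (Suc v)" "J v (off (Suc v)) s'"
    then show "ht (Seq Skip (Incr ''v'')) s' (\<lambda>t s''. t \<le> 150 \<and>
          J (Suc v) (off (Suc v)) s'' \<and> s'' ''v'' 0 = Suc v \<and> s'' ''e'' 0 = off (Suc v))"
      unfolding J_def by (simp add: ht_simps)
  qed simp
  then show ?thesis
    unfolding cover_prog_def W
    by (simp add: ht_simps) (erule ht_mono, auto simp: J_def agree_def)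
qed

end

section \<open>Neighbourhood codes and class numbers\<close>

context cover_index
begin

definition nbr_code :: "nat \<Rightarrow> nat" where
  "nbr_code v = set_encode ((\<lambda>u. ix u - 1) ` nbr v)"

lemma inj_nbr: "inj_on (\<lambda>u. ix u - 1) {u. u < n \<and> ix u > 0}"
proof (rule inj_onI)
  fix u w assume "u \<in> {u. u < n \<and> ix u > 0}" "w \<in> {u. u < n \<and> ix u > 0}" "ix u - 1 = ix w - 1"
  then show "u = w" using ix_bij unfolding bij_betw_def by (auto intro: inj_onD)
qed

lemma nbr_marked: "\<lbrakk>v < n; ix v = 0\<rbrakk> \<Longrightarrow> nbr v \<subseteq> {u. u < n \<and> ix u > 0}"
  using covered nbr_iff by fastforce

text \<open>The neighbours of a vertex outside the cover all lie in the cover, where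
  \<open>ix\<close> is injective.\<close>

lemma nbr_code_inj:
  assumes "v < n" "w < n" "ix v = 0" "ix w = 0" "nbr_code v = nbr_code w"
  shows "nbr v = nbr w"
proof -
  have "(\<lambda>u. ix u - 1) ` nbr v = (\<lambda>u. ix u - 1) ` nbr w"
    using assms(5) unfolding nbr_code_def by (simp add: set_encode_eq)
  then show ?thesis
    using inj_on_image_eq_iff[OF inj_nbr nbr_marked nbr_marked] assms by blast
qed

text \<open>Distinct neighbours have distinct indices, so the weights are different powers of two
  and no carries occur.\<close>

lemma nbr_code_sum:
  assumes "v < n" "ix v = 0" "\<And>u. u < n \<Longrightarrow> pw u = (if ix u = 0 then 0 else 2 ^ (ix u - 1))"
  shows "(\<Sum>x\<in>src v. pw (nbr_at x)) = nbr_code v"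
proof -
  have "(\<Sum>x\<in>src v. pw (nbr_at x)) = (\<Sum>u\<in>nbr v. pw u)"
    by (rule sum.reindex_bij_betw[OF bij_src[OF assms(1)]])
  also have "\<dots> = (\<Sum>u\<in>nbr v. 2 ^ (ix u - 1))"
    using nbr_marked[OF assms(1,2)] assms(3) by (intro sum.cong) auto
  also have "\<dots> = nbr_code v"
    unfolding nbr_code_def set_encode_def
    using sum.reindex[OF inj_on_subset[OF inj_nbr nbr_marked[OF assms(1,2)]], of "(^) (2::nat)"]
    by (simp add: comp_def)
  finally show ?thesis .
qed

lemma nbr_code_less:
  assumes "v < n" "ix v = 0"
  shows "nbr_code v < 2 ^ K"
proof -
  have "nbr_code v \<le> (\<Sum>i\<in>{..<K}. 2 ^ i)"
    unfolding nbr_code_def set_encode_def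
    using nbr_marked[OF assms] ix_le by (intro sum_mono2) fastforce+
  also have "\<dots> < 2 ^ K" by (induction K) auto
  finally show ?thesis .
qed

text \<open>The injectivity of \<open>cl\<close> on the codes met so far makes members of one class
  twins; the bound on these codes gives at most 2^K classes outside the cover.\<close>

definition types_ok ::
    "nat \<Rightarrow> nat \<Rightarrow> (nat \<Rightarrow> nat) \<Rightarrow> (nat \<Rightarrow> nat) \<Rightarrow> (nat \<Rightarrow> nat) \<Rightarrow> bool" where
  "types_ok v m cl cls sz \<longleftrightarrow>
     K \<le> m \<and> bij_betw cl {t. cl t > 0} {K<..m} \<and> {t. cl t > 0} \<subseteq> {..<2 ^ K} \<and>
     (\<forall>u<v. cls u < m \<and> (ix u > 0 \<longrightarrow> cls u = ix u - 1) \<and>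
        (ix u = 0 \<longrightarrow> cl (nbr_code u) = Suc (cls u))) \<and>
     (\<forall>A. sz A = card {u. u < v \<and> cls u = A})"

lemma types_ok_Suc:
  assumes "types_ok v m cl cls sz" "a < m" "ix v > 0 \<Longrightarrow> a = ix v - 1"
    "ix v = 0 \<Longrightarrow> cl (nbr_code v) = Suc a"
  shows "types_ok (Suc v) m cl (cls(v := a)) (sz(a := Suc (sz a)))"
  using assms card_class_Suc[of sz v cls a] unfolding types_ok_def by (auto simp: less_Suc_eq)

lemma types_ok_cover:
  assumes "types_ok v m cl cls sz" "v < n" "ix v > 0"
  shows "types_ok (Suc v) m cl (cls(v := ix v - 1)) (sz(ix v - 1 := Suc (sz (ix v - 1))))"
proof (rule types_ok_Suc[OF assms(1)])
  show "ix v - 1 < m" using ix_le[OF assms(2)] assms(1,3) unfolding types_ok_def by linarith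
qed (use assms(3) in auto)

lemma types_ok_old:
  assumes "types_ok v m cl cls sz" "ix v = 0" "cl (nbr_code v) > 0"
  shows "types_ok (Suc v) m cl (cls(v := cl (nbr_code v) - 1))
    (sz(cl (nbr_code v) - 1 := Suc (sz (cl (nbr_code v) - 1))))"
proof (rule types_ok_Suc[OF assms(1)])
  have "cl (nbr_code v) \<in> {K<..m}"
    using assms(1,3) unfolding types_ok_def by (metis (mono_tags, lifting) bij_betwE mem_Collect_eq)
  then show "cl (nbr_code v) - 1 < m" by auto
qed (use assms(2,3) in auto)

lemma types_ok_new:
  assumes ok: "types_ok v m cl cls sz" and v: "v < n" "ix v = 0" and t: "cl (nbr_code v) = 0"
  shows "types_ok (Suc v) (Suc m) (cl(nbr_code v := Suc m)) (cls(v := m)) (sz(m := Suc (sz m)))"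
proof (rule types_ok_Suc)
  let ?t = "nbr_code v"
  let ?cl = "cl(?t := Suc m)"
  have bij: "bij_betw cl {t. cl t > 0} {K<..m}" and Km: "K \<le> m"
    using ok unfolding types_ok_def by auto
  have "bij_betw ?cl {t. cl t > 0} {K<..m}"
    using bij t by (subst bij_betw_cong[where g = cl]) auto
  then have "bij_betw ?cl ({t. cl t > 0} \<union> {?t}) ({K<..m} \<union> {?cl ?t})"
    by (rule notIn_Un_bij_betw[rotated 2]) (use t in auto)
  moreover have "{t. ?cl t > 0} = {t. cl t > 0} \<union> {?t}" "{K<..Suc m} = {K<..m} \<union> {?cl ?t}"
    using Km by auto
  ultimately have bij': "bij_betw ?cl {t. ?cl t > 0} {K<..Suc m}" by simp
  have "{t. ?cl t > 0} \<subseteq> {..<2 ^ K}"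
    using ok nbr_code_less[OF v] unfolding types_ok_def by auto
  moreover have "\<forall>u<v. cls u < Suc m \<and> (ix u > 0 \<longrightarrow> cls u = ix u - 1) \<and>
      (ix u = 0 \<longrightarrow> ?cl (nbr_code u) = Suc (cls u))"
    using ok t unfolding types_ok_def by (metis fun_upd_other less_SucI nat.distinct(1))
  ultimately show "types_ok v (Suc m) ?cl cls sz"
    using ok bij' Km unfolding types_ok_def by simp
qed (use v in auto)

lemma types_ok_final:
  assumes "types_ok n m cl cls sz"
    and nb: "\<And>A j. \<lbrakk>A < m; j < K\<rbrakk> \<Longrightarrow> nb A j \<longleftrightarrow>
      (\<exists>v u. v < n \<and> u \<in> nbr v \<and> cls v = A \<and> ix u = Suc j \<and> (ix v = 0 \<or> ix u < ix v))"
  shows "twin_classes V E c vs adj ix K m cls sz nb" and "m \<le> K + 2 ^ K"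
proof -
  have bij: "bij_betw cl {t. cl t > 0} {K<..m}" and Km: "K \<le> m" and sub: "{t. cl t > 0} \<subseteq> {..<2 ^ K}"
    and cls: "\<And>u. u < n \<Longrightarrow> cls u < m \<and> (ix u > 0 \<longrightarrow> cls u = ix u - 1) \<and>
        (ix u = 0 \<longrightarrow> cl (nbr_code u) = Suc (cls u))"
    and sz: "\<And>A. sz A = card {u. u < n \<and> cls u = A}"
    using assms(1) unfolding types_ok_def by auto
  have "card {K<..m} \<le> card {..<(2::nat) ^ K}"
    using bij_betw_same_card[OF bij] card_mono[OF _ sub] by simp
  then show "m \<le> K + 2 ^ K" by simp
  have other: "K \<le> cls v" if "v < n" "ix v = 0" for v
  proof -
    have "cl (nbr_code v) = Suc (cls v)" using cls[OF that(1)] that(2) by simp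
    then have "Suc (cls v) \<in> {K<..m}"
      using bij_betwE[OF bij] by (metis mem_Collect_eq zero_less_Suc)
    then show ?thesis by simp
  qed
  have twins: "nbr v = nbr u" if "v < n" "u < n" "ix v = 0" "ix u = 0" "cls v = cls u" for v u
  proof -
    have "cl (nbr_code v) = cl (nbr_code u)" "cl (nbr_code v) > 0" "cl (nbr_code u) > 0"
      using cls that by auto
    then have "nbr_code v = nbr_code u"
      using bij unfolding bij_betw_def by (auto dest: inj_onD)
    then show ?thesis using nbr_code_inj that by blast
  qed
  show "twin_classes V E c vs adj ix K m cls sz nb"
  proof unfold_locales
    show "nb A j \<longleftrightarrow> (\<exists>v u. v < n \<and> u \<in> nbr v \<and> cls v = A \<and> ix u = Suc j \<and>
        (ix v = 0 \<or> ix u < ix v))" if "A < m" "j < K" for A j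
      using nb[OF that] .
    show "nbr v = nbr u" if "v < n" "u < n" "ix v = 0" "ix u = 0" "cls v = cls u" for v u
      using twins[OF that] .
    show "sz A = card {v. v < n \<and> cls v = A}" if "A < m" for A
      by (rule sz)
  qed (use ix_bij covered Km cls other in auto)
qed

lemma ht_types_prog:
  assumes inp: "inp s" and s: "s ''ix'' = ix" "s ''K'' 0 = K"
    and pw: "\<And>u. u < n \<Longrightarrow> s ''pw'' u = (if ix u = 0 then 0 else 2 ^ (ix u - 1))"
    and zero: "s ''cl'' = (\<lambda>_. 0)" "s ''sz'' = (\<lambda>_. 0)" "s ''ty'' 0 = 0"
  shows "ht types_prog s (\<lambda>t s'. t \<le> (n + arcs) * 200 + 200 \<and> inp s' \<and>
    types_ok n (s' ''m'' 0) (s' ''cl'') (s' ''cls'') (s' ''sz'') \<and>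
    agree {''m'', ''cl'', ''cls'', ''sz'', ''ty'', ''A'', ''v'', ''e''} s s')"
proof -
  \<comment> \<open>\<open>ty\<close> holds the partial sum over the scanned arcs of the current
    vertex. On moving to the next vertex the interval is empty, which matches the reset in
    \<open>type_vertex\<close>.\<close>
  define J where "J v e s' \<longleftrightarrow> types_ok v (s' ''m'' 0) (s' ''cl'') (s' ''cls'') (s' ''sz'') \<and>
      s' ''ty'' 0 = (\<Sum>x\<in>{off v..<e}. s ''pw'' (nbr_at x))"
    for v e :: nat and s' :: state
  let ?s = "s(''m'' := (s ''m'')(0 := s ''K'' 0))"
  let ?W = "writes type_edge \<union> writes type_vertex \<union> {''v'', ''e''}"
  have W: "?W = {''m'', ''cl'', ''cls'', ''sz'', ''ty'', ''A'', ''v'', ''e''}"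
    unfolding type_edge_def type_vertex_def by auto
  have "ht (scan type_edge type_vertex) ?s (\<lambda>t s'. t \<le> (n + arcs) * (150 + 20) + 20 \<and> J n arcs s' \<and>
      inp s' \<and> agree ?W ?s s')"
  proof (rule ht_scan)
    show "inp ?s" using inp unfolding inp_def by simp
    show "?W \<inter> {''n'', ''c'', ''off'', ''adj''} = {}" unfolding W by simp
    show "J 0 0 (?s(''v'' := (?s ''v'')(0 := 0), ''e'' := (?s ''e'')(0 := 0)))"
      unfolding J_def types_ok_def using zero s off_0 by (simp add: bij_betw_def)
  next
    fix v x s'
    assume *: "v < n" "x \<in> src v" "s' ''v'' 0 = v" "s' ''e'' 0 = x" "inp s'" "agree ?W ?s s'" "J v x s'"
    have ad: "s' ''adj'' x = nbr_at x" using src_less[OF *(1,2)] *(5) unfolding inp_def by simp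
    have pw': "s' ''pw'' = s ''pw''" using *(6) unfolding W agree_def by simp
    have "off v \<le> x" using *(2) unfolding src_def by simp
    then show "ht (Seq type_edge (Incr ''e'')) s' (\<lambda>t s''. t \<le> 150 \<and> J v (Suc x) s'' \<and>
        s'' ''v'' 0 = v \<and> s'' ''e'' 0 = Suc x)"
      using *(3,4,7) ad pw' unfolding type_edge_def J_def by (simp add: ht_simps sum.atLeastLessThan_Suc)
  next
    fix v s'
    assume *: "v < n" "s' ''v'' 0 = v" "s' ''e'' 0 = off (Suc v)" "agree ?W ?s s'"
      "J v (off (Suc v)) s'"
    have ix': "s' ''ix'' = ix" using *(4) s unfolding W agree_def by simp
    have ok: "types_ok v (s' ''m'' 0) (s' ''cl'') (s' ''cls'') (s' ''sz'')"
      using *(5) unfolding J_def by blast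
    have ty: "s' ''ty'' 0 = nbr_code v" if "ix v = 0"
      using *(5) nbr_code_sum[OF *(1) that pw] unfolding J_def src_def by simp
    show "ht (Seq type_vertex (Incr ''v'')) s' (\<lambda>t s''. t \<le> 150 \<and>
          J (Suc v) (off (Suc v)) s'' \<and> s'' ''v'' 0 = Suc v \<and> s'' ''e'' 0 = off (Suc v))"
    proof (cases "ix v = 0")
      case False
      then show ?thesis
        using types_ok_cover[OF ok *(1)] *(2,3) ix' unfolding type_vertex_def J_def
        by (simp add: ht_simps)
    next
      case ixv: True
      show ?thesis
      proof (cases "s' ''cl'' (nbr_code v) = 0")
        case True
        then show ?thesis
          using types_ok_new[OF ok *(1) ixv] ixv *(2,3) ix' ty unfolding type_vertex_def J_def
          by (simp add: ht_simps)
      next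
        case False
        then show ?thesis
          using types_ok_old[OF ok ixv] ixv *(2,3) ix' ty unfolding type_vertex_def J_def
          by (simp add: ht_simps)
      qed
    qed
  qed simp
  then show ?thesis
    unfolding types_prog_def W
    by (simp add: ht_simps) (erule ht_mono, auto simp: J_def agree_def)
qed

end

section \<open>Row offsets and the number of codes\<close>

lemma ht_rows_prog:
  "ht rows_prog s (\<lambda>t s'. t \<le> 100 * s ''m'' 0 + 100 \<and>
     (\<forall>A<s ''m'' 0. s' ''cb'' A = A * s ''c'' 0 \<and> s' ''kb'' A = A * s ''K'' 0) \<and>
     s' ''M'' 0 = s ''m'' 0 * s ''c'' 0 \<and>
     agree {''A'', ''a'', ''b'', ''cb'', ''kb'', ''M''} s s')"
proof -
  let ?s = "s(''a'' := (s ''a'')(0 := 0), ''b'' := (s ''b'')(0 := 0))"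
  let ?W = "{''A'', ''a'', ''b'', ''cb'', ''kb''}"
  define I where "I k s' \<longleftrightarrow> s' ''a'' 0 = k * s ''c'' 0 \<and> s' ''b'' 0 = k * s ''K'' 0 \<and>
      (\<forall>A<k. s' ''cb'' A = A * s ''c'' 0 \<and> s' ''kb'' A = A * s ''K'' 0)" for k and s' :: state
  have "ht (for_loop ''A'' (Var ''m'') rows_body) ?s
      (\<lambda>t s'. t \<le> 70 * s ''m'' 0 + 50 \<and> I (s ''m'' 0) s' \<and> agree ?W ?s s')"
  proof (rule ht_for_loop[where I = I])
    show "?W = insert ''A'' (writes rows_body)" unfolding rows_body_def by auto
    show "aval (Var ''m'') s' = s ''m'' 0" if "agree ?W ?s s'" for s'
      using that unfolding agree_def by simp
    show "I 0 (?s(''A'' := (?s ''A'')(0 := 0)))" unfolding I_def by simp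
    fix k s' assume *: "s' ''A'' 0 = k" "agree ?W ?s s'" "I k s'"
    have "s' ''c'' = s ''c''" "s' ''K'' = s ''K''" using *(2) unfolding agree_def by simp_all
    then show "ht (Seq rows_body (Incr ''A'')) s' (\<lambda>t s''. t \<le> 50 \<and> I (Suc k) s'' \<and>
        s'' ''A'' 0 = Suc k)"
      using *(1,3) unfolding I_def rows_body_def by (auto simp: ht_simps less_Suc_eq)
  qed simp
  then show ?thesis
    unfolding rows_prog_def by (simp add: ht_simps I_def) (erule ht_mono, simp add: agree_def)
qed

definition double_prog :: com where
  "double_prog = for_loop ''i'' (Var ''M'') (Set ''bb'' (Plus (Var ''bb'') (Var ''bb'')))"

text \<open>Doubling \<open>M\<close> times in each of \<open>m + c\<close> rounds realises the
  exponent \<open>M * (m + c)\<close> without a multiplication.\<close>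

definition bound_prog :: com where
  "bound_prog = Seq (Set ''bb'' (Const 1)) (for_loop ''j'' (Plus (Var ''m'') (Var ''c'')) double_prog)"

lemma ht_double_prog:
  "ht double_prog s (\<lambda>t s'. t \<le> 50 * s ''M'' 0 + 50 \<and> s' ''bb'' 0 = s ''bb'' 0 * 2 ^ s ''M'' 0 \<and>
     agree {''bb'', ''i''} s s')"
  unfolding double_prog_def
proof (rule ht_for_loop[where d = 20 and I = "\<lambda>k s'. s' ''bb'' 0 = s ''bb'' 0 * 2 ^ k"])
  show "{''bb'', ''i''} = insert ''i'' (writes (Set ''bb'' (Plus (Var ''bb'') (Var ''bb''))))"
    by auto
qed (auto simp: ht_simps agree_def)

lemma ht_bound_prog:
  "ht bound_prog s (\<lambda>t s'. t \<le> (s ''m'' 0 + s ''c'' 0) * (50 * s ''M'' 0 + 100) + 50 \<and>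
     s' ''bb'' 0 = 2 ^ (s ''M'' 0 * (s ''m'' 0 + s ''c'' 0)) \<and>
     agree {''bb'', ''i'', ''j''} s s')"
  unfolding bound_prog_def
proof (rule ht_Assign_SeqI)
  let ?N = "s ''m'' 0 + s ''c'' 0" and ?b = "Plus (Var ''m'') (Var ''c'')"
  let ?s = "s(''bb'' := (s ''bb'')(aval (Const 0) s := aval (Const 1) s))"
  let ?W = "{''bb'', ''i'', ''j''}"
  show "ht (for_loop ''j'' ?b double_prog) ?s (\<lambda>t s'. t \<le> ?N * (50 * s ''M'' 0 + 100) + 30 \<and>
      s' ''bb'' 0 = 2 ^ (s ''M'' 0 * ?N) \<and> agree ?W ?s s')"
  proof (rule ht_for_loop[where I = "\<lambda>k s'. s' ''bb'' 0 = 2 ^ (s ''M'' 0 * k)"])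
    show "?W = insert ''j'' (writes double_prog)"
      unfolding double_prog_def writes_for_loop by auto
    show "aval ?b s' = ?N" if "agree ?W ?s s'" for s' using that unfolding agree_def by simp
    show "(?s(''j'' := (?s ''j'')(0 := 0))) ''bb'' 0 = 2 ^ (s ''M'' 0 * 0)" by simp
    fix k s' assume *: "s' ''j'' 0 = k" "agree ?W ?s s'" "s' ''bb'' 0 = 2 ^ (s ''M'' 0 * k)"
    have M: "s' ''M'' 0 = s ''M'' 0" using *(2) unfolding agree_def by simp
    show "ht (Seq double_prog (Incr ''j'')) s' (\<lambda>t s''. t \<le> 50 * s ''M'' 0 + 60 \<and>
        s'' ''bb'' 0 = 2 ^ (s ''M'' 0 * Suc k) \<and> s'' ''j'' 0 = Suc k)"
      by (rule ht_SeqI[OF ht_double_prog]) (use * M in \<open>simp add: ht_simps agree_def power_add\<close>)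
  next
    have "?N * (50 * s ''M'' 0 + 60 + acost ?b + 10) + (acost ?b + 20) \<le>
        ?N * (50 * s ''M'' 0 + 100) + 30"
      by (rule add_mono[OF mult_le_mono2]) auto
    then show "?N * (50 * s ''M'' 0 + 60 + acost ?b + 10) + acost ?b + 20 \<le>
        ?N * (50 * s ''M'' 0 + 100) + 30"
      by simp
  qed
qed (simp add: agree_def)

section \<open>Adjacency between classes and cover vertices\<close>

context cover_index
begin

definition nb_arc :: "(nat \<Rightarrow> nat) \<Rightarrow> nat \<Rightarrow> nat \<Rightarrow> nat \<Rightarrow> nat \<Rightarrow> bool" where
  "nb_arc cls A j v x \<longleftrightarrow> cls v = A \<and> ix (nbr_at x) = Suc j \<and> (ix v = 0 \<or> ix (nbr_at x) < ix v)"

definition nb_ok :: "nat \<Rightarrow> (nat \<Rightarrow> nat) \<Rightarrow> nat \<Rightarrow> (nat \<Rightarrow> nat) \<Rightarrow> bool" where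
  "nb_ok m cls e b \<longleftrightarrow> (\<forall>A<m. \<forall>j<K. b (A * K + j) > 0 \<longleftrightarrow>
     (\<exists>v<n. \<exists>x\<in>src v. x < e \<and> nb_arc cls A j v x))"

lemma src_Suc:
  assumes "v < n" "x \<in> src v"
  shows "(\<exists>w<n. \<exists>y\<in>src w. y < Suc x \<and> P w y) \<longleftrightarrow> (\<exists>w<n. \<exists>y\<in>src w. y < x \<and> P w y) \<or> P v x"
    (is "?L \<longleftrightarrow> ?R \<or> _")
proof
  assume ?L
  then obtain w y where *: "w < n" "y \<in> src w" "y < Suc x" "P w y" by auto
  show "?R \<or> P v x"
  proof (cases "y = x")
    case True
    then have "w = v" using src_unique[OF *(2)] assms(2) by simp
    then show ?thesis using * True by simp
  next
    case False
    then have "y < x" using *(3) by simp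
    then show ?thesis using * by auto
  qed
next
  assume "?R \<or> P v x"
  then show ?L using assms by (meson less_SucI lessI)
qed

lemma nb_ok_skip:
  assumes "nb_ok m cls x b" "v < n" "x \<in> src v"
    "\<not> (ix (nbr_at x) > 0 \<and> (ix v = 0 \<or> ix (nbr_at x) < ix v))"
  shows "nb_ok m cls (Suc x) b"
  using assms(1,4) unfolding nb_ok_def src_Suc[OF assms(2,3)] by (auto simp: nb_arc_def)

text \<open>Column indices are below \<open>K\<close>, so the row-major address belongs to one pair
  only. Arcs of several twins may set the same cell, which is why only positivity is
  recorded.\<close>

lemma nb_ok_add:
  assumes ok: "nb_ok m cls x b" and v: "v < n" "x \<in> src v" "cls v < m"
    and u: "ix (nbr_at x) > 0" "ix v = 0 \<or> ix (nbr_at x) < ix v"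
  shows "nb_ok m cls (Suc x) (b(cls v * K + (ix (nbr_at x) - Suc 0) := Suc 0))"
  unfolding nb_ok_def src_Suc[OF v(1,2)]
proof (intro allI impI)
  fix A j assume Aj: "A < m" "j < K"
  have "nbr_at x < n" using src_nbr[OF v(1,2)] nbr_iff[OF v(1)] by simp
  then have "ix (nbr_at x) - Suc 0 < K" using ix_le u(1) by fastforce
  then have "A * K + j = cls v * K + (ix (nbr_at x) - Suc 0) \<longleftrightarrow> A = cls v \<and> j = ix (nbr_at x) - Suc 0"
    by (rule row_major_inj[OF Aj(2)])
  moreover have "j = ix (nbr_at x) - Suc 0 \<longleftrightarrow> ix (nbr_at x) = Suc j" using u(1) by auto
  ultimately show "(b(cls v * K + (ix (nbr_at x) - Suc 0) := Suc 0)) (A * K + j) > 0 \<longleftrightarrow>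
      (\<exists>w<n. \<exists>y\<in>src w. y < x \<and> nb_arc cls A j w y) \<or> nb_arc cls A j v x"
    using ok[unfolded nb_ok_def, rule_format, OF Aj] u(2) by (auto simp: nb_arc_def)
qed

lemma nb_ok_final:
  assumes "nb_ok m cls arcs b" "A < m" "j < K"
  shows "b (A * K + j) > 0 \<longleftrightarrow>
    (\<exists>v u. v < n \<and> u \<in> nbr v \<and> cls v = A \<and> ix u = Suc j \<and> (ix v = 0 \<or> ix u < ix v))"
proof -
  have "(\<exists>x\<in>src v. x < arcs \<and> nb_arc cls A j v x) \<longleftrightarrow>
      (\<exists>u\<in>nbr v. cls v = A \<and> ix u = Suc j \<and> (ix v = 0 \<or> ix u < ix v))" if "v < n" for v
  proof -
    have "nbr v = nbr_at ` src v" using bij_src[OF that] unfolding bij_betw_def by simp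
    then show ?thesis using src_less[OF that] by (auto simp: nb_arc_def)
  qed
  then show ?thesis using assms unfolding nb_ok_def by fastforce
qed

lemma ht_nb_prog:
  assumes inp: "inp s" and s: "s ''ix'' = ix" "s ''cls'' = cls"
    and cls: "\<And>v. v < n \<Longrightarrow> cls v < m" and kb: "\<And>A. A < m \<Longrightarrow> s ''kb'' A = A * K"
    and zero: "s ''nb'' = (\<lambda>_. 0)"
  shows "ht nb_prog s (\<lambda>t s'. t \<le> (n + arcs) * 200 + 200 \<and> inp s' \<and>
    nb_ok m cls arcs (s' ''nb'') \<and> agree {''nb'', ''v'', ''e''} s s')"
proof -
  define J where "J v e s' \<longleftrightarrow> nb_ok m cls e (s' ''nb'')" for v e :: nat and s' :: state
  let ?W = "writes nb_edge \<union> writes Skip \<union> {''v'', ''e''}"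
  have W: "?W = {''nb'', ''v'', ''e''}"
    unfolding nb_edge_def by auto
  have "ht (scan nb_edge Skip) s (\<lambda>t s'. t \<le> (n + arcs) * (150 + 20) + 20 \<and> J n arcs s' \<and>
      inp s' \<and> agree ?W s s')"
  proof (rule ht_scan[OF inp])
    show "?W \<inter> {''n'', ''c'', ''off'', ''adj''} = {}" unfolding W by simp
    show "J 0 0 (s(''v'' := (s ''v'')(0 := 0), ''e'' := (s ''e'')(0 := 0)))"
      unfolding J_def nb_ok_def using zero by simp
  next
    fix v x s'
    assume *: "v < n" "x \<in> src v" "s' ''v'' 0 = v" "s' ''e'' 0 = x" "inp s'" "agree ?W s s'" "J v x s'"
    have ad: "s' ''adj'' x = nbr_at x" using src_less[OF *(1,2)] *(5) unfolding inp_def by simp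
    have ix': "s' ''ix'' = ix" "s' ''cls'' = cls" "s' ''kb'' = s ''kb''"
      using *(6) s unfolding W agree_def by simp_all
    show "ht (Seq nb_edge (Incr ''e'')) s' (\<lambda>t s''. t \<le> 150 \<and> J v (Suc x) s'' \<and>
        s'' ''v'' 0 = v \<and> s'' ''e'' 0 = Suc x)"
    proof (cases "ix (nbr_at x) > 0 \<and> (ix v = 0 \<or> ix (nbr_at x) < ix v)")
      case True
      note add = nb_ok_add[OF *(7)[unfolded J_def] *(1,2) cls[OF *(1)] conjunct1[OF True] conjunct2[OF True]]
      show ?thesis
        using True add *(3,4) ad ix' kb[OF cls[OF *(1)]] unfolding nb_edge_def J_def
        by (auto simp: ht_simps)
    next
      case False
      note skip = nb_ok_skip[OF *(7)[unfolded J_def] *(1,2) False]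
      show ?thesis
        using False skip *(3,4) ad ix' unfolding nb_edge_def J_def by (auto simp: ht_simps)
    qed
  next
    fix v s'
    assume "s' ''v'' 0 = v" "s' ''e'' 0 = off (Suc v)" "J v (off (Suc v)) s'"
    then show "ht (Seq Skip (Incr ''v'')) s' (\<lambda>t s''. t \<le> 150 \<and>
          J (Suc v) (off (Suc v)) s'' \<and> s'' ''v'' 0 = Suc v \<and> s'' ''e'' 0 = off (Suc v))"
      unfolding J_def by (simp add: ht_simps)
  qed simp
  then show ?thesis
    unfolding nb_prog_def W
    by (rule ht_mono) (simp add: J_def)
qed

end

section \<open>The memory during the enumeration\<close>

context twin_classes
begin

text \<open>These arrays are fixed by the input and the preprocessing; afterwards the preservation
  of \<open>mem\<close> reduces to the disjointness of two sets of names.\<close>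

definition static :: "string set" where
  "static = {''n'', ''c'', ''off'', ''adj'', ''K'', ''m'', ''M'', ''cls'', ''sz'', ''cb'', ''kb'',
     ''nb'', ''q'', ''r'', ''bb''}"

text \<open>
  There are only \<open>(m * c) ^ (m + c)\<close> words of letters; the larger bound is reached by doublings alone.
\<close>

definition bound :: nat where
  "bound = 2 ^ (m * c * (m + c))"

definition mem :: "state \<Rightarrow> bool" where
  "mem s \<longleftrightarrow> inp s \<and> s ''K'' 0 = K \<and> s ''m'' 0 = m \<and> s ''M'' 0 = m * c \<and> s ''cls'' = cls \<and>
     s ''sz'' = sz \<and> (\<forall>A<m. s ''cb'' A = A * c \<and> s ''kb'' A = A * K) \<and>
     (\<forall>A<m. \<forall>j<K. s ''nb'' (A * K + j) > 0 \<longleftrightarrow> nb A j) \<and>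
     s ''q'' 0 = n div c \<and> s ''r'' 0 = n mod c \<and> s ''bb'' 0 = bound"

lemma mem_agree:
  assumes "agree W s s'" "W \<inter> static = {}" "mem s"
  shows "mem s'"
proof -
  have eq: "s' x = s x" if "x \<in> static" for x
    using assms(1,2) that unfolding agree_def by blast
  have "s' ''n'' = s ''n''" "s' ''c'' = s ''c''" "s' ''off'' = s ''off''" "s' ''adj'' = s ''adj''"
    "s' ''K'' = s ''K''" "s' ''m'' = s ''m''" "s' ''M'' = s ''M''" "s' ''cls'' = s ''cls''"
    "s' ''sz'' = s ''sz''" "s' ''cb'' = s ''cb''" "s' ''kb'' = s ''kb''" "s' ''nb'' = s ''nb''"
    "s' ''q'' = s ''q''" "s' ''r'' = s ''r''" "s' ''bb'' = s ''bb''"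
    by (rule eq; simp add: static_def)+
  then show ?thesis using assms(3) unfolding mem_def inp_def by simp
qed

end

section \<open>Enumeration of greedy solutions\<close>

definition init_x_prog :: com where
  "init_x_prog = for_loop ''i'' (Var ''M'') (Assign ''x'' (Var ''i'') (Const 0))"

definition init_rows_prog :: com where
  "init_rows_prog = for_loop ''A'' (Var ''m'')
     (Seq (Assign ''row'' (Var ''A'') (Cell ''sz'' (Var ''A''))) (Assign ''pj'' (Var ''A'') (Const 0)))"

definition init_cols_prog :: com where
  "init_cols_prog = for_loop ''i'' (Var ''c'')
     (If (Less (Var ''i'') (Var ''r''))
       (Assign ''col'' (Var ''i'') (Plus (Var ''q'') (Const 1)))
       (Assign ''col'' (Var ''i'') (Var ''q'')))"

definition decode_prog :: com where
  "decode_prog = Seq (Set ''A'' (Var ''cd'')) (Seq (divmod_by ''A'' ''m'' ''cd'')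
     (Seq (Set ''i'' (Var ''cd'')) (divmod_by ''i'' ''c'' ''cd'')))"

text \<open>\<open>left\<close> keeps the sum of the remaining supplies, so that completeness of a
  run is a single test.\<close>

definition move_prog :: com where
  "move_prog =
     Seq
       (If (Less (Cell ''row'' (Var ''A'')) (Cell ''col'' (Var ''i'')))
         (Set ''t'' (Cell ''row'' (Var ''A''))) (Set ''t'' (Cell ''col'' (Var ''i''))))
       (If (Less (Const 0) (Var ''t''))
         (Block
           [Assign ''x'' (Plus (Cell ''cb'' (Var ''A'')) (Var ''i''))
              (Plus (Cell ''x'' (Plus (Cell ''cb'' (Var ''A'')) (Var ''i''))) (Var ''t'')),
            Assign ''row'' (Var ''A'') (Minus (Cell ''row'' (Var ''A'')) (Var ''t'')),
            Assign ''col'' (Var ''i'') (Minus (Cell ''col'' (Var ''i'')) (Var ''t'')),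
            Assign ''pj'' (Var ''A'') (Var ''i''),
            Set ''left'' (Minus (Var ''left'') (Var ''t''))])
         Skip)"

definition greedy_prog :: com where
  "greedy_prog = Seq init_x_prog (Seq init_rows_prog (Seq init_cols_prog
     (Seq (Set ''left'' (Var ''n''))
       (for_loop ''j'' (Plus (Var ''m'') (Var ''c'')) (Seq decode_prog move_prog)))))"

definition cost_prog :: com where
  "cost_prog = Seq (Set ''cost'' (Const 0))
     (for_loop ''A'' (Var ''m'')
       (for_loop ''j'' (Var ''K'')
         (If (Less (Const 0) (Cell ''nb'' (Plus (Cell ''kb'' (Var ''A'')) (Var ''j''))))
           (Set ''cost'' (Plus (Var ''cost'') (Minus (Cell ''sz'' (Var ''A''))
             (Cell ''x'' (Plus (Cell ''cb'' (Var ''A'')) (Cell ''pj'' (Var ''j'')))))))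
           Skip)))"

lemma ht_decode_prog:
  assumes "s ''m'' 0 > 0" "s ''c'' 0 > 0"
  shows "ht decode_prog s (\<lambda>t s'. t \<le> 60 * s ''cd'' 0 + 80 \<and>
     s' ''A'' 0 = s ''cd'' 0 mod s ''m'' 0 \<and>
     s' ''i'' 0 = s ''cd'' 0 div s ''m'' 0 mod s ''c'' 0 \<and>
     s' ''cd'' 0 = s ''cd'' 0 div s ''m'' 0 div s ''c'' 0 \<and> agree {''A'', ''cd'', ''i''} s s')"
    (is "ht _ s ?Q")
  unfolding decode_prog_def ht_Seq ht_Assign[of "''A''"]
proof (rule ht_mono[OF ht_divmod_by], simp, use assms in simp, elim conjE)
  fix t s'
  let ?s1 = "s(''A'' := (s ''A'')(aval (Const 0) s := aval (Var ''cd'') s))"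
  assume t: "t \<le> 30 * ?s1 ''A'' 0 + 30"
    and s': "s' = ?s1(''A'' := (?s1 ''A'')(0 := ?s1 ''A'' 0 mod ?s1 ''m'' 0),
      ''cd'' := (?s1 ''cd'')(0 := ?s1 ''A'' 0 div ?s1 ''m'' 0))"
  have le: "s ''cd'' 0 div s ''m'' 0 \<le> s ''cd'' 0" by (rule div_le_dividend)
  show "ht (Set ''i'' (Var ''cd'')) s' (\<lambda>u s'. ht (divmod_by ''i'' ''c'' ''cd'') s' (\<lambda>w.
      ?Q (acost (Const 0) + acost (Var ''cd'') + 1 + (t + (u + w)))))"
    unfolding ht_Assign
    by (rule ht_mono[OF ht_divmod_by])
      (use t le assms in \<open>auto simp: s' agree_def simp del: div_le_dividend\<close>)
qed

section \<open>Simulation of one greedy run\<close>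

context twin_classes
begin

definition grel :: "state \<Rightarrow> gstate \<Rightarrow> bool" where
  "grel s = (\<lambda>(x, r, d, p). (\<forall>A<m. \<forall>i<c. s ''x'' (A * c + i) = x A i) \<and>
     (\<forall>A<m. s ''row'' A = r A \<and> s ''pj'' A = p A) \<and> (\<forall>i<c. s ''col'' i = d i) \<and>
     s ''left'' 0 = (\<Sum>A<m. r A))"

lemma grel_agree: "agree W s s' \<Longrightarrow> W \<inter> {''x'', ''row'', ''pj'', ''col'', ''left''} = {} \<Longrightarrow>
    grel s st \<Longrightarrow> grel s' st"
proof -
  assume *: "agree W s s'" "W \<inter> {''x'', ''row'', ''pj'', ''col'', ''left''} = {}" "grel s st"
  have "s' ''x'' = s ''x''" "s' ''row'' = s ''row''" "s' ''pj'' = s ''pj''" "s' ''col'' = s ''col''"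
    "s' ''left'' = s ''left''"
    by (rule agreeD[OF *(1)], use *(2) in blast)+
  then show ?thesis using *(3) unfolding grel_def by simp
qed

lemma grel_move:
  assumes rel: "grel s (x, r, d, p)" and A: "A < m" "i < c"
    and t: "t = min (r A) (d i)" "t > 0"
    and s': "s' ''x'' = (s ''x'')(A * c + i := s ''x'' (A * c + i) + t)"
      "s' ''row'' = (s ''row'')(A := s ''row'' A - t)"
      "s' ''col'' = (s ''col'')(i := s ''col'' i - t)"
      "s' ''pj'' = (s ''pj'')(A := i)" "s' ''left'' 0 = s ''left'' 0 - t"
  shows "grel s' (gstep (A, i) (x, r, d, p))"
proof -
  have eq: "gstep (A, i) (x, r, d, p) =
      (x(A := (x A)(i := x A i + t)), r(A := r A - t), d(i := d i - t), p(A := i))"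
    using t unfolding gstep_def by (simp add: Let_def)
  have sum: "(\<Sum>B<m. (r(A := r A - t)) B) = (\<Sum>B<m. r B) - t"
    using sum_fun_upd[of "{..<m}" A r "r A - t"] A t(1) by simp
  have x: "s' ''x'' (B * c + j) = (x(A := (x A)(i := x A i + t))) B j" if "B < m" "j < c" for B j
    using rel A that row_major_inj[OF that(2) A(2), of B A] unfolding s'(1) grel_def by auto
  have "\<forall>B<m. s' ''row'' B = (r(A := r A - t)) B \<and> s' ''pj'' B = (p(A := i)) B"
    using rel A unfolding s' grel_def by simp
  moreover have "\<forall>j<c. s' ''col'' j = (d(i := d i - t)) j"
    using rel A unfolding s' grel_def by simp
  moreover have "s' ''left'' 0 = (\<Sum>B<m. (r(A := r A - t)) B)"
    using rel unfolding s' sum grel_def by simp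
  ultimately show ?thesis unfolding eq grel_def prod.case using x by (intro conjI) simp_all
qed

lemma ht_move_prog:
  assumes rel: "grel s st" and A: "s ''A'' 0 < m" "s ''i'' 0 < c"
    and cb: "s ''cb'' (s ''A'' 0) = s ''A'' 0 * c"
  shows "ht move_prog s (\<lambda>t s'. t \<le> 150 \<and> grel s' (gstep (s ''A'' 0, s ''i'' 0) st) \<and>
    agree {''t'', ''x'', ''row'', ''col'', ''pj'', ''left''} s s')"
proof -
  obtain x r d p where st: "st = (x, r, d, p)" by (metis prod_cases4)
  define A where "A = s ''A'' 0"
  define i where "i = s ''i'' 0"
  define t where "t = min (r A) (d i)"
  have rd: "s ''row'' A = r A" "s ''col'' i = d i"
    using rel assms(2,3) unfolding st grel_def A_def i_def by auto
  show ?thesis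
  proof (cases "t > 0")
    case True
    note move = grel_move[OF rel[unfolded st] A[folded A_def i_def] t_def True]
    define s1 where "s1 = s(''t'' := (s ''t'')(0 := t),
        ''x'' := (s ''x'')(A * c + i := s ''x'' (A * c + i) + t),
        ''row'' := (s ''row'')(A := s ''row'' A - t),
        ''col'' := (s ''col'')(i := s ''col'' i - t),
        ''pj'' := (s ''pj'')(A := i), ''left'' := (s ''left'')(0 := s ''left'' 0 - t))"
    have g: "grel s1 (gstep (A, i) st)" unfolding st by (rule move) (simp_all add: s1_def)
    have ag: "agree {''t'', ''x'', ''row'', ''col'', ''pj'', ''left''} s s1"
      unfolding agree_def s1_def by simp
    have "ht move_prog s (\<lambda>t s'. t \<le> 150 \<and> s' = s1)"
    proof (cases "r A < d i")
      case True
      then have "t = r A" unfolding t_def by simp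
      then show ?thesis
        using True \<open>t > 0\<close> rd cb unfolding move_prog_def s1_def
        by (simp add: ht_simps flip: A_def i_def)
    next
      case False
      then have "t = d i" unfolding t_def by simp
      then show ?thesis
        using False \<open>t > 0\<close> rd cb unfolding move_prog_def s1_def
        by (simp add: ht_simps flip: A_def i_def)
    qed
    then show ?thesis
      by (rule ht_mono) (use g ag in \<open>simp add: A_def i_def\<close>)
  next
    case False
    then have "gstep (A, i) st = st" unfolding st gstep_def t_def by (auto simp: Let_def)
    moreover have "grel (s(''t'' := (s ''t'')(0 := 0))) st"
      using rel unfolding st grel_def by simp
    ultimately show ?thesis
      using False rd unfolding move_prog_def t_def
      by (simp add: ht_simps agree_def flip: A_def i_def) auto
  qed
qed

text \<open>Both factors of \<open>m * c * (m + c)\<close> are positive, so each is at most the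
  product, which is below its power of two. All later running times become polynomials in
  \<open>bound\<close> plus a multiple of \<open>n\<close>.\<close>

lemma bound_ge:
  assumes "m > 0"
  shows "m * c \<le> bound" "m + c \<le> bound" "m \<le> bound" "c \<le> bound" "K \<le> bound" "bound > 0"
proof -
  have le: "m * c * (m + c) \<le> bound" unfolding bound_def by (rule less_imp_le[OF less_exp])
  obtain k where "m * c = Suc k" using assms c_pos by (cases "m * c") auto
  then have "m * c * (m + c) = (m + c) + k * (m + c)" by simp
  then show "m + c \<le> bound" using le by linarith
  then show "m \<le> bound" "c \<le> bound" "K \<le> bound" using K_le by simp_all
  obtain l where "m + c = Suc l" using assms by (cases "m + c") auto
  then have "m * c * (m + c) = m * c + m * c * l" by simp
  then show "m * c \<le> bound" using le by linarith
  show "bound > 0" unfolding bound_def by simp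
qed

lemma ht_init_progs:
  assumes mem: "mem s" and m: "m > 0"
  shows "ht init_x_prog s (\<lambda>t s'. t \<le> 60 * bound + 60 \<and> (\<forall>l<m * c. s' ''x'' l = 0) \<and>
      agree {''i'', ''x''} s s')" (is ?X)
    and "ht init_rows_prog s (\<lambda>t s'. t \<le> 60 * bound + 60 \<and>
      (\<forall>A<m. s' ''row'' A = sz A \<and> s' ''pj'' A = 0) \<and> agree {''A'', ''row'', ''pj''} s s')" (is ?R)
    and "ht init_cols_prog s (\<lambda>t s'. t \<le> 60 * bound + 60 \<and>
      (\<forall>i<c. s' ''col'' i = part_size n c i) \<and> agree {''i'', ''col''} s s')" (is ?C)
proof -
  have le: "N * (38 + acost (Var x) + 10) + acost (Var x) + 20 \<le> 60 * bound + 60"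
    if "N \<le> bound" for N x
    using that by simp
  show ?X
    unfolding init_x_prog_def
  proof (rule ht_for_loop[where I = "\<lambda>k s'. \<forall>l<k. s' ''x'' l = 0"])
    show "{''i'', ''x''} = insert ''i'' (writes (Assign ''x'' (Var ''i'') (Const 0)))" by simp
    show "aval (Var ''M'') s' = m * c" if "agree {''i'', ''x''} s s'" for s'
      using mem that unfolding agree_def mem_def by simp
  qed (use bound_ge(1)[OF m] in \<open>auto simp: ht_simps less_Suc_eq\<close>)
  let ?p = "Seq (Assign ''row'' (Var ''A'') (Cell ''sz'' (Var ''A''))) (Assign ''pj'' (Var ''A'') (Const 0))"
  show ?R
    unfolding init_rows_prog_def
  proof (rule ht_for_loop[where I = "\<lambda>k s'. \<forall>A<k. s' ''row'' A = sz A \<and> s' ''pj'' A = 0"])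
    show "{''A'', ''row'', ''pj''} = insert ''A'' (writes ?p)" by auto
    show "aval (Var ''m'') s' = m" if "agree {''A'', ''row'', ''pj''} s s'" for s'
      using mem that unfolding agree_def mem_def by simp
    fix k s' assume *: "s' ''A'' 0 = k" "agree {''A'', ''row'', ''pj''} s s'"
      "\<forall>A<k. s' ''row'' A = sz A \<and> s' ''pj'' A = 0"
    have "s' ''sz'' = sz" using *(2) mem unfolding agree_def mem_def by simp
    then show "ht (Seq ?p (Incr ''A'')) s' (\<lambda>t s''. t \<le> 38 \<and>
        (\<forall>A<Suc k. s'' ''row'' A = sz A \<and> s'' ''pj'' A = 0) \<and> s'' ''A'' 0 = Suc k)"
      using *(1,3) by (simp add: ht_simps less_Suc_eq)
  qed (simp, rule le[OF bound_ge(3)[OF m]])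
  let ?q = "If (Less (Var ''i'') (Var ''r''))
       (Assign ''col'' (Var ''i'') (Plus (Var ''q'') (Const 1)))
       (Assign ''col'' (Var ''i'') (Var ''q''))"
  show ?C
    unfolding init_cols_prog_def
  proof (rule ht_for_loop[where I = "\<lambda>k s'. \<forall>i<k. s' ''col'' i = part_size n c i"])
    show "{''i'', ''col''} = insert ''i'' (writes ?q)" by simp
    show "aval (Var ''c'') s' = c" if "agree {''i'', ''col''} s s'" for s'
      using mem that unfolding agree_def mem_def inp_def by simp
    fix k s' assume *: "s' ''i'' 0 = k" "agree {''i'', ''col''} s s'"
      "\<forall>i<k. s' ''col'' i = part_size n c i"
    have "s' ''q'' 0 = n div c" "s' ''r'' 0 = n mod c"
      using *(2) mem unfolding agree_def mem_def by simp_all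
    then show "ht (Seq ?q (Incr ''i'')) s' (\<lambda>t s''. t \<le> 38 \<and>
        (\<forall>i<Suc k. s'' ''col'' i = part_size n c i) \<and> s'' ''i'' 0 = Suc k)"
      using *(1,3) by (simp add: ht_simps less_Suc_eq part_size_def)
  qed (simp, rule le[OF bound_ge(4)[OF m]])
qed

abbreviation greedy_vars :: "string set" where
  "greedy_vars \<equiv> {''A'', ''cd'', ''i'', ''t'', ''x'', ''row'', ''col'', ''pj'', ''left'', ''j''}"

lemma ht_greedy_loop:
  assumes mem: "mem s" and m: "m > 0" and rel: "grel s st" and cd: "s ''cd'' 0 \<le> bound"
  shows "ht (for_loop ''j'' (Plus (Var ''m'') (Var ''c'')) (Seq decode_prog move_prog)) s
    (\<lambda>t s'. t \<le> 600 * bound * bound + 30 \<and>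
      grel s' (greedy (decode m c (m + c) (s ''cd'' 0)) st) \<and> agree greedy_vars s s')"
proof -
  let ?p = "Seq decode_prog move_prog"
  let ?k = "s ''cd'' 0"
  let ?d = "60 * bound + 300"
  \<comment> \<open>The invariant speaks about the future: reading the remaining letters from the
    present state gives the final result. No closed form of intermediate states is required.\<close>
  define I where "I j s' \<longleftrightarrow> s' ''cd'' 0 \<le> bound \<and> (\<exists>st'. grel s' st' \<and>
      greedy (decode m c (m + c - j) (s' ''cd'' 0)) st' = greedy (decode m c (m + c) ?k) st)"
    for j and s' :: state
  have "ht (for_loop ''j'' (Plus (Var ''m'') (Var ''c'')) ?p) s
    (\<lambda>t s'. t \<le> 600 * bound * bound + 30 \<and> I (m + c) s' \<and> agree greedy_vars s s')"
  proof (rule ht_for_loop[where I = I])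
    show "greedy_vars = insert ''j'' (writes ?p)"
      unfolding decode_prog_def move_prog_def divmod_by_def by auto
    show "aval (Plus (Var ''m'') (Var ''c'')) s' = m + c" if "agree greedy_vars s s'" for s'
      using mem that unfolding agree_def mem_def inp_def by simp
    show "I 0 (s(''j'' := (s ''j'')(0 := 0)))"
    proof -
      have "grel (s(''j'' := (s ''j'')(0 := 0))) st"
        by (rule grel_agree[OF _ _ rel, of "{''j''}"]) (auto simp: agree_def)
      then show ?thesis unfolding I_def using cd by (intro conjI exI[of _ st]) simp_all
    qed
  next
    fix j s'
    assume *: "j < m + c" "s' ''j'' 0 = j" "agree greedy_vars s s'" "I j s'"
    obtain st' where st': "grel s' st'"
        "greedy (decode m c (m + c - j) (s' ''cd'' 0)) st' = greedy (decode m c (m + c) ?k) st"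
      using *(4) unfolding I_def by blast
    have cd': "s' ''cd'' 0 \<le> bound" using *(4) unfolding I_def by blast
    have mem': "mem s'" by (rule mem_agree[OF *(3) _ mem]) (simp add: static_def)
    have mc: "s' ''m'' 0 = m" "s' ''c'' 0 = c" "\<And>A. A < m \<Longrightarrow> s' ''cb'' A = A * c"
      using mem' unfolding mem_def inp_def by auto
    have mc_pos: "s' ''m'' 0 > 0" "s' ''c'' 0 > 0" using mc m c_pos by auto
    define k where "k = s' ''cd'' 0"
    have rest: "greedy (decode m c (m + c - Suc j) (k div m div c)) (gstep (k mod m, k div m mod c) st') =
        greedy (decode m c (m + c) ?k) st"
    proof -
      have "m + c - j = Suc (m + c - Suc j)" using *(1) by simp
      then show ?thesis using st'(2) unfolding k_def by simp
    qed
    show "ht (Seq ?p (Incr ''j'')) s' (\<lambda>t s''. t \<le> ?d \<and> I (Suc j) s'' \<and> s'' ''j'' 0 = Suc j)"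
      unfolding ht_Seq
    proof (rule ht_mono[OF ht_decode_prog[of s', OF mc_pos]], elim conjE)
      fix t s2
      assume t: "t \<le> 60 * s' ''cd'' 0 + 80" and s2: "s2 ''A'' 0 = s' ''cd'' 0 mod s' ''m'' 0"
        "s2 ''i'' 0 = s' ''cd'' 0 div s' ''m'' 0 mod s' ''c'' 0"
        "s2 ''cd'' 0 = s' ''cd'' 0 div s' ''m'' 0 div s' ''c'' 0" "agree {''A'', ''cd'', ''i''} s' s2"
      have Ai: "s2 ''A'' 0 < m" "s2 ''i'' 0 < c" using s2 mc m c_pos by simp_all
      have cb: "s2 ''cb'' (s2 ''A'' 0) = s2 ''A'' 0 * c"
        using mc(3)[OF Ai(1)] agreeD[OF s2(4), of "''cb''"] by simp
      have rel2: "grel s2 st'" by (rule grel_agree[OF s2(4) _ st'(1)]) simp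
      show "ht move_prog s2 (\<lambda>u s'. ht (Incr ''j'') s'
          (\<lambda>w s''. t + u + w \<le> ?d \<and> I (Suc j) s'' \<and> s'' ''j'' 0 = Suc j))"
      proof (rule ht_mono[OF ht_move_prog[of s2, OF rel2 Ai cb]], elim conjE)
        fix u :: nat and s3
        assume u: "u \<le> 150" and rel3: "grel s3 (gstep (s2 ''A'' 0, s2 ''i'' 0) st')"
          and ag3: "agree {''t'', ''x'', ''row'', ''col'', ''pj'', ''left''} s2 s3"
        have j3: "s3 ''j'' 0 = j" using agreeD[OF ag3, of "''j''"] agreeD[OF s2(4), of "''j''"] *(2) by simp
        have cd3: "s3 ''cd'' 0 = k div m div c"
          using agreeD[OF ag3, of "''cd''"] s2(3) mc unfolding k_def by simp
        have le: "k div m div c \<le> bound" using cd' unfolding k_def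
          by (meson div_le_dividend le_trans)
        let ?s4 = "s3(''j'' := (s3 ''j'')(0 := Suc j))"
        have "grel ?s4 (gstep (k mod m, k div m mod c) st')"
          by (rule grel_agree[of "{''j''}" s3]) (use rel3 s2 mc in \<open>auto simp: agree_def k_def\<close>)
        then have "I (Suc j) ?s4" unfolding I_def using rest cd3 le
          by (intro conjI exI[of _ "gstep (k mod m, k div m mod c) st'"]) simp_all
        then show "ht (Incr ''j'') s3 (\<lambda>w s''. t + u + w \<le> ?d \<and> I (Suc j) s'' \<and> s'' ''j'' 0 = Suc j)"
          using t u cd' j3 by (simp add: ht_simps)
      qed
    qed
  next
    \<comment> \<open>315 is 300 from the body, 5 for evaluating the loop bound and 10 of loop
      overhead.\<close>
    have "(m + c) * (60 * bound + 315) + 25 \<le> bound * (60 * bound + 315 * bound) + 25"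
      using bound_ge[OF m] by (intro add_mono mult_le_mono) auto
    also have "\<dots> \<le> 600 * bound * bound + 30" by (simp add: algebra_simps)
    finally show "(m + c) * (?d + acost (Plus (Var ''m'') (Var ''c'')) + 10) +
        acost (Plus (Var ''m'') (Var ''c'')) + 20 \<le> 600 * bound * bound + 30"
      by (simp add: algebra_simps)
  qed
  then show ?thesis by (rule ht_mono) (auto simp: I_def)
qed

lemma ht_greedy_prog:
  assumes mem: "mem s" and m: "m > 0" and cd: "s ''cd'' 0 \<le> bound"
  shows "ht greedy_prog s (\<lambda>t s'. t \<le> 1500 * bound * bound \<and> grel s' (run (s ''cd'' 0)) \<and>
    agree greedy_vars s s')"
    (is "ht _ s ?Q")
  unfolding greedy_prog_def
proof (rule ht_SeqI[OF ht_init_progs(1)[OF mem m]], elim conjE)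
  let ?loop = "for_loop ''j'' (Plus (Var ''m'') (Var ''c'')) (Seq decode_prog move_prog)"
  let ?tail = "Seq (Set ''left'' (Var ''n'')) ?loop"
  fix t1 s1
  assume t1: "t1 \<le> 60 * bound + 60" and x1: "\<forall>l<m * c. s1 ''x'' l = 0" and a1: "agree {''i'', ''x''} s s1"
  have mem1: "mem s1" by (rule mem_agree[OF a1 _ mem]) (simp add: static_def)
  show "ht (Seq init_rows_prog (Seq init_cols_prog ?tail)) s1 (\<lambda>u. ?Q (t1 + u))"
  proof (rule ht_SeqI[OF ht_init_progs(2)[OF mem1 m]], elim conjE)
    fix t2 s2
    assume t2: "t2 \<le> 60 * bound + 60" and r2: "\<forall>A<m. s2 ''row'' A = sz A \<and> s2 ''pj'' A = 0"
      and a2: "agree {''A'', ''row'', ''pj''} s1 s2"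
    have mem2: "mem s2" by (rule mem_agree[OF a2 _ mem1]) (simp add: static_def)
    show "ht (Seq init_cols_prog ?tail) s2 (\<lambda>u. ?Q (t1 + (t2 + u)))"
    proof (rule ht_SeqI[OF ht_init_progs(3)[OF mem2 m]], elim conjE)
      fix t3 s3
      assume t3: "t3 \<le> 60 * bound + 60" and c3: "\<forall>i<c. s3 ''col'' i = part_size n c i"
        and a3: "agree {''i'', ''col''} s2 s3"
      have mem3: "mem s3" by (rule mem_agree[OF a3 _ mem2]) (simp add: static_def)
      let ?s = "s3(''left'' := (s3 ''left'')(aval (Const 0) s3 := aval (Var ''n'') s3))"
      have a4: "agree {''left''} s3 ?s" unfolding agree_def by simp
      have mem4: "mem ?s" by (rule mem_agree[OF a4 _ mem3]) (simp add: static_def)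
      have n3: "s3 ''n'' 0 = n" using mem3 unfolding mem_def inp_def by simp
      have sumsz: "(\<Sum>A<m. sz A) = n" using sum_sz sum_part_size[OF c_pos] by simp
      have eqs: "s3 ''x'' = s1 ''x''" "s3 ''row'' = s2 ''row''" "s3 ''pj'' = s2 ''pj''"
        using a2 a3 unfolding agree_def by simp_all
      have "A * c + i < m * c" if "A < m" "i < c" for A i
      proof -
        have "A * c + i < Suc A * c" using that by simp
        also have "\<dots> \<le> m * c" using that by (intro mult_le_mono1) simp
        finally show ?thesis .
      qed
      then have rel: "grel ?s (ginit sz (part_size n c))"
        unfolding grel_def ginit_def using x1 r2 c3 eqs sumsz n3 by simp
      have ag: "agree greedy_vars s ?s"
        using a1 a2 a3 a4 unfolding agree_def by simp
      have cd4: "?s ''cd'' 0 = s ''cd'' 0"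
        using a1 a2 a3 unfolding agree_def by simp
      have cd4_le: "?s ''cd'' 0 \<le> bound" unfolding cd4 by (rule cd)
      show "ht ?tail s3 (\<lambda>u. ?Q (t1 + (t2 + (t3 + u))))"
      proof (rule ht_Assign_SeqI[OF ht_greedy_loop[OF mem4 m rel cd4_le]], elim conjE)
        fix u s'
        assume u: "u \<le> 600 * bound * bound + 30"
          and g: "grel s' (greedy (decode m c (m + c) (?s ''cd'' 0)) (ginit sz (part_size n c)))"
          and a: "agree greedy_vars ?s s'"
        have "bound \<le> bound * bound" by (rule le_square)
        moreover have "1 \<le> bound * bound" using bound_ge(6)[OF m] by simp
        ultimately have "t1 + (t2 + (t3 + (acost (Const 0) + acost (Var ''n'') + 1 + u))) \<le>
            1500 * (bound * bound)"
          using u t1 t2 t3 unfolding mult.assoc acost.simps by linarith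
        then show "?Q (t1 + (t2 + (t3 + (acost (Const 0) + acost (Var ''n'') + 1 + u)))) s'"
          using g agree_trans[OF ag a] unfolding run_def cd4 mult.assoc by (intro conjI)
      qed
    qed
  qed
qed

end

section \<open>The search for the best code and the output\<close>

definition enum_body :: com where
  "enum_body = Seq (Set ''cd'' (Var ''code'')) (Seq greedy_prog
     (If (Less (Var ''left'') (Const 1))
       (Seq cost_prog
         (If (Not (And (Less (Const 0) (Var ''fnd'')) (Not (Less (Var ''cost'') (Var ''best'')))))
           (Block [Set ''fnd'' (Const 1), Set ''best'' (Var ''cost''), Set ''bc'' (Var ''code'')])
           Skip))
       Skip))"

definition enum_prog :: com where
  "enum_prog = Seq (Set ''fnd'' (Const 0)) (for_loop ''code'' (Var ''bb'') enum_body)"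

text \<open>
  \<open>ptr[A]\<close> is the part that is being filled from class \<open>A\<close>. Every iteration places a vertex or advances
  a pointer, hence there are at most \<open>n + m * c\<close> of them.
\<close>

definition output_prog :: com where
  "output_prog = Seq (Set ''v'' (Const 0))
     (While (Less (Var ''v'') (Var ''n''))
       (Seq (Set ''A'' (Cell ''cls'' (Var ''v'')))
         (If (Less (Const 0) (Cell ''x'' (Plus (Cell ''cb'' (Var ''A'')) (Cell ''ptr'' (Var ''A'')))))
           (Block
             [Assign ''x'' (Plus (Cell ''cb'' (Var ''A'')) (Cell ''ptr'' (Var ''A'')))
                (Minus (Cell ''x'' (Plus (Cell ''cb'' (Var ''A'')) (Cell ''ptr'' (Var ''A'')))) (Const 1)),
              Assign ''part'' (Var ''v'') (Cell ''ptr'' (Var ''A'')),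
              Incr ''v''])
           (Assign ''ptr'' (Var ''A'') (Plus (Cell ''ptr'' (Var ''A'')) (Const 1))))))"

text \<open>Later runs overwrite the matrix of the best one, so only its code is kept and the run is
  repeated before the output.\<close>

definition main_prog :: com where
  "main_prog = Seq enum_prog (Seq (Set ''cd'' (Var ''bc'')) (Seq greedy_prog
     (Seq (Set ''cut'' (Var ''best'')) output_prog)))"

context twin_classes
begin

text \<open>The condition on \<open>p\<close> keeps each access to \<open>x\<close> within its row;
  complete runs satisfy it.\<close>

lemma ht_cost_prog:
  assumes mem: "mem s" and m: "m > 0" and rel: "grel s (x, r, d, p)" and p: "\<forall>j<K. p j < c"
  shows "ht cost_prog s (\<lambda>t s'. t \<le> 500 * bound * bound \<and> s' ''cost'' 0 = cut_cost m K nb sz x p \<and>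
    agree {''cost'', ''A'', ''j''} s s')"
    (is "ht _ s ?Q")
  unfolding cost_prog_def
proof (rule ht_Assign_SeqI)
  let ?body = "If (Less (Const 0) (Cell ''nb'' (Plus (Cell ''kb'' (Var ''A'')) (Var ''j''))))
           (Set ''cost'' (Plus (Var ''cost'') (Minus (Cell ''sz'' (Var ''A''))
             (Cell ''x'' (Plus (Cell ''cb'' (Var ''A'')) (Cell ''pj'' (Var ''j'')))))))
           Skip"
  define T where "T A j = (if nb A j then sz A - x A (p j) else 0)" for A j
  define W :: "string set" where "W = {''cost'', ''A'', ''j''}"
  let ?s = "s(''cost'' := (s ''cost'')(aval (Const 0) s := aval (Const 0) s))"
  have a0: "agree W s ?s" unfolding agree_def W_def by simp
  have ag_mem: "mem s'" if "agree W s s'" for s'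
    by (rule mem_agree[OF that _ mem]) (simp add: static_def W_def)
  have inner: "ht (for_loop ''j'' (Var ''K'') ?body) s1
      (\<lambda>t s'. t \<le> K * 72 + 22 \<and> s' ''cost'' 0 = s1 ''cost'' 0 + (\<Sum>j<K. T A j) \<and>
      agree {''cost'', ''j''} s1 s')"
    if s1: "agree W s s1" "s1 ''A'' 0 = A" "A < m" for s1 A
  proof (rule ht_for_loop[where I = "\<lambda>j s'. s' ''cost'' 0 = s1 ''cost'' 0 + (\<Sum>i<j. T A i)"])
    show "{''cost'', ''j''} = insert ''j'' (writes ?body)" by auto
    show "aval (Var ''K'') s' = K" if "agree {''cost'', ''j''} s1 s'" for s'
      using ag_mem[OF s1(1)] that unfolding agree_def mem_def by simp
    show "(s1(''j'' := (s1 ''j'')(0 := 0))) ''cost'' 0 = s1 ''cost'' 0 + (\<Sum>i<0. T A i)" by simp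
    fix j s'
    assume *: "j < K" "s' ''j'' 0 = j" "agree {''cost'', ''j''} s1 s'"
      "s' ''cost'' 0 = s1 ''cost'' 0 + (\<Sum>i<j. T A i)"
    have ag: "agree W s s'" using s1(1) *(3) unfolding agree_def W_def by simp
    have A: "s' ''A'' 0 = A" using s1(2) *(3) unfolding agree_def by simp
    have M: "s' ''kb'' A = A * K" "s' ''cb'' A = A * c" "s' ''sz'' = sz"
        "s' ''nb'' (A * K + j) > 0 \<longleftrightarrow> nb A j"
      using ag_mem[OF ag] s1(3) *(1) unfolding mem_def by auto
    have "s' ''x'' = s ''x''" "s' ''pj'' = s ''pj''" using ag unfolding agree_def W_def by simp_all
    then have X: "s' ''pj'' j = p j" "s' ''x'' (A * c + p j) = x A (p j)"
      using rel p *(1) s1(3) K_le unfolding grel_def by auto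
    show "ht (Seq ?body (Incr ''j'')) s' (\<lambda>t s''. t \<le> 60 \<and>
        s'' ''cost'' 0 = s1 ''cost'' 0 + (\<Sum>i<Suc j. T A i) \<and> s'' ''j'' 0 = Suc j)"
      using * A M X by (simp add: ht_simps T_def)
  qed simp
  show "ht (for_loop ''A'' (Var ''m'') (for_loop ''j'' (Var ''K'') ?body)) ?s
    (\<lambda>t s'. t \<le> 146 * (bound * bound) \<and> s' ''cost'' 0 = (\<Sum>A<m. \<Sum>j<K. T A j) \<and> agree W ?s s')"
  proof (rule ht_for_loop[where I = "\<lambda>A s'. s' ''cost'' 0 = (\<Sum>B<A. \<Sum>j<K. T B j)"])
    show "W = insert ''A'' (writes (for_loop ''j'' (Var ''K'') ?body))"
      unfolding W_def writes_for_loop by auto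
    show "aval (Var ''m'') s' = m" if "agree W ?s s'" for s'
      using ag_mem[OF agree_trans[OF a0 that]] unfolding mem_def by simp
    show "(?s(''A'' := (?s ''A'')(0 := 0))) ''cost'' 0 = (\<Sum>B<0. \<Sum>j<K. T B j)" by simp
    fix A s'
    assume *: "A < m" "s' ''A'' 0 = A" "agree W ?s s'" "s' ''cost'' 0 = (\<Sum>B<A. \<Sum>j<K. T B j)"
    show "ht (Seq (for_loop ''j'' (Var ''K'') ?body) (Incr ''A'')) s' (\<lambda>t s''. t \<le> K * 72 + 40 \<and>
        s'' ''cost'' 0 = (\<Sum>B<Suc A. \<Sum>j<K. T B j) \<and> s'' ''A'' 0 = Suc A)"
    proof (rule ht_SeqI[OF inner[OF agree_trans[OF a0 *(3)] *(2,1)]], elim conjE)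
      fix t s2
      assume t: "t \<le> K * 72 + 22"
        and s2: "s2 ''cost'' 0 = s' ''cost'' 0 + (\<Sum>j<K. T A j)" "agree {''cost'', ''j''} s' s2"
      have "s2 ''A'' 0 = A" using s2(2) *(2) unfolding agree_def by simp
      then show "ht (Incr ''A'') s2 (\<lambda>u s''. t + u \<le> K * 72 + 40 \<and>
        s'' ''cost'' 0 = (\<Sum>B<Suc A. \<Sum>j<K. T B j) \<and> s'' ''A'' 0 = Suc A)"
        using t s2(1) *(4) by (simp add: ht_simps)
    qed
  next
    have "m * (K * 72 + 52) + 22 \<le> bound * (bound * 72 + 52 * bound) + 22 * (bound * bound)"
      using bound_ge[OF m] by (intro add_mono mult_le_mono) auto
    then show "m * (K * 72 + 40 + acost (Var ''m'') + 10) + acost (Var ''m'') + 20 \<le>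
        146 * (bound * bound)"
      by (simp add: algebra_simps)
  qed
  fix t s'
  assume *: "t \<le> 146 * (bound * bound) \<and> s' ''cost'' 0 = (\<Sum>A<m. \<Sum>j<K. T A j) \<and> agree W ?s s'"
  moreover have "1 \<le> bound * bound" using bound_ge(6)[OF m] by simp
  ultimately have "acost (Const 0) + acost (Const 0) + 1 + t \<le> 500 * (bound * bound)"
    unfolding acost.simps by linarith
  then show "?Q (acost (Const 0) + acost (Const 0) + 1 + t) s'"
    using * agree_trans[OF a0] unfolding cut_cost_def T_def W_def by (simp only: mult.assoc simp_thms)
qed

definition best_ok :: "nat \<Rightarrow> nat \<Rightarrow> nat \<Rightarrow> nat \<Rightarrow> bool" where
  "best_ok k f b v \<longleftrightarrow> (f = 0 \<longrightarrow> (\<forall>i<k. \<not> complete i)) \<and>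
     (f > 0 \<longrightarrow> b < k \<and> complete b \<and> v = run_cost b \<and> (\<forall>i<k. complete i \<longrightarrow> v \<le> run_cost i))"

lemma best_ok_incomplete: "best_ok k f b v \<Longrightarrow> \<not> complete k \<Longrightarrow> best_ok (Suc k) f b v"
  unfolding best_ok_def by (auto simp: less_Suc_eq)

lemma best_ok_keep: "best_ok k f b v \<Longrightarrow> f > 0 \<Longrightarrow> v \<le> run_cost k \<Longrightarrow> best_ok (Suc k) f b v"
  unfolding best_ok_def by (auto simp: less_Suc_eq)

lemma best_ok_new:
  "best_ok k f b v \<Longrightarrow> complete k \<Longrightarrow> f = 0 \<or> run_cost k < v \<Longrightarrow> best_ok (Suc k) (Suc 0) k (run_cost k)"
  unfolding best_ok_def by (fastforce simp: less_Suc_eq)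

abbreviation enum_vars :: "string set" where
  "enum_vars \<equiv> {''fnd'', ''best'', ''bc'', ''cost'', ''code''} \<union> greedy_vars"

lemma ht_enum_prog:
  assumes mem: "mem s" and m: "m > 0"
  shows "ht enum_prog s (\<lambda>t s'. t \<le> 3000 * bound ^ 3 \<and>
    best_ok bound (s' ''fnd'' 0) (s' ''bc'' 0) (s' ''best'' 0) \<and> agree enum_vars s s')"
    (is "ht _ s ?R")
  unfolding enum_prog_def
proof (rule ht_Assign_SeqI)
  let ?s = "s(''fnd'' := (s ''fnd'')(aval (Const 0) s := aval (Const 0) s))"
  have a0: "agree enum_vars s ?s" unfolding agree_def by simp
  have ag_mem: "mem s'" if "agree enum_vars s s'" for s'
    by (rule mem_agree[OF that _ mem]) (simp add: static_def)
  have wr: "enum_vars = insert ''code'' (writes enum_body)"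
    unfolding enum_body_def greedy_prog_def cost_prog_def writes.simps writes_for_loop
      init_x_prog_def init_rows_prog_def init_cols_prog_def decode_prog_def move_prog_def
      divmod_by_def Block.simps by auto
  define J where "J k s' \<longleftrightarrow> best_ok k (s' ''fnd'' 0) (s' ''bc'' 0) (s' ''best'' 0)"
    for k and s' :: state
  show "ht (for_loop ''code'' (Var ''bb'') enum_body) ?s
    (\<lambda>t s'. t \<le> 2500 * bound ^ 3 + 12 * bound + 22 \<and> J bound s' \<and> agree enum_vars ?s s')"
  proof (rule ht_for_loop[where I = J])
    show "enum_vars = insert ''code'' (writes enum_body)" by (rule wr)
    show "aval (Var ''bb'') s' = bound" if "agree enum_vars ?s s'" for s'
      using ag_mem[OF agree_trans[OF a0 that]] unfolding mem_def by simp
    show "J 0 (?s(''code'' := (?s ''code'')(0 := 0)))" unfolding J_def best_ok_def by simp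
    fix k s'
    assume *: "k < bound" "s' ''code'' 0 = k" "agree enum_vars ?s s'" "J k s'"
    let ?s1 = "s'(''cd'' := (s' ''cd'')(0 := k))"
    have "agree enum_vars s' ?s1" unfolding agree_def by simp
    then have mem1: "mem ?s1" using ag_mem agree_trans[OF a0 agree_trans[OF *(3)]] by blast
    \<comment> \<open>Folding the square makes it an atom for linear arithmetic.\<close>
    define b2 where "b2 = bound * bound"
    have b1: "1 \<le> b2" unfolding b2_def using bound_ge(6)[OF m] by simp
    let ?c0 = "acost (Const 0) + acost (Var ''code'') + 1"
    let ?c1 = "bcost (Less (Var ''left'') (Const 1)) + 1"
    let ?Q = "\<lambda>t s''. t \<le> 2500 * bound * bound \<and> J (Suc k) s'' \<and> s'' ''code'' 0 = Suc k"
    let ?rest = "If (Not (And (Less (Const 0) (Var ''fnd'')) (Not (Less (Var ''cost'') (Var ''best'')))))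
           (Block [Set ''fnd'' (Const 1), Set ''best'' (Var ''cost''), Set ''bc'' (Var ''code'')])
           Skip"
    have le: "?s1 ''cd'' 0 \<le> bound" using *(1) by simp
    have main: "ht (Seq greedy_prog (If (Less (Var ''left'') (Const 1)) (Seq cost_prog ?rest) Skip)) ?s1
        (\<lambda>u s''. ht (Incr ''code'') s'' (\<lambda>w. ?Q (?c0 + u + w)))"
    proof (rule ht_SeqI[OF ht_greedy_prog[OF mem1 m le]], elim conjE)
      fix t2 s2
      assume t2: "t2 \<le> 1500 * bound * bound" and rel2: "grel s2 (run (?s1 ''cd'' 0))"
        and a2: "agree greedy_vars ?s1 s2"
      have mem2: "mem s2" by (rule mem_agree[OF a2 _ mem1]) (simp add: static_def)
      have s2: "s2 ''code'' 0 = k" "s2 ''fnd'' = s' ''fnd''" "s2 ''bc'' = s' ''bc''" "s2 ''best'' = s' ''best''"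
        using a2 *(2) unfolding agree_def by simp_all
      obtain x r d p where run: "run k = (x, r, d, p)" by (metis prod_cases4)
      have rel: "grel s2 (x, r, d, p)" using rel2 run by simp
      have left: "s2 ''left'' 0 = 0 \<longleftrightarrow> complete k"
        using rel run unfolding grel_def complete_def run_r_def by auto
      show "ht (If (Less (Var ''left'') (Const 1)) (Seq cost_prog ?rest) Skip) s2
          (\<lambda>u s''. ht (Incr ''code'') s'' (\<lambda>w. ?Q (?c0 + (t2 + u) + w)))"
      proof (cases "complete k")
        case False
        then have "J (Suc k) (s2(''code'' := (s2 ''code'')(0 := Suc k)))"
          using best_ok_incomplete *(4) s2 unfolding J_def by simp
        then show ?thesis
          using False left t2 s2(1) b1 by (simp add: ht_simps mult.assoc flip: b2_def)
      next
        case True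
        have p: "\<forall>j<K. p j < c"
          using solution_run[OF True m] run unfolding solution_def run_p_def by simp
        have "ht cost_prog s2 (\<lambda>t s3. ht ?rest s3 (\<lambda>u s''. ht (Incr ''code'') s''
            (\<lambda>w. ?Q (?c0 + (t2 + (?c1 + (t + u))) + w))))"
        proof (rule ht_mono[OF ht_cost_prog[OF mem2 m rel p]], elim conjE)
          fix t3 s3
          assume t3: "t3 \<le> 500 * bound * bound" and cost: "s3 ''cost'' 0 = cut_cost m K nb sz x p"
            and a3: "agree {''cost'', ''A'', ''j''} s2 s3"
          have c3: "s3 ''cost'' 0 = run_cost k"
            using cost run unfolding run_cost_def run_x_def run_p_def by simp
          have s3: "s3 ''code'' 0 = k" "s3 ''fnd'' = s' ''fnd''"
              "s3 ''bc'' = s' ''bc''" "s3 ''best'' = s' ''best''"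
            using a3 s2 unfolding agree_def by simp_all
          have ok: "best_ok k (s' ''fnd'' 0) (s' ''bc'' 0) (s' ''best'' 0)"
            using *(4) unfolding J_def .
          show "ht ?rest s3 (\<lambda>u s''. ht (Incr ''code'') s''
              (\<lambda>w. ?Q (?c0 + (t2 + (?c1 + (t3 + u))) + w)))"
          proof (cases "s' ''fnd'' 0 = 0 \<or> run_cost k < s' ''best'' 0")
            case True
            then show ?thesis
              using best_ok_new[OF ok \<open>complete k\<close> True] c3 s3 t2 t3 b1 unfolding J_def
              by (auto simp: ht_simps mult.assoc simp flip: b2_def)
          next
            case False
            then show ?thesis
              using best_ok_keep[OF ok] c3 s3 t2 t3 b1 unfolding J_def
              by (auto simp: ht_simps mult.assoc simp flip: b2_def)
          qed
        qed
        then show ?thesis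
          using True left unfolding ht_If[of _ "Seq cost_prog ?rest"] ht_Seq[of cost_prog] by simp
      qed
    qed
    then show "ht (Seq enum_body (Incr ''code'')) s' (\<lambda>t s''. ?Q t s'')"
      unfolding enum_body_def ht_Seq[of _ "Incr ''code''"] ht_Seq[of "Set ''cd'' (Var ''code'')"]
        ht_Assign[of "''cd''"]
      using *(2) by simp
  qed (simp add: algebra_simps power3_eq_cube)
  fix t s'
  assume *: "t \<le> 2500 * bound ^ 3 + 12 * bound + 22 \<and> J bound s' \<and> agree enum_vars ?s s'"
  have "bound ^ 1 \<le> bound ^ 3" "1 \<le> bound ^ 3"
    using bound_ge(6)[OF m] by (intro power_increasing one_le_power; simp)+
  then have "acost (Const 0) + acost (Const 0) + 1 + t \<le> 3000 * bound ^ 3" using * by simp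
  then show "?R (acost (Const 0) + acost (Const 0) + 1 + t) s'"
    using * agree_trans[OF a0] unfolding J_def by blast
qed

text \<open>\<open>x\<close> is consumed: each cell holds what is still to be placed, and together
  with the vertices placed so far it gives \<open>X\<close>. Cells before the pointer of a class are
  used up.\<close>

definition out_ok ::
    "(nat \<Rightarrow> nat \<Rightarrow> nat) \<Rightarrow> nat \<Rightarrow> (nat \<Rightarrow> nat) \<Rightarrow> (nat \<Rightarrow> nat) \<Rightarrow> (nat \<Rightarrow> nat) \<Rightarrow> bool" where
  "out_ok X v x ptr f \<longleftrightarrow> v \<le> n \<and> (\<forall>A<m. ptr A \<le> c) \<and> (\<forall>u<v. f u < c) \<and>
     (\<forall>A<m. \<forall>i<ptr A. x (A * c + i) = 0) \<and>
     (\<forall>A<m. \<forall>i<c. x (A * c + i) + card {u. u < v \<and> cls u = A \<and> f u = i} = X A i)"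

text \<open>Had the pointer run past the last part, the whole row would be used up and the full
  class size would already be placed among the vertices before \<open>v\<close>; but
  \<open>v\<close> itself belongs to the class.\<close>

lemma out_ok_ptr:
  assumes ok: "out_ok X v x ptr f" and v: "v < n" and X: "\<And>A. A < m \<Longrightarrow> (\<Sum>i<c. X A i) = sz A"
  shows "ptr (cls v) < c"
proof (rule ccontr)
  let ?A = "cls v"
  assume "\<not> ptr ?A < c"
  then have x0: "x (?A * c + i) = 0" if "i < c" for i
    using ok cls_less[OF v] that unfolding out_ok_def by auto
  have "sz ?A = (\<Sum>i<c. card {u. u < v \<and> cls u = ?A \<and> f u = i})"
  proof -
    have "card {u. u < v \<and> cls u = ?A \<and> f u = i} = X ?A i" if "i < c" for i
      using ok cls_less[OF v] that x0[OF that] unfolding out_ok_def by fastforce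
    then show ?thesis using X[OF cls_less[OF v]] by simp
  qed
  also have "\<dots> = card (\<Union>i<c. {u. u < v \<and> cls u = ?A \<and> f u = i})"
    by (intro card_UN_disjoint[symmetric]) auto
  also have "\<dots> \<le> card ({u. u < n \<and> cls u = ?A} - {v})"
    using v by (intro card_mono) auto
  also have "\<dots> < card {u. u < n \<and> cls u = ?A}"
    using v by (intro card_Diff1_less) auto
  also have "\<dots> = sz ?A" using sz cls_less[OF v] by simp
  finally show False by simp
qed

lemma out_ok_assign:
  assumes ok: "out_ok X v x ptr f" and v: "v < n" and A: "A = cls v" "ptr A < c" "x (A * c + ptr A) > 0"
  shows "out_ok X (Suc v) (x(A * c + ptr A := x (A * c + ptr A) - Suc 0)) ptr (f(v := ptr A))"
  unfolding out_ok_def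
proof (intro conjI allI impI)
  show "Suc v \<le> n" using v by simp
  show "ptr B \<le> c" if "B < m" for B using ok that unfolding out_ok_def by simp
  show "(f(v := ptr A)) u < c" if "u < Suc v" for u
    using ok A(2) that unfolding out_ok_def by (auto simp: less_Suc_eq)
  fix B assume B: "B < m"
  show "(x(A * c + ptr A := x (A * c + ptr A) - Suc 0)) (B * c + i) = 0" if "i < ptr B" for i
  proof -
    have "x (B * c + i) = 0" using ok B that unfolding out_ok_def by blast
    then show ?thesis by (cases "B * c + i = A * c + ptr A") auto
  qed
  fix i assume i: "i < c"
  have old: "x (B * c + i) + card {u. u < v \<and> cls u = B \<and> f u = i} = X B i"
    using ok B i unfolding out_ok_def by blast
  have eq: "B * c + i = A * c + ptr A \<longleftrightarrow> B = A \<and> i = ptr A"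
    using row_major_inj[OF i A(2)] .
  have set: "{u. u < Suc v \<and> cls u = B \<and> (f(v := ptr A)) u = i} =
      (if B = A \<and> i = ptr A then insert v {u. u < v \<and> cls u = B \<and> f u = i}
       else {u. u < v \<and> cls u = B \<and> f u = i})"
    using A(1) by (auto simp: less_Suc_eq)
  show "(x(A * c + ptr A := x (A * c + ptr A) - Suc 0)) (B * c + i) +
      card {u. u < Suc v \<and> cls u = B \<and> (f(v := ptr A)) u = i} = X B i"
    unfolding set using old A(3) eq by auto
qed

lemma out_ok_advance:
  assumes ok: "out_ok X v x ptr f" and A: "ptr A < c" "x (A * c + ptr A) = 0"
  shows "out_ok X v x (ptr(A := Suc (ptr A))) f"
  using assms unfolding out_ok_def by (auto simp: less_Suc_eq)

text \<open>Once all vertices are placed, the placed vertices of each class account for its whole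
  row sum, so nothing remains in \<open>x\<close>.\<close>

lemma out_ok_final:
  assumes ok: "out_ok X n x ptr f" and X: "\<And>A. A < m \<Longrightarrow> (\<Sum>i<c. X A i) = sz A"
  shows "\<forall>v<n. f v < c" and "\<lbrakk>A < m; i < c\<rbrakk> \<Longrightarrow> X A i = counts f A i"
proof -
  show f: "\<forall>v<n. f v < c" using ok unfolding out_ok_def by blast
  assume A: "A < m" "i < c"
  have eq: "x (A * c + i) + counts f A i = X A i" if "i < c" for i
    using ok A(1) that unfolding out_ok_def counts_def by blast
  have "(\<Sum>i<c. x (A * c + i)) + (\<Sum>i<c. counts f A i) = (\<Sum>i<c. X A i)"
    unfolding sum.distrib[symmetric] using eq by (intro sum.cong) auto
  then have "(\<Sum>i<c. x (A * c + i)) = 0"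
    using X[OF A(1)] sum_counts_row[OF A(1) f] by simp
  then show "X A i = counts f A i" using eq[OF A(2)] A(2) by simp
qed

lemma ht_output_prog:
  assumes mem: "mem s" and ptr: "s ''ptr'' = (\<lambda>_. 0)"
    and x: "\<And>A i. \<lbrakk>A < m; i < c\<rbrakk> \<Longrightarrow> s ''x'' (A * c + i) = X A i"
    and X: "\<And>A. A < m \<Longrightarrow> (\<Sum>i<c. X A i) = sz A"
  shows "ht output_prog s (\<lambda>t s'. t \<le> 100 * (n + m * c) + 100 \<and> (\<forall>v<n. s' ''part'' v < c) \<and>
    (\<forall>A<m. \<forall>i<c. X A i = counts (s' ''part'') A i) \<and> agree {''v'', ''A'', ''x'', ''part'', ''ptr''} s s')"
    (is "ht _ s ?Q")
  unfolding output_prog_def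
proof (rule ht_Assign_SeqI)
  let ?W = "{''v'', ''A'', ''x'', ''part'', ''ptr''}"
  let ?s = "s(''v'' := (s ''v'')(aval (Const 0) s := aval (Const 0) s))"
  let ?b = "Less (Var ''v'') (Var ''n'')"
  let ?p = "Seq (Set ''A'' (Cell ''cls'' (Var ''v'')))
         (If (Less (Const 0) (Cell ''x'' (Plus (Cell ''cb'' (Var ''A'')) (Cell ''ptr'' (Var ''A'')))))
           (Block
             [Assign ''x'' (Plus (Cell ''cb'' (Var ''A'')) (Cell ''ptr'' (Var ''A'')))
                (Minus (Cell ''x'' (Plus (Cell ''cb'' (Var ''A'')) (Cell ''ptr'' (Var ''A'')))) (Const 1)),
              Assign ''part'' (Var ''v'') (Cell ''ptr'' (Var ''A'')),
              Incr ''v''])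
           (Assign ''ptr'' (Var ''A'') (Plus (Cell ''ptr'' (Var ''A'')) (Const 1))))"
  have wr: "writes ?p = ?W" by auto
  have a0: "agree ?W s ?s" unfolding agree_def by simp
  define I where "I s' \<longleftrightarrow> out_ok X (s' ''v'' 0) (s' ''x'') (s' ''ptr'') (s' ''part'')" for s' :: state
  define g where "g v ptr = (n - v) + (\<Sum>A<m. c - ptr A)" for v :: nat and ptr :: "nat \<Rightarrow> nat"
  define f where "f s' = g (s' ''v'' 0) (s' ''ptr'')" for s' :: state
  show "ht (While ?b ?p) ?s (\<lambda>t s'. t \<le> f ?s * (80 + bcost ?b + 1) + bcost ?b + 1 \<and> I s' \<and>
      agree (writes ?p) ?s s' \<and> \<not> bval ?b s')"
  proof (rule ht_While[where I = I and f = f])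
    show "I ?s" unfolding I_def out_ok_def using ptr x by simp
  next
    fix s' assume *: "I s'" "agree (writes ?p) ?s s'" "bval ?b s'"
    have ag: "agree ?W s s'" using agree_trans[OF a0] *(2) unfolding wr by blast
    have mem': "mem s'" by (rule mem_agree[OF ag _ mem]) (simp add: static_def)
    define v where "v = s' ''v'' 0"
    define A where "A = cls v"
    have v: "v < n" using *(3) mem' unfolding v_def mem_def inp_def by simp
    have A: "A < m" using cls_less[OF v] unfolding A_def .
    have M: "s' ''cls'' = cls" "s' ''cb'' A = A * c" using mem' A unfolding mem_def by auto
    have ok: "out_ok X v (s' ''x'') (s' ''ptr'') (s' ''part'')" using *(1) unfolding I_def v_def .
    have p: "s' ''ptr'' A < c" using out_ok_ptr[OF ok v X] unfolding A_def .
    show "ht ?p s' (\<lambda>t s''. t \<le> 80 \<and> I s'' \<and> f s'' < f s')"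
    proof (cases "s' ''x'' (A * c + s' ''ptr'' A) > 0")
      case True
      have "g (Suc v) (s' ''ptr'') < g v (s' ''ptr'')" unfolding g_def using v by simp
      then show ?thesis
        using True out_ok_assign[OF ok v A_def p True] M unfolding I_def f_def
        by (simp add: ht_simps flip: v_def A_def)
    next
      case False
      have "(\<Sum>B<m. c - ((s' ''ptr'')(A := Suc (s' ''ptr'' A))) B) < (\<Sum>B<m. c - (s' ''ptr'') B)"
        using A p by (intro sum_strict_mono_ex1) auto
      then have "g v ((s' ''ptr'')(A := Suc (s' ''ptr'' A))) < g v (s' ''ptr'')" unfolding g_def by simp
      then show ?thesis
        using False out_ok_advance[OF ok p] M unfolding I_def f_def
        by (simp add: ht_simps flip: v_def A_def)
    qed
  qed
  fix t s'
  assume "t \<le> f ?s * (80 + bcost ?b + 1) + bcost ?b + 1 \<and> I s' \<and>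
      agree (writes ?p) ?s s' \<and> \<not> bval ?b s'"
  then have t: "t \<le> f ?s * (80 + bcost ?b + 1) + bcost ?b + 1" and I: "I s'"
    and ag: "agree (writes ?p) ?s s'" and b: "\<not> bval ?b s'" by blast+
  have ag': "agree ?W s s'" using agree_trans[OF a0] ag unfolding wr by blast
  then have "s' ''n'' 0 = n" using mem unfolding mem_def inp_def agree_def by simp
  moreover have "s' ''v'' 0 \<le> n" using I unfolding I_def out_ok_def by blast
  ultimately have "s' ''v'' 0 = n" using b by simp
  then have ok: "out_ok X n (s' ''x'') (s' ''ptr'') (s' ''part'')" using I unfolding I_def by simp
  have "f ?s = n + m * c" unfolding f_def g_def using ptr by simp
  then have "acost (Const 0) + acost (Const 0) + 1 + t \<le> 100 * (n + m * c) + 100" using t by simp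
  moreover have "\<forall>v<n. s' ''part'' v < c"
    by (rule out_ok_final(1)[OF ok]) (rule X)
  moreover have "\<forall>A<m. \<forall>i<c. X A i = counts (s' ''part'') A i"
    by (intro allI impI, rule out_ok_final(2)[OF ok]) (use X in auto)
  ultimately show "?Q (acost (Const 0) + acost (Const 0) + 1 + t) s'"
    using ag' by (intro conjI)
qed

end

text \<open>Without vertices there are no classes, and the division by \<open>m = 0\<close> through
  repeated subtraction would not terminate. In that case the zero memory already encodes the
  answer.\<close>

definition partition_prog :: com where
  "partition_prog =
     If (Less (Const 0) (Var ''n''))
       (Seq cover_prog (Seq types_prog (Seq rows_prog (Seq nb_prog
         (Seq (Set ''r'' (Var ''n'')) (Seq (divmod_by ''r'' ''c'' ''q'') (Seq bound_prog main_prog)))))))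
       Skip"

section \<open>Existence of balanced partitions and the number of arcs\<close>

context balanced_input
begin

text \<open>Guarantees that the enumeration meets a complete run. Vertices are matched with the
  slots of boxes of the prescribed sizes, whose total is \<open>n\<close>.\<close>

lemma balanced_partition_exists: "\<exists>Q. balanced_partition V c Q"
proof -
  have "card (SIGMA i:{..<c}. {..<part_size n c i}) = n"
    using sum_part_size[OF c_pos] by simp
  then obtain g where g: "bij_betw g {..<n} (SIGMA i:{..<c}. {..<part_size n c i})"
    using finite_same_card_bij[of "{..<n}" "SIGMA i:{..<c}. {..<part_size n c i}"] by auto
  define f where "f v = fst (g v)" for v
  have f: "\<forall>v<n. f v < c"
  proof (intro allI impI)
    fix v assume "v < n"
    then have "g v \<in> (SIGMA i:{..<c}. {..<part_size n c i})" using bij_betwE[OF g] by simp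
    then show "f v < c" unfolding f_def by auto
  qed
  have "card {v. v < n \<and> f v = i} = part_size n c i" if i: "i < c" for i
  proof -
    have "bij_betw g {v \<in> {..<n}. fst (g v) = i}
        {y \<in> SIGMA i:{..<c}. {..<part_size n c i}. fst y = i}"
    proof -
      have "g ` {v \<in> {..<n}. fst (g v) = i} = {y \<in> g ` {..<n}. fst y = i}" by auto
      then show ?thesis using g unfolding bij_betw_def by (auto intro: inj_on_subset)
    qed
    moreover have "{y \<in> SIGMA i:{..<c}. {..<part_size n c i}. fst y = i} = {i} \<times> {..<part_size n c i}"
      using i by auto
    moreover have "{v \<in> {..<n}. fst (g v) = i} = {v. v < n \<and> f v = i}"
      unfolding f_def by auto
    ultimately show ?thesis using bij_betw_same_card by fastforce
  qed
  then show ?thesis using balanced_parts f by blast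
qed

lemma card_marked_le:
  assumes "vertex_cover V E S"
  shows "card {v. v < n \<and> vs ! v \<in> S} \<le> card S"
proof (rule card_inj_on_le[of "(!) vs"])
  show "inj_on ((!) vs) {v. v < n \<and> vs ! v \<in> S}"
    by (intro inj_onI) (auto dest: vs_inj)
  show "finite S"
    using assms graph unfolding vertex_cover_def simple_graph_def by (auto intro: finite_subset)
qed auto

text \<open>A vertex outside \<open>S\<close> has all its neighbours in \<open>S\<close>, hence
  degree at most |S|; the at most |S| vertices of \<open>S\<close> contribute at most
  \<open>n\<close> additional arcs each.\<close>

lemma arcs_le:
  assumes S: "vertex_cover V E S"
  shows "arcs \<le> 2 * card S * n"
proof -
  have off: "i \<le> n \<Longrightarrow> off i = (\<Sum>v<i. card (nbr v))" for i
    by (induction i) (auto simp: off_0 off_Suc distinct_card distinct_adj)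
  have "card (nbr v) \<le> card S + (if vs ! v \<in> S then n else 0)" if v: "v < n" for v
  proof (cases "vs ! v \<in> S")
    case True
    have "nbr v \<subseteq> {..<n}" using v nbr_iff by auto
    then have "card (nbr v) \<le> n" using card_mono[of "{..<n}" "nbr v"] by simp
    then show ?thesis using True by simp
  next
    case False
    have "nbr v \<subseteq> {u. u < n \<and> vs ! u \<in> S}"
    proof
      fix u assume "u \<in> nbr v"
      then have u: "u < n" "{vs ! v, vs ! u} \<in> E" using nbr_iff[OF v] by auto
      have "{vs ! v, vs ! u} \<inter> S \<noteq> {}"
        by (rule S[unfolded vertex_cover_def, THEN conjunct2, rule_format, OF u(2)])
      then show "u \<in> {u. u < n \<and> vs ! u \<in> S}" using False u(1) by auto
    qed
    then have "card (nbr v) \<le> card {u. u < n \<and> vs ! u \<in> S}" by (intro card_mono) auto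
    then show ?thesis using card_marked_le[OF S] by simp
  qed
  then have "arcs \<le> (\<Sum>v<n. card S + (if vs ! v \<in> S then n else 0))"
    using off[of n] off_n by (auto intro!: sum_mono)
  also have "\<dots> = n * card S + n * card {v. v < n \<and> vs ! v \<in> S}"
    by (simp add: sum.distrib sum.If_cases Collect_conj_eq lessThan_def)
  also have "\<dots> \<le> n * card S + n * card S"
    using card_marked_le[OF S] by (intro add_left_mono mult_le_mono2)
  finally show ?thesis by (simp add: algebra_simps)
qed

end

section \<open>Optimality of the output\<close>

context twin_classes
begin

lemma complete_below_bound:
  assumes "solution xs ps" "m > 0"
  obtains k where "k < bound" "complete k" "run_cost k \<le> cut_cost m K nb sz xs ps"
proof -
  have "(m * c) ^ (m + c) \<le> (2 ^ (m * c)) ^ (m + c)"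
    by (rule power_mono[OF less_imp_le[OF less_exp]]) simp
  also have "\<dots> = bound" unfolding bound_def by (simp add: power_mult)
  finally have le: "(m * c) ^ (m + c) \<le> bound" .
  obtain k where k: "k < (m * c) ^ (m + c)" "complete k" "run_cost k \<le> cut_cost m K nb sz xs ps"
    by (rule run_optimal[OF assms])
  show ?thesis by (rule that[OF order_less_le_trans[OF k(1) le] k(2,3)])
qed

lemma ht_main_prog:
  assumes mem: "mem s" and m: "m > 0" and ptr: "s ''ptr'' = (\<lambda>_. 0)"
  shows "ht main_prog s (\<lambda>t s'. t \<le> 6000 * bound ^ 3 + 100 * n \<and>
    optimal_balanced_partition V E c (parts vs (s' ''part'')) \<and>
    s' ''cut'' 0 = card (cut_edges E c (parts vs (s' ''part''))))"
    (is "ht _ s ?Q")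
  unfolding main_prog_def
proof (rule ht_SeqI[OF ht_enum_prog[OF mem m]], elim conjE)
  fix t1 s1
  assume t1: "t1 \<le> 3000 * bound ^ 3" and best: "best_ok bound (s1 ''fnd'' 0) (s1 ''bc'' 0) (s1 ''best'' 0)"
    and a1: "agree enum_vars s s1"
  have mem1: "mem s1" by (rule mem_agree[OF a1 _ mem]) (simp add: static_def)
  define b where "b = s1 ''bc'' 0"
  \<comment> \<open>A balanced partition yields a complete code below \<open>bound\<close>, which
    rules out \<open>fnd = 0\<close> after the search.\<close>
  obtain Q0 where "balanced_partition V c Q0" using balanced_partition_exists by blast
  then obtain xs ps where "solution xs ps" using solution_of_partition by blast
  then obtain k where "k < bound" "complete k" using complete_below_bound m by blast
  then have b: "b < bound" "complete b" "s1 ''best'' 0 = run_cost b"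
      "\<And>i. i < bound \<Longrightarrow> complete i \<Longrightarrow> run_cost b \<le> run_cost i"
    using best unfolding best_ok_def b_def by (cases "s1 ''fnd'' 0 = 0"; auto)+
  note sol = solution_run[OF b(2) m]
  let ?s = "s1(''cd'' := (s1 ''cd'')(0 := b))"
  have a2: "agree {''cd''} s1 ?s" unfolding agree_def by simp
  have mem2: "mem ?s" by (rule mem_agree[OF a2 _ mem1]) (simp add: static_def)
  have le: "?s ''cd'' 0 \<le> bound" using b(1) by simp
  have "ht (Seq greedy_prog (Seq (Set ''cut'' (Var ''best'')) output_prog)) ?s
      (\<lambda>u. ?Q (t1 + (acost (Const 0) + acost (Var ''bc'') + 1 + u)))"
  proof (rule ht_SeqI[OF ht_greedy_prog[OF mem2 m le]], elim conjE)
    fix t3 s3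
    assume t3: "t3 \<le> 1500 * bound * bound" and rel: "grel s3 (run (?s ''cd'' 0))"
      and a3: "agree greedy_vars ?s s3"
    let ?T = "\<lambda>u. t1 + (acost (Const 0) + acost (Var ''bc'') + 1 +
        (t3 + (acost (Const 0) + acost (Var ''best'') + 1 + u)))"
    let ?s4 = "s3(''cut'' := (s3 ''cut'')(0 := run_cost b))"
    have a4: "agree {''cut''} s3 ?s4" unfolding agree_def by simp
    have mem4: "mem ?s4"
      by (rule mem_agree[OF a4 _ mem_agree[OF a3 _ mem2]]) (simp_all add: static_def)
    have best3: "s3 ''best'' 0 = run_cost b" using a3 b(3) unfolding agree_def by simp
    have ptr4: "?s4 ''ptr'' = (\<lambda>_. 0)" using a1 a3 ptr unfolding agree_def by simp
    obtain x r d p where run: "run b = (x, r, d, p)" by (metis prod_cases4)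
    have x4: "?s4 ''x'' (A * c + i) = run_x b A i" if "A < m" "i < c" for A i
      using rel that run unfolding grel_def run_x_def by simp
    have X4: "(\<Sum>i<c. run_x b A i) = sz A" if "A < m" for A
      using sol that unfolding solution_def transport_def by blast
    have "ht output_prog ?s4 (\<lambda>u. ?Q (?T u))"
    proof (rule ht_mono[OF ht_output_prog[OF mem4 ptr4 x4 X4]], assumption, assumption, assumption, elim conjE)
      fix u s5
      assume u: "u \<le> 100 * (n + m * c) + 100" and part: "\<forall>v<n. s5 ''part'' v < c"
          "\<forall>A<m. \<forall>i<c. run_x b A i = counts (s5 ''part'') A i"
        and a5: "agree {''v'', ''A'', ''x'', ''part'', ''ptr''} ?s4 s5"
      have cut: "s5 ''cut'' 0 = run_cost b" using a5 unfolding agree_def by simp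
      have bal: "balanced_partition V c (parts vs (s5 ''part''))"
        by (rule partition_of_solution(1)[OF sol part(1)]) (use part(2) in blast)
      have cost: "run_cost b = card (cut_edges E c (parts vs (s5 ''part'')))"
        unfolding run_cost_def
        by (rule partition_of_solution(2)[OF sol part(1)]) (use part(2) in blast)
      have "optimal_balanced_partition V E c (parts vs (s5 ''part''))"
        unfolding optimal_balanced_partition_def
      proof (intro conjI allI impI)
        show "balanced_partition V c (parts vs (s5 ''part''))" by (rule bal)
        fix Q assume "balanced_partition V c Q"
        then obtain xs ps where xs: "solution xs ps"
            "cut_cost m K nb sz xs ps = card (cut_edges E c Q)"
          using solution_of_partition by blast
        obtain k where "k < bound" "complete k" "run_cost k \<le> cut_cost m K nb sz xs ps"
          using complete_below_bound[OF xs(1) m] by blast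
        then show "card (cut_edges E c (parts vs (s5 ''part''))) \<le> card (cut_edges E c Q)"
          using b(4) xs(2) cost by (metis le_trans)
      qed
      moreover have "?T u \<le> 6000 * bound ^ 3 + 100 * n"
      proof -
        have B: "1 \<le> bound" using bound_ge(6)[OF m] by simp
        have "1 \<le> bound ^ 3" "bound ^ 1 \<le> bound ^ 3" "bound ^ 2 \<le> bound ^ 3"
          using B by (intro one_le_power power_increasing; simp)+
        moreover have "t3 \<le> 1500 * bound ^ 2" using t3 by (simp add: power2_eq_square)
        moreover have "m * c \<le> bound" by (rule bound_ge(1)[OF m])
        moreover have "u \<le> 100 * n + 100 * (m * c) + 100" using u by simp
        ultimately show ?thesis using t1 by simp
      qed
      ultimately show "?Q (?T u) s5"
        using cut cost by (intro conjI) simp_all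
    qed
    then show "ht (Seq (Set ''cut'' (Var ''best'')) output_prog) s3
        (\<lambda>u. ?Q (t1 + (acost (Const 0) + acost (Var ''bc'') + 1 + (t3 + u))))"
      unfolding ht_Seq[of "Set ''cut'' (Var ''best'')"] ht_Assign[of "''cut''"] using best3 by simp
  qed
  then show "ht (Seq (Set ''cd'' (Var ''bc'')) (Seq greedy_prog
      (Seq (Set ''cut'' (Var ''best'')) output_prog))) s1 (\<lambda>u. ?Q (t1 + u))"
    unfolding ht_Seq[of "Set ''cd'' (Var ''bc'')"] ht_Assign[of "''cd''"] b_def by simp
qed

end

section \<open>The algorithm and its running time\<close>

context balanced_input
begin

text \<open>\<open>K\<close> and \<open>m\<close> are computed during the run, so the locales are
  interpreted with arrays read off from intermediate states, and only the bounds on \<open>K\<close>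
  and \<open>m\<close> are passed on.\<close>

lemma ht_partition_prog:
  assumes S: "vertex_cover V E S" and n: "n > 0"
  shows "\<exists>K m. K \<le> 2 * card S \<and> m \<le> K + 2 ^ K \<and>
    ht partition_prog (input_state adj c) (\<lambda>t s'.
      t \<le> 2000 * (n + arcs) + 10000 * (2 ^ (m * c * (m + c))) ^ 3 \<and>
      optimal_balanced_partition V E c (parts vs (s' ''part'')) \<and>
      s' ''cut'' 0 = card (cut_edges E c (parts vs (s' ''part''))))"
proof -
  let ?s0 = "input_state adj c"
  have zero: "?s0 x = (\<lambda>_. 0)" if "x \<notin> {''n'', ''c'', ''off'', ''adj''}" for x
    using that unfolding input_state_def by simp
  have inp0: "inp ?s0" by (rule inp_input_state)
  obtain t1 s1 where e1: "exec cover_prog ?s0 t1 s1" and t1: "t1 \<le> (n + arcs) * 200 + 200"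
      and inp1: "inp s1" and ok1: "cover_ok S arcs (s1 ''ix'') (s1 ''pw'') (s1 ''K'' 0) (s1 ''P'' 0)"
      and a1: "agree {''ix'', ''pw'', ''K'', ''P'', ''v'', ''e''} ?s0 s1"
    using ht_cover_prog[OF inp0 S] zero unfolding ht_def by auto
  define ix where "ix = s1 ''ix''"
  define K where "K = s1 ''K'' 0"
  have z1: "s1 x = (\<lambda>_. 0)"
    if "x \<notin> {''n'', ''c'', ''off'', ''adj''} \<union> {''ix'', ''pw'', ''K'', ''P'', ''v'', ''e''}" for x
    using agreeD[OF a1, of x] zero[of x] that by simp
  interpret ci: cover_index V E c vs adj ix K
  proof
    show "bij_betw ix {v. v < n \<and> ix v > 0} {1..K}"
      using ok1 unfolding cover_ok_def ix_def K_def by simp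
    fix v u assume v: "v < n" "u \<in> nbr v"
    then obtain x where x: "x \<in> src v" "u = nbr_at x"
      using bij_src[OF v(1)] unfolding bij_betw_def by blast
    then show "ix v > 0 \<or> ix u > 0"
      using ok1 src_less[OF v(1) x(1)] v(1) unfolding cover_ok_def ix_def by auto
  qed
  have K2: "K \<le> 2 * card S"
  proof -
    have "card {v. v < n \<and> ix v > 0 \<and> vs ! v \<in> S} \<le> card {v. v < n \<and> vs ! v \<in> S}"
      by (intro card_mono) auto
    also have "\<dots> \<le> card S" by (rule card_marked_le[OF S])
    finally show ?thesis using ok1 unfolding cover_ok_def ix_def K_def by simp
  qed
  have pw1: "s1 ''pw'' u = (if ix u = 0 then 0 else 2 ^ (ix u - 1))" if "u < n" for u
    using ok1 that unfolding cover_ok_def ix_def by simp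
  have "ht types_prog s1 (\<lambda>t s'. t \<le> (n + arcs) * 200 + 200 \<and> inp s' \<and>
    ci.types_ok n (s' ''m'' 0) (s' ''cl'') (s' ''cls'') (s' ''sz'') \<and>
    agree {''m'', ''cl'', ''cls'', ''sz'', ''ty'', ''A'', ''v'', ''e''} s1 s')"
    by (rule ci.ht_types_prog[OF inp1 ix_def[symmetric] K_def[symmetric] pw1]) (simp_all add: z1)
  then obtain t2 s2 where e2: "exec types_prog s1 t2 s2" and t2: "t2 \<le> (n + arcs) * 200 + 200"
      and inp2: "inp s2" and ok2: "ci.types_ok n (s2 ''m'' 0) (s2 ''cl'') (s2 ''cls'') (s2 ''sz'')"
      and a2: "agree {''m'', ''cl'', ''cls'', ''sz'', ''ty'', ''A'', ''v'', ''e''} s1 s2"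
    unfolding ht_def by blast
  define m where "m = s2 ''m'' 0"
  define cls where "cls = s2 ''cls''"
  define sz where "sz = s2 ''sz''"
  have ok2': "ci.types_ok n m (s2 ''cl'') cls sz"
    using ok2 unfolding m_def cls_def sz_def .
  obtain t3 s3 where e3: "exec rows_prog s2 t3 s3" and t3: "t3 \<le> 100 * s2 ''m'' 0 + 100"
      and rows: "\<forall>A<s2 ''m'' 0. s3 ''cb'' A = A * s2 ''c'' 0 \<and> s3 ''kb'' A = A * s2 ''K'' 0"
      "s3 ''M'' 0 = s2 ''m'' 0 * s2 ''c'' 0"
      and a3: "agree {''A'', ''a'', ''b'', ''cb'', ''kb'', ''M''} s2 s3"
    using ht_rows_prog[of s2] unfolding ht_def by blast
  have c2: "s2 ''c'' 0 = c" "s2 ''K'' 0 = K"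
    using inp2 agreeD[OF a2, of "''K''"] unfolding inp_def K_def by simp_all
  have inp3: "inp s3" by (rule inp_agree[OF a3 _ inp2]) simp
  have s3: "s3 ''ix'' = ix" "s3 ''cls'' = cls" "s3 ''sz'' = sz" "s3 ''m'' 0 = m" "s3 ''K'' 0 = K"
    using a2 a3 c2 unfolding agree_def ix_def cls_def sz_def m_def by simp_all
  have cls_less: "cls v < m" if "v < n" for v
    using ok2' that unfolding ci.types_ok_def by blast
  have kb: "s3 ''kb'' A = A * K" if "A < m" for A using rows c2 that unfolding m_def by simp
  have nb0: "s3 ''nb'' = (\<lambda>_. 0)"
    using a2 a3 z1[of "''nb''"] unfolding agree_def by simp
  have "ht nb_prog s3 (\<lambda>t s'. t \<le> (n + arcs) * 200 + 200 \<and> inp s' \<and>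
    ci.nb_ok m cls arcs (s' ''nb'') \<and> agree {''nb'', ''v'', ''e''} s3 s')"
    by (rule ci.ht_nb_prog[OF inp3 s3(1,2) cls_less kb nb0])
  then obtain t4 s4 where e4: "exec nb_prog s3 t4 s4" and t4: "t4 \<le> (n + arcs) * 200 + 200"
      and inp4: "inp s4" and ok4: "ci.nb_ok m cls arcs (s4 ''nb'')"
      and a4: "agree {''nb'', ''v'', ''e''} s3 s4"
    unfolding ht_def by blast
  let ?nb = "\<lambda>A j. s4 ''nb'' (A * K + j) > 0"
  note fin = ci.types_ok_final[OF ok2', of ?nb, OF ci.nb_ok_final[OF ok4]]
  interpret tc: twin_classes V E c vs adj ix K m cls sz ?nb
    by (rule fin(1))
  have mK: "m \<le> K + 2 ^ K" by (rule fin(2))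
  have m: "m > 0" using cls_less[OF n] by simp
  have c4: "s4 ''c'' 0 = c" "s4 ''n'' 0 = n" using inp4 unfolding inp_def by simp_all
  let ?s5 = "s4(''r'' := (s4 ''r'')(0 := n))"
  have e5: "exec (Set ''r'' (Var ''n'')) s4 4 ?s5"
    using exec.Assign[of "''r''" "Const 0" "Var ''n''" s4] c4
    by (simp add: eval_nat_numeral)
  have "ht (divmod_by ''r'' ''c'' ''q'') ?s5 (\<lambda>t s'. t \<le> 30 * ?s5 ''r'' 0 + 30 \<and>
    s' = ?s5(''r'' := (?s5 ''r'')(0 := ?s5 ''r'' 0 mod ?s5 ''c'' 0),
      ''q'' := (?s5 ''q'')(0 := ?s5 ''r'' 0 div ?s5 ''c'' 0)))"
    by (rule ht_divmod_by) (use c4 c_pos in auto)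
  then obtain t6 s6 where e6: "exec (divmod_by ''r'' ''c'' ''q'') ?s5 t6 s6" and t6: "t6 \<le> 30 * n + 30"
      and s6: "s6 = ?s5(''r'' := (?s5 ''r'')(0 := n mod c), ''q'' := (?s5 ''q'')(0 := n div c))"
    unfolding ht_def using c4 by auto
  obtain t7 s7 where e7: "exec bound_prog s6 t7 s7"
      and t7: "t7 \<le> (s6 ''m'' 0 + s6 ''c'' 0) * (50 * s6 ''M'' 0 + 100) + 50"
      and bb: "s7 ''bb'' 0 = 2 ^ (s6 ''M'' 0 * (s6 ''m'' 0 + s6 ''c'' 0))"
      and a7: "agree {''bb'', ''i'', ''j''} s6 s7"
    using ht_bound_prog[of s6] unfolding ht_def by blast
  have a47: "agree {''r'', ''q'', ''bb'', ''i'', ''j''} s4 s7"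
    using a7 unfolding agree_def s6 by simp
  have s4: "s4 ''cls'' = cls" "s4 ''sz'' = sz" "s4 ''m'' 0 = m" "s4 ''K'' 0 = K"
    "s4 ''M'' = s3 ''M''" "s4 ''cb'' = s3 ''cb''" "s4 ''kb'' = s3 ''kb''"
    using a4 s3 unfolding agree_def by simp_all
  have M3: "s3 ''M'' 0 = m * c" using rows(2) c2 unfolding m_def by simp
  have s6': "s6 ''m'' 0 = m" "s6 ''c'' 0 = c" "s6 ''M'' 0 = m * c"
    unfolding s6 using s4 c4 M3 by simp_all
  have inp7: "inp s7" by (rule inp_agree[OF a47 _ inp4]) simp
  have s7: "s7 ''cls'' = cls" "s7 ''sz'' = sz" "s7 ''m'' 0 = m" "s7 ''K'' 0 = K"
    "s7 ''M'' 0 = m * c" "s7 ''cb'' = s3 ''cb''" "s7 ''kb'' = s3 ''kb''" "s7 ''nb'' = s4 ''nb''"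
    using a47 s4 M3 unfolding agree_def by simp_all
  have qr: "s7 ''q'' 0 = n div c" "s7 ''r'' 0 = n mod c"
    using a7 unfolding agree_def s6 by simp_all
  have cb: "s3 ''cb'' A = A * c" if "A < m" for A using rows c2 that unfolding m_def by simp
  have mem7: "tc.mem s7"
    unfolding tc.mem_def tc.bound_def
    using inp7 s7 qr bb s6' cb kb by (intro conjI allI impI) simp_all
  have ptr7: "s7 ''ptr'' = (\<lambda>_. 0)"
    using a47 a4 a3 a2 z1[of "''ptr''"] unfolding agree_def by simp
  obtain t8 s8 where e8: "exec main_prog s7 t8 s8" and t8: "t8 \<le> 6000 * tc.bound ^ 3 + 100 * n"
      and opt: "optimal_balanced_partition V E c (parts vs (s8 ''part''))"
      and cut: "s8 ''cut'' 0 = card (cut_edges E c (parts vs (s8 ''part'')))"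
    using tc.ht_main_prog[OF mem7 m ptr7] unfolding ht_def by blast
  define T where "T = t1 + (t2 + (t3 + (t4 + (4 + (t6 + (t7 + t8))))))"
  have e: "exec partition_prog ?s0 (bcost (Less (Const 0) (Var ''n'')) + 1 + T) s8"
    unfolding partition_prog_def T_def
    by (rule IfTrue) (use inp0 n in \<open>simp add: inp_def\<close>,
      intro exec.Seq[OF e1] exec.Seq[OF e2] exec.Seq[OF e3] exec.Seq[OF e4] exec.Seq[OF e5]
        exec.Seq[OF e6] exec.Seq[OF e7] e8)
  define B where "B = tc.bound ^ 3"
  have b1: "1 \<le> tc.bound" using tc.bound_ge(6)[OF m] by simp
  have "1 \<le> B" "tc.bound ^ 1 \<le> B" "tc.bound ^ 2 \<le> B"
    unfolding B_def using b1 by (intro one_le_power power_increasing; simp)+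
  then have pow: "1 \<le> B" "tc.bound \<le> B" "tc.bound * tc.bound \<le> B"
    by (simp_all add: power2_eq_square)
  have m_le: "m \<le> B" using tc.bound_ge(3)[OF m] pow(2) by linarith
  have t7': "t7 \<le> 200 * B"
  proof -
    have "t7 \<le> (m + c) * (50 * (m * c) + 100) + 50" using t7 s6' by simp
    also have "\<dots> \<le> tc.bound * (50 * tc.bound + 100 * tc.bound) + 50 * B"
      using tc.bound_ge(1,2)[OF m] b1 pow(1) by (intro add_mono mult_le_mono) auto
    also have "\<dots> = 150 * (tc.bound * tc.bound) + 50 * B" by simp
    also have "\<dots> \<le> 200 * B" using pow(3) by simp
    finally show ?thesis .
  qed
  have "T \<le> 600 * (n + arcs) + 130 * n + 8000 * B"
  proof -
    have "t3 \<le> 200 * B" using t3 m_le pow(1) unfolding m_def by simp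
    moreover have "t8 \<le> 6000 * B + 100 * n" using t8 unfolding B_def .
    ultimately show ?thesis
      unfolding T_def using t1 t2 t4 t6 t7' pow(1) by (simp add: algebra_simps)
  qed
  then have "bcost (Less (Const 0) (Var ''n'')) + 1 + T \<le> 2000 * (n + arcs) + 10000 * B"
    using pow(1) by simp
  then have "bcost (Less (Const 0) (Var ''n'')) + 1 + T \<le>
      2000 * (n + arcs) + 10000 * (2 ^ (m * c * (m + c))) ^ 3"
    unfolding B_def tc.bound_def .
  then show ?thesis
    unfolding ht_def using K2 mK e opt cut by blast
qed

end

section \<open>Arithmetic of the time bound\<close>

lemma time_bound:
  fixes k c n arcs K m t :: nat
  assumes K: "K \<le> 2 * k" and m: "m \<le> K + 2 ^ K" and c: "c \<ge> 1" and arcs: "arcs \<le> 2 * k * n"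
    and t: "t \<le> 2000 * (n + arcs) + 10000 * (2 ^ (m * c * (m + c))) ^ 3"
  shows "t \<le> 2 ^ (2 ^ (9 * (k + c))) + 4000 * (2 ^ k * n)"
proof -
  \<comment> \<open>The arcs cost a factor \<open>1 + 2 * k\<close> on \<open>n\<close>; bounding it
    by twice 2^k turns 2000 into 4000.\<close>
  have "1 + 2 * k \<le> 2 * 2 ^ k" using less_exp[of k] by linarith
  then have "(1 + 2 * k) * n \<le> 2 * 2 ^ k * n" by (rule mult_le_mono1)
  then have lin: "2000 * (n + arcs) \<le> 4000 * (2 ^ k * n)"
    using arcs by (simp add: algebra_simps)
  have "K < 2 ^ K" by (rule less_exp)
  then have "m \<le> 2 ^ Suc K" using m unfolding power_Suc by linarith
  also have "\<dots> \<le> 2 ^ (2 * k + 1)" using K by (intro power_increasing) auto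
  finally have m2: "m \<le> 2 ^ (2 * k + 1)" .
  have c2: "c \<le> 2 ^ c" by (rule less_imp_le[OF less_exp])
  have "m * c \<le> 2 ^ (2 * k + 1) * 2 ^ c" using m2 c2 by (rule mult_le_mono)
  also have "\<dots> = 2 ^ (2 * k + 1 + c)" by (simp add: power_add)
  finally have mc: "m * c \<le> 2 ^ (2 * k + 1 + c)" .
  have "(2::nat) ^ (2 * k + 1) \<le> 2 ^ (2 * k + 1 + c)" "(2::nat) ^ c \<le> 2 ^ (2 * k + 1 + c)"
    by (intro power_increasing; simp)+
  then have "m + c \<le> 2 ^ (2 * k + 1 + c) + 2 ^ (2 * k + 1 + c)"
    using m2 c2 by (meson add_mono order_trans)
  then have mpc: "m + c \<le> 2 ^ (2 * k + 2 + c)" by simp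
  have "m * c * (m + c) \<le> 2 ^ (2 * k + 1 + c) * 2 ^ (2 * k + 2 + c)"
    using mc mpc by (rule mult_le_mono)
  also have "\<dots> = 2 ^ (4 * k + 3 + 2 * c)"
    unfolding power_add[symmetric] by (rule arg_cong[of _ _ "(^) 2"]) simp
  \<comment> \<open>The summand 3 is absorbed by \<open>3 * c\<close>, as
    \<open>c >= 1\<close>.\<close>
  also have "\<dots> \<le> 2 ^ (5 * (k + c))" using c by (intro power_increasing) auto
  finally have e: "m * c * (m + c) \<le> 2 ^ (5 * (k + c))" .
  have "10000 * (2 ^ (m * c * (m + c))) ^ 3 = (10000::nat) * 2 ^ (3 * (m * c * (m + c)))"
    by (simp add: power_mult mult.commute[of 3])
  \<comment> \<open>10000 is below 2^14; the factor 3 in the exponent comes from the cube of the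
    number of codes.\<close>
  also have "\<dots> \<le> 2 ^ 14 * 2 ^ (3 * 2 ^ (5 * (k + c)))"
    using e by (intro mult_le_mono power_increasing) auto
  also have "\<dots> = 2 ^ (14 + 3 * 2 ^ (5 * (k + c)))" by (simp only: power_add)
  also have "\<dots> \<le> 2 ^ (2 ^ (9 * (k + c)))"
  proof (intro power_increasing)
    \<comment> \<open>For y = 2^(5 (k + c)) one needs 14 <= 13 y, true from y = 2 on. The factor 16
      then adds 4 to the exponent, and \<open>c >= 1\<close> turns 5 (k + c) + 4 into at most 9 (k +
      c).\<close>
    have "1 \<le> (2::nat) ^ (5 * (k + c))" by simp
    moreover have "(2::nat) ^ 1 \<le> 2 ^ (5 * (k + c))" using c by (intro power_increasing) auto
    ultimately have "14 + 3 * 2 ^ (5 * (k + c)) \<le> (16::nat) * 2 ^ (5 * (k + c))" by simp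
    also have "\<dots> = 2 ^ (5 * (k + c) + 4)" by (simp add: power_add)
    also have "\<dots> \<le> 2 ^ (9 * (k + c))" using c by (intro power_increasing) auto
    finally show "14 + 3 * 2 ^ (5 * (k + c)) \<le> (2::nat) ^ (9 * (k + c))" .
  qed simp
  finally show ?thesis using t lin by linarith
qed

theorem theorem5:
  "\<exists>(p :: com) (a :: nat) (b :: nat).
     \<forall>(V :: nat set) (E :: nat set set) (S :: nat set) (k :: nat) (c :: nat)
      (vs :: nat list) (adj :: nat list list).
       simple_graph V E \<and> vertex_cover V E S \<and> card S = k \<and> c \<ge> 1 \<and>
       adjacency_lists V E vs adj \<longrightarrow>
       (\<exists>t s. exec p (input_state adj c) t s \<and>
          optimal_balanced_partition V E c (output_partition vs s) \<and>
          output_cut_size s = card (cut_edges E c (output_partition vs s)) \<and>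
          t \<le> 2 ^ (2 ^ (a * (k + c))) + b * (2 ^ k * card V))"
proof (rule exI[of _ partition_prog], rule exI[of _ 9], rule exI[of _ 4000], intro allI impI, elim conjE)
  fix V :: "nat set" and E :: "nat set set" and S :: "nat set" and k c :: nat
    and vs :: "nat list" and adj :: "nat list list"
  assume graph: "simple_graph V E" and S: "vertex_cover V E S" and k: "card S = k" and c: "c \<ge> 1"
    and lists: "adjacency_lists V E vs adj"
  interpret balanced_input V E c vs adj
    by unfold_locales (use graph c lists in auto)
  show "\<exists>t s. exec partition_prog (input_state adj c) t s \<and>
          optimal_balanced_partition V E c (output_partition vs s) \<and>
          output_cut_size s = card (cut_edges E c (output_partition vs s)) \<and>
          t \<le> 2 ^ (2 ^ (9 * (k + c))) + 4000 * (2 ^ k * card V)"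
  proof (cases "n > 0")
    case True
    obtain K m t s where *: "K \<le> 2 * card S" "m \<le> K + 2 ^ K"
        "exec partition_prog (input_state adj c) t s"
        "t \<le> 2000 * (n + arcs) + 10000 * (2 ^ (m * c * (m + c))) ^ 3"
        "optimal_balanced_partition V E c (parts vs (s ''part''))"
        "s ''cut'' 0 = card (cut_edges E c (parts vs (s ''part'')))"
      using ht_partition_prog[OF S True] unfolding ht_def by blast
    have "t \<le> 2 ^ (2 ^ (9 * (k + c))) + 4000 * (2 ^ k * card V)"
      using time_bound[OF _ *(2) c _ *(4)] *(1) arcs_le[OF S] unfolding k card_V by blast
    then show ?thesis using * unfolding output_partition_eq output_cut_size_def by blast
  next
    case False
    let ?s = "input_state adj c"
    have vs_empty: "vs = []" "V = {}" using False vs(2) by auto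
    have E_empty: "E = {}" using graph unfolding vs_empty simple_graph_def by fastforce
    have out: "output_partition vs ?s = (\<lambda>_. {})"
      unfolding output_partition_def vs_empty by (rule ext) simp
    \<comment> \<open>Evaluating the guard takes 4 units, branching 1 and \<open>Skip\<close>
      1.\<close>
    have "exec partition_prog ?s 6 ?s"
    proof -
      have "?s ''n'' 0 = 0" using inp_input_state False unfolding inp_def by simp
      then show ?thesis
        using IfFalse[OF _ exec.Skip, of "Less (Const 0) (Var ''n'')" ?s] unfolding partition_prog_def
        by (simp add: eval_nat_numeral)
    qed
    moreover have "optimal_balanced_partition V E c (\<lambda>_. {})"
      unfolding optimal_balanced_partition_def balanced_partition_def cut_edges_def
        vs_empty(2) E_empty disjoint_family_on_def by simp
    then have "optimal_balanced_partition V E c (output_partition vs ?s)"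
      unfolding out .
    moreover have "output_cut_size ?s = card (cut_edges E c (output_partition vs ?s))"
      unfolding output_cut_size_def cut_edges_def E_empty input_state_def by simp
    moreover have "6 \<le> (2::nat) ^ (2 ^ (9 * (k + c)))"
    proof -
      have "(2::nat) ^ 9 \<le> 2 ^ (9 * (k + c))" using c by (intro power_increasing) auto
      then have "(3::nat) \<le> 2 ^ (9 * (k + c))" by simp
      then have "(2::nat) ^ 3 \<le> 2 ^ (2 ^ (9 * (k + c)))" by (intro power_increasing) auto
      then show ?thesis by simp
    qed
    ultimately show ?thesis by (meson trans_le_add1)
  qed
qed

end
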